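(* Let $A\in C^\infty(\mathbb R_+\times\mathbb R^n,\mathbb C^{m\times m})\cap L^\infty(\mathbb R_+,S^1(\mathbb R^n))$, fix $N>0$, and assume (A1)$_{0,\infty}$ with $\nu=0$ and (A2) (with $\nu=0$). Let $\mathcal E(t,s,\xi)$ solve $\mathrm D_t\mathcal E(t,s,\xi)=A(t,\xi)\mathcal E(t,s,\xi)$, $\mathcal E(s,s,\xi)=I$. Then (A3) holds if and only if there exists $C>0$ such that $$C^{-1}\|V\|\le\|\mathcal E(t,s,\xi)V\|\le C\|V\|$$ for all $V\in\mathbb C^m$ and all $(t,\xi),(s,\xi)\in Z_{hyp}(N,0)$.
   Context: $\mathrm D_t=-i\partial_t$, $\mathrm D_\xi=-i\partial_\xi$, $\operatorname{Im}B=\frac1{2i}(B-B^* )$; $\operatorname{diag}$ = diagonal matrix / diagonal part. Here $\nu=0$: $t_\xi\ge0$ is defined by $(1+t_\xi)|\xi|=N$ ($t_\xi=0$ if $|\xi|\ge N$) and $Z_{hyp}(N,0)=\{(t,\xi):t\ge t_\xi\}$. $\chi_{hyp}(t,\xi)=1-\chi(|\xi|(1+t)/N)$ for a fixed cut-off $\chi$ localising to $\{t\le t_\xi\}$. Symbol classes: $a\in\mathcal S^{\ell_1,\ell_2}_{N,0}\{m_1,m_2\}$ iff $|\mathrm D_t^k\mathrm D_\xi^\alpha a|\le C_{k,\alpha}|\xi|_t^{m_1-|\alpha|}(1+t)^{-m_2-k}$ for $|\alpha|\le\ell_1$, $k\le\ell_2$, where $|\xi|_t=\max(|\xi|,N/(1+t))$.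 (A1)$_{0,\infty}$: $A\in\mathcal S^{0,\infty}_{N,0}\{1,0\}$ and all eigenvalues of $A(t,\xi)$ lie in a strip $|\operatorname{Im}\zeta|\le c$ for $(t,\xi)\in Z_{hyp}(N,0)$. (A2): there is $A_1(t,\xi)$ homogeneous of order one in $\xi$ with $A-A_1\chi_{hyp}\in\mathcal S^{0,\infty}_{N,0}\{0,1\}$, having real distinct eigenvalues $\lambda_1<\dots<\lambda_m$ in $\mathcal S^{0,\infty}_{N,0}\{1,0\}$, with $\liminf_{t\to\infty}\min_{|\omega|=1}|\lambda_i(t,\omega)-\lambda_j(t,\omega)|>0$ for $i\ne j$. (A3): for an invertible $M$ with $M,M^{-1}\in\mathcal S^{0,\infty}_{N,0}\{0,0\}$ and $A_1M=M\operatorname{diag}(\lambda_1,\dots,\lambda_m)$, and $F_0=\operatorname{diag}(M^{-1}(A-A_1)M-M^{-1}\mathrm D_tM)$: $\sup_{(s,\xi),(t,\xi)\in Z_{hyp}(N,0)}\|\int_s^t\operatorname{Im}F_0(\theta,\xi)\mathrm d\theta\|<\infty$. *)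

theory Defs
  imports "HOL-Analysis.Analysis"
begin

text \<open>Hyperbolic zone Z_hyp(N,0) = {(t,xi). t >= t_xi}, where (1+t_xi)|xi| = N
  (t_xi = 0 if |xi| >= N).  Written without t_xi so that xi = 0 (t_xi = infinity)
  is correctly excluded.\<close>
definition Zhyp :: "real \<Rightarrow> (real \<times> (real^'n)) set" where
  "Zhyp N = {(t, \<xi>). 0 \<le> t \<and> N \<le> (1 + t) * norm \<xi>}"

definition Zall :: "(real \<times> (real^'n)) set" where
  "Zall = {(t, \<xi>). 0 \<le> t}"

definition xi_t :: "real \<Rightarrow> real \<Rightarrow> real^'n \<Rightarrow> real" where
  "xi_t N t \<xi> = max (norm \<xi>) (N / (1 + t))"

definition chi_hyp :: "(real \<Rightarrow> real) \<Rightarrow> real \<Rightarrow> real \<Rightarrow> real^'n \<Rightarrow> real" where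
  "chi_hyp cf N t \<xi> = 1 - cf (norm \<xi> * (1 + t) / N)"

definition tD :: "(real \<times> 'a) set \<Rightarrow> (real \<Rightarrow> 'a \<Rightarrow> 'b::real_normed_vector) \<Rightarrow> nat \<Rightarrow> real \<Rightarrow> 'a \<Rightarrow> 'b" where
  "tD Z a k = ((\<lambda>g t \<xi>. vector_derivative (\<lambda>s. g s \<xi>) (at t within {s. (s, \<xi>) \<in> Z})) ^^ k) a"

text \<open>a in S^{0,infinity}_{N,0}{m1,m2} on Z: all t-derivatives exist and
  |D_t^k a| <= C_k |xi|_t^m1 (1+t)^(-m2-k) on Z  (D_t = -i d/dt has the same norm).\<close>
definition symb0inf :: "(real \<times> (real^'n)) set \<Rightarrow> real \<Rightarrow> real \<Rightarrow> real \<Rightarrow>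
    (real \<Rightarrow> real^'n \<Rightarrow> 'b::real_normed_vector) \<Rightarrow> bool" where
  "symb0inf Z N m1 m2 a \<longleftrightarrow>
     (\<forall>k. \<forall>(t, \<xi>) \<in> Z. (\<lambda>s. tD Z a k s \<xi>) differentiable (at t within {s. (s, \<xi>) \<in> Z})) \<and>
     (\<forall>k. \<exists>C. \<forall>(t, \<xi>) \<in> Z. norm (tD Z a k t \<xi>) \<le> C * xi_t N t \<xi> powr m1 * (1 + t) powr (- m2 - real k))"

datatype 'n dop = Dt | Dx 'n

fun pder :: "'n dop \<Rightarrow> (real \<Rightarrow> real^'n \<Rightarrow> 'b::real_normed_vector) \<Rightarrow> real \<Rightarrow> real^'n \<Rightarrow> 'b" where
  "pder Dt f = (\<lambda>t \<xi>. vector_derivative (\<lambda>s. f s \<xi>) (at t within {0..}))"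
| "pder (Dx j) f = (\<lambda>t \<xi>. vector_derivative (\<lambda>h. f t (\<xi> + h *\<^sub>R axis j 1)) (at 0))"

fun pD :: "'n dop list \<Rightarrow> (real \<Rightarrow> real^'n \<Rightarrow> 'b::real_normed_vector) \<Rightarrow> real \<Rightarrow> real^'n \<Rightarrow> 'b" where
  "pD [] f = f"
| "pD (d # ds) f = pder d (pD ds f)"

definition smooth_tx :: "(real \<Rightarrow> real^'n \<Rightarrow> 'b::real_normed_vector) \<Rightarrow> bool" where
  "smooth_tx f \<longleftrightarrow>
     (\<forall>ds. continuous_on ({0..} \<times> UNIV) (\<lambda>(t, \<xi>). pD ds f t \<xi>)) \<and>
     (\<forall>ds t \<xi>. 0 \<le> t \<longrightarrow> (\<lambda>s. pD ds f s \<xi>) differentiable (at t within {0..})) \<and>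
     (\<forall>ds t \<xi> j. 0 \<le> t \<longrightarrow> (\<lambda>h. pD ds f t (\<xi> + h *\<^sub>R axis j 1)) differentiable (at 0))"

text \<open>A in L^infinity(R_+, S^1(R^n)): |d_xi^alpha A(t,xi)| <= C_alpha <xi>^(1-|alpha|)
  uniformly in t >= 0 (multi-indices given as lists of coordinate directions).\<close>
definition Linf_S1 :: "(real \<Rightarrow> real^'n \<Rightarrow> 'b::real_normed_vector) \<Rightarrow> bool" where
  "Linf_S1 f \<longleftrightarrow> (\<forall>js. \<exists>C. \<forall>t \<xi>. 0 \<le> t \<longrightarrow>
      norm (pD (map Dx js) f t \<xi>) \<le> C * sqrt (1 + (norm \<xi>)\<^sup>2) powr (1 - real (length js)))"

definition smooth_real :: "(real \<Rightarrow> real) \<Rightarrow> bool" where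
  "smooth_real f \<longleftrightarrow> (\<forall>k x. ((deriv ^^ k) f) differentiable (at x))"

definition is_eigenvalue :: "complex^'m^'m \<Rightarrow> complex \<Rightarrow> bool" where
  "is_eigenvalue B \<zeta> \<longleftrightarrow> (\<exists>v. v \<noteq> 0 \<and> B *v v = \<zeta> *s v)"

definition cmat_adj :: "complex^'m^'m \<Rightarrow> complex^'m^'m" where
  "cmat_adj B = (\<chi> i j. cnj (B $ j $ i))"

definition cmat_Im :: "complex^'m^'m \<Rightarrow> complex^'m^'m" where
  "cmat_Im B = (\<chi> i j. (B $ i $ j - cmat_adj B $ i $ j) / (2 * \<i>))"

definition diag_part :: "complex^'m^'m \<Rightarrow> complex^'m^'m" where
  "diag_part B = (\<chi> i j. if i = j then B $ i $ j else 0)"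

definition diag_mat :: "('m \<Rightarrow> complex) \<Rightarrow> complex^'m^'m" where
  "diag_mat d = (\<chi> i j. if i = j then d i else 0)"

definition DtM :: "(real \<times> (real^'n)) set \<Rightarrow> (real \<Rightarrow> real^'n \<Rightarrow> complex^'m^'m) \<Rightarrow> real \<Rightarrow> real^'n \<Rightarrow> complex^'m^'m" where
  "DtM Z M t \<xi> = (\<chi> i j. - \<i> * tD Z M 1 t \<xi> $ i $ j)"

definition A1_hyp :: "real \<Rightarrow> (real \<Rightarrow> real^'n \<Rightarrow> complex^'m^'m) \<Rightarrow> bool" where
  "A1_hyp N A \<longleftrightarrow> symb0inf Zall N 1 0 A \<and>
     (\<exists>c. \<forall>(t, \<xi>) \<in> Zhyp N. \<forall>\<zeta>. is_eigenvalue (A t \<xi>) \<zeta> \<longrightarrow> \<bar>Im \<zeta>\<bar> \<le> c)"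

definition A2_hyp :: "real \<Rightarrow> (real \<Rightarrow> real) \<Rightarrow> (real \<Rightarrow> real^'n \<Rightarrow> complex^'m::{finite,linorder}^'m::{finite,linorder})
    \<Rightarrow> (real \<Rightarrow> real^'n \<Rightarrow> complex^'m::{finite,linorder}^'m::{finite,linorder}) \<Rightarrow> ('m::{finite,linorder} \<Rightarrow> real \<Rightarrow> real^'n \<Rightarrow> real) \<Rightarrow> bool" where
  "A2_hyp N cf A A1 lam \<longleftrightarrow>
     (\<forall>t \<xi> (\<rho>::real). 0 < \<rho> \<longrightarrow> A1 t (\<rho> *\<^sub>R \<xi>) = \<rho> *\<^sub>R A1 t \<xi>) \<and>
     symb0inf (Zhyp N) N 0 1 (\<lambda>t \<xi>. A t \<xi> - chi_hyp cf N t \<xi> *\<^sub>R A1 t \<xi>) \<and>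
     (\<forall>(t, \<xi>) \<in> Zhyp N. {\<zeta>. is_eigenvalue (A1 t \<xi>) \<zeta>} = {complex_of_real (lam i t \<xi>) | i. True}) \<and>
     (\<forall>(t, \<xi>) \<in> Zhyp N. \<forall>i j. i < j \<longrightarrow> lam i t \<xi> < lam j t \<xi>) \<and>
     (\<forall>i. symb0inf (Zhyp N) N 1 0 (lam i)) \<and>
     (\<forall>i j. i \<noteq> j \<longrightarrow> (\<exists>\<delta>>0. \<forall>\<^sub>F t in at_top.
         \<forall>\<omega>::real^'n. norm \<omega> = 1 \<longrightarrow> \<delta> \<le> \<bar>lam i t \<omega> - lam j t \<omega>\<bar>))"

definition F0 :: "real \<Rightarrow> (real \<Rightarrow> real^'n \<Rightarrow> complex^'m^'m) \<Rightarrow> (real \<Rightarrow> real^'n \<Rightarrow> complex^'m^'m)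
    \<Rightarrow> (real \<Rightarrow> real^'n \<Rightarrow> complex^'m^'m) \<Rightarrow> (real \<Rightarrow> real^'n \<Rightarrow> complex^'m^'m) \<Rightarrow> real \<Rightarrow> real^'n \<Rightarrow> complex^'m^'m" where
  "F0 N A A1 M Minv t \<xi> =
     diag_part (Minv t \<xi> ** (A t \<xi> - A1 t \<xi>) ** M t \<xi> - Minv t \<xi> ** DtM (Zhyp N) M t \<xi>)"

definition A3_hyp :: "real \<Rightarrow> (real \<Rightarrow> real^'n \<Rightarrow> complex^'m::{finite,linorder}^'m::{finite,linorder})
    \<Rightarrow> (real \<Rightarrow> real^'n \<Rightarrow> complex^'m::{finite,linorder}^'m::{finite,linorder}) \<Rightarrow> ('m::{finite,linorder} \<Rightarrow> real \<Rightarrow> real^'n \<Rightarrow> real) \<Rightarrow> bool" where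
  "A3_hyp N A A1 lam \<longleftrightarrow>
     (\<exists>M Minv.
        (\<forall>(t, \<xi>) \<in> Zhyp N. M t \<xi> ** Minv t \<xi> = mat 1 \<and> Minv t \<xi> ** M t \<xi> = mat 1 \<and>
            A1 t \<xi> ** M t \<xi> = M t \<xi> ** diag_mat (\<lambda>i. complex_of_real (lam i t \<xi>))) \<and>
        symb0inf (Zhyp N) N 0 0 M \<and> symb0inf (Zhyp N) N 0 0 Minv \<and>
        (\<exists>B. \<forall>s t \<xi>. (s, \<xi>) \<in> Zhyp N \<longrightarrow> (t, \<xi>) \<in> Zhyp N \<longrightarrow>
            norm (integral {s..t} (\<lambda>\<theta>. cmat_Im (F0 N A A1 M Minv \<theta> \<xi>))) \<le> B))"

end

theory Submission
  imports Defs
begin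

text \<open>
  Fix \<open>\<xi>\<close>. In the coordinates given by a diagonaliser \<open>M\<close> of \<open>A1\<close> the system reads
  \<open>W' = \<i> (\<Lambda> + R) W\<close> with \<open>R = O(1/(1+t))\<close>. As the roots are uniformly separated, one further
  step \<open>X = (I - N1) W\<close> with \<open>N1 = O(1/(|\<xi>| (1+t)))\<close> removes the off-diagonal part of \<open>R\<close> up
  to a remainder \<open>O(1/(|\<xi>| (1+t)^2))\<close>, whose integral over \<open>|\<xi>| (1+t) \<ge> \<Theta>\<close> is \<open>O(1/\<Theta>)\<close>; in the
  layer \<open>N \<le> |\<xi>| (1+t) \<le> \<Theta>\<close> everything is bounded trivially. Hence the growth of the \<open>j\<close>-th
  component of \<open>X\<close> is governed by the integral of the imaginary part of the \<open>j\<close>-th entry of \<open>F0\<close>.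
  That such an \<open>M\<close> with symbol estimates always exists is shown by parallel transport of unit
  eigenvectors along \<open>t\<close>; separation of the roots for bounded \<open>t\<close> follows by compactness, since
  \<open>A1\<close> is the locally uniform limit of \<open>A(t, k \<omega>) / k\<close> and therefore continuous.
\<close>

section \<open>Symbol estimates on the hyperbolic zone\<close>

text \<open>The two implications use the normal form differently. Under (A3) all weights
  \<open>exp (phi ...)\<close> are comparable to 1, so a single Gronwall estimate serves the whole
  vector X. In the converse the phases of different components might drift apart without any a
  priori control, so the weights cannot be put on all components together: one component is
  followed, and its coupling to the others is estimated through the assumed energy bound. Since (A3)
  asks for some M, the converse must also supply one. Eigenvectors are determined only up to a
  scalar factor, and a careless choice along t would destroy the symbol estimates. The spectral
  projections carry no such ambiguity, so the estimates are proved for them first and handed on to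
  the frame by a differential equation in t. No estimate differentiates in \<xi>, so the initial
  vector of that equation may be chosen separately for each \<xi>.\<close>

abbreviation slice :: "real \<Rightarrow> real^'n \<Rightarrow> real set" where
  "slice N \<xi> \<equiv> {s. (s, \<xi>) \<in> Zhyp N}"

lemma ZhypD:
  assumes "(t, \<xi>) \<in> Zhyp N" "0 < N"
  shows "0 \<le> t" "N \<le> (1 + t) * norm \<xi>" "0 < norm \<xi>" "\<xi> \<noteq> 0"
    "inverse (1 + t) \<le> norm \<xi> / N"
proof -
  show t: "0 \<le> t" and r: "N \<le> (1 + t) * norm \<xi>"
    using assms by (auto simp: Zhyp_def)
  show \<xi>: "\<xi> \<noteq> 0"
    using r assms by auto
  then show "0 < norm \<xi>"
    by simp
  show "inverse (1 + t) \<le> norm \<xi> / N"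
    using t r assms by (simp add: field_simps)
qed

lemma slice_eq:
  assumes "0 < N" "\<xi> \<noteq> 0"
  shows "slice N \<xi> = {max 0 (N / norm \<xi> - 1)..}"
  using assms by (auto simp: Zhyp_def field_simps)

lemma slice_obtain:
  assumes "(t, \<xi>) \<in> Zhyp N" "0 < N"
  obtains a where "0 \<le> a" "a \<le> t" "slice N \<xi> = {a..}"
  using slice_eq[OF assms(2) ZhypD(4)[OF assms]] assms(1)
  by (metis atLeast_iff max.cobounded1 mem_Collect_eq)

text \<open>At the left end of the slice derivatives are one-sided; a nontrivial filter is what
  makes them unique there.\<close>

lemma at_within_slice_neq_bot:
  assumes "(t, \<xi>) \<in> Zhyp N" "0 < N"
  shows "at t within slice N \<xi> \<noteq> bot"
proof -
  obtain a where a: "a \<le> t" "slice N \<xi> = {a..}"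
    using slice_obtain[OF assms] by metis
  have "t islimpt {t..t+1}"
    by (simp add: islimpt_Icc)
  then have "t islimpt slice N \<xi>"
    using a by (elim islimpt_subset) auto
  then show ?thesis
    by (simp add: trivial_limit_within)
qed

text \<open>Inside the zone |\<xi>| is at least N/(1+t), so the maximum is attained by |\<xi>|. This
  is why \<open>symb\<close> is formulated with \<open>norm \<xi>\<close> directly.\<close>

lemma xi_t_Zhyp:
  assumes "(t, \<xi>) \<in> Zhyp N" "0 < N"
  shows "xi_t N t \<xi> = norm \<xi>"
  using ZhypD[OF assms] unfolding xi_t_def by (simp add: max_def field_simps)

text \<open>Symbol estimates for the first \<open>K\<close> derivatives. Recursing over an existentially quantified
  derivative, instead of iterating \<open>vector_derivative\<close>, makes closure under products, inverses and
  linear equations a one-step induction on \<open>K\<close>.\<close>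
primrec symb :: "real \<Rightarrow> nat \<Rightarrow> real \<Rightarrow> real \<Rightarrow> (real \<Rightarrow> real^'n \<Rightarrow> 'b::real_normed_vector) \<Rightarrow> bool"
  where
    "symb N 0 m p f \<longleftrightarrow>
      (\<exists>C. \<forall>(t, \<xi>) \<in> Zhyp N. norm (f t \<xi>) \<le> C * (norm \<xi> powr m * (1 + t) powr (- p)))"
  | "symb N (Suc K) m p f \<longleftrightarrow>
      (\<exists>C. \<forall>(t, \<xi>) \<in> Zhyp N. norm (f t \<xi>) \<le> C * (norm \<xi> powr m * (1 + t) powr (- p))) \<and>
      (\<exists>f'. (\<forall>(t, \<xi>) \<in> Zhyp N. ((\<lambda>s. f s \<xi>) has_vector_derivative f' t \<xi>) (at t within slice N \<xi>)) \<and>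
        symb N K m (p + 1) f')"

lemma symb_bound:
  assumes "symb N K m p f"
  obtains C where "0 < C"
    "\<And>t \<xi>. (t, \<xi>) \<in> Zhyp N \<Longrightarrow> norm (f t \<xi>) \<le> C * (norm \<xi> powr m * (1 + t) powr (- p))"
proof -
  obtain C where C: "\<forall>(t, \<xi>) \<in> Zhyp N. norm (f t \<xi>) \<le> C * (norm \<xi> powr m * (1 + t) powr (- p))"
    using assms by (cases K) auto
  have "norm (f t \<xi>) \<le> max 1 C * (norm \<xi> powr m * (1 + t) powr (- p))" if "(t, \<xi>) \<in> Zhyp N" for t \<xi>
  proof -
    have "norm (f t \<xi>) \<le> C * (norm \<xi> powr m * (1 + t) powr (- p))"
      using C that by auto
    also have "\<dots> \<le> max 1 C * (norm \<xi> powr m * (1 + t) powr (- p))"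
      by (intro mult_right_mono) auto
    finally show ?thesis .
  qed
  then show ?thesis
    using that[of "max 1 C"] by auto
qed

lemma symb_0I:
  assumes "\<And>t \<xi>. (t, \<xi>) \<in> Zhyp N \<Longrightarrow> norm (f t \<xi>) \<le> C * (norm \<xi> powr m * (1 + t) powr (- p))"
  shows "symb N 0 m p f"
  using assms by auto

lemma symb_SucI:
  assumes "symb N 0 m p f"
    and "\<And>t \<xi>. (t, \<xi>) \<in> Zhyp N \<Longrightarrow> ((\<lambda>s. f s \<xi>) has_vector_derivative f' t \<xi>) (at t within slice N \<xi>)"
    and "symb N K m (p + 1) f'"
  shows "symb N (Suc K) m p f"
  using assms by auto

lemma symb_to_0: "symb N K m p f \<Longrightarrow> symb N 0 m p f"
  by (cases K) auto

lemma symb_SucE: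
  assumes "symb N (Suc K) m p f"
  obtains f' where
    "\<And>t \<xi>. (t, \<xi>) \<in> Zhyp N \<Longrightarrow> ((\<lambda>s. f s \<xi>) has_vector_derivative f' t \<xi>) (at t within slice N \<xi>)"
    "symb N K m (p + 1) f'"
  using assms by fastforce

lemma symb_Suc: "symb N (Suc K) m p f \<Longrightarrow> symb N K m p f"
proof (induction K arbitrary: p f)
  case (Suc K)
  obtain f' where f': "\<And>t \<xi>. (t, \<xi>) \<in> Zhyp N \<Longrightarrow> ((\<lambda>s. f s \<xi>) has_vector_derivative f' t \<xi>) (at t within slice N \<xi>)"
    "symb N (Suc K) m (p + 1) f'"
    using symb_SucE[OF Suc.prems] by metis
  show ?case
    by (rule symb_SucI[OF symb_to_0[OF Suc.prems] f'(1) Suc.IH[OF f'(2)]])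
qed (auto simp only: symb.simps)

lemma symb_cong:
  fixes f :: "real \<Rightarrow> real^'n \<Rightarrow> 'b::real_normed_vector"
  assumes "symb N K m p f" "\<And>t \<xi>. (t, \<xi>) \<in> Zhyp N \<Longrightarrow> f t \<xi> = g t \<xi>"
  shows "symb N K m p g"
proof -
  obtain C where C: "\<And>t \<xi>. (t, \<xi>) \<in> Zhyp N \<Longrightarrow> norm (f t \<xi>) \<le> C * (norm \<xi> powr m * (1 + t) powr (- p))"
    using symb_bound[OF assms(1)] by metis
  have 0: "symb N 0 m p g"
    by (rule symb_0I[where C = C]) (use C assms(2) in metis)
  show ?thesis
  proof (cases K)
    case Suc: (Suc L)
    obtain f' where f': "\<And>t \<xi>. (t, \<xi>) \<in> Zhyp N \<Longrightarrow> ((\<lambda>s. f s \<xi>) has_vector_derivative f' t \<xi>) (at t within slice N \<xi>)"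
      "symb N L m (p + 1) f'"
      using symb_SucE assms(1) Suc by metis
    have "((\<lambda>s. g s \<xi>) has_vector_derivative f' t \<xi>) (at t within slice N \<xi>)"
      if "(t, \<xi>) \<in> Zhyp N" for t \<xi>
      by (rule has_vector_derivative_transform[OF _ _ f'(1)[OF that]]) (use assms(2) that in auto)
    then show ?thesis
      unfolding Suc using 0 f'(2) by (intro symb_SucI[of _ _ _ g f'])
  qed (use 0 in simp)
qed

lemma symb_zero: "symb N K m p (\<lambda>t \<xi>. 0)"
proof (induction K arbitrary: p)
  case (Suc K)
  show ?case
    by (rule symb_SucI[where f' = "\<lambda>_ _. 0"]) (auto simp only: Suc has_vector_derivative_const intro!: symb_to_0[OF Suc])
qed (auto intro!: exI[of _ 0])

lemma symb_const:
  fixes c :: "'b::real_normed_vector"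
  assumes "0 < N"
  shows "symb N K 0 0 (\<lambda>t (\<xi> :: real^'n). c)"
proof -
  have 0: "symb N 0 0 0 (\<lambda>t (\<xi> :: real^'n). c)"
    by (rule symb_0I[where C = "norm c"]) (use ZhypD[OF _ assms] in \<open>fastforce\<close>)
  show ?thesis
  proof (cases K)
    case (Suc L)
    show ?thesis
      unfolding Suc
      by (rule symb_SucI[where f' = "\<lambda>_ _. 0"]) (use 0 symb_zero in auto)
  qed (use 0 in auto)
qed

section \<open>Closure of the symbol classes under algebraic operations\<close>

lemma symb_add:
  fixes f g :: "real \<Rightarrow> real^'n \<Rightarrow> 'b::real_normed_vector"
  shows "symb N K m p f \<Longrightarrow> symb N K m p g \<Longrightarrow> symb N K m p (\<lambda>t \<xi>. f t \<xi> + g t \<xi>)"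
proof (induction K arbitrary: p f g)
  case 0
  obtain C where C: "\<And>t \<xi>. (t, \<xi>) \<in> Zhyp N \<Longrightarrow> norm (f t \<xi>) \<le> C * (norm \<xi> powr m * (1 + t) powr (- p))"
    using symb_bound[OF 0(1)] by metis
  obtain D where D: "\<And>t \<xi>. (t, \<xi>) \<in> Zhyp N \<Longrightarrow> norm (g t \<xi>) \<le> D * (norm \<xi> powr m * (1 + t) powr (- p))"
    using symb_bound[OF 0(2)] by metis
  show ?case
  proof (rule symb_0I[where C = "C + D"])
    fix t and \<xi> :: "real^'n" assume "(t, \<xi>) \<in> Zhyp N"
    from add_mono[OF C[OF this] D[OF this]]
    show "norm (f t \<xi> + g t \<xi>) \<le> (C + D) * (norm \<xi> powr m * (1 + t) powr (- p))"
      unfolding distrib_right by (rule order_trans[OF norm_triangle_ineq])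
  qed
next
  case (Suc K)
  obtain f' where f': "\<And>t \<xi>. (t, \<xi>) \<in> Zhyp N \<Longrightarrow> ((\<lambda>s. f s \<xi>) has_vector_derivative f' t \<xi>) (at t within slice N \<xi>)"
    "symb N K m (p + 1) f'"
    using symb_SucE[OF Suc.prems(1)] by metis
  obtain g' where g': "\<And>t \<xi>. (t, \<xi>) \<in> Zhyp N \<Longrightarrow> ((\<lambda>s. g s \<xi>) has_vector_derivative g' t \<xi>) (at t within slice N \<xi>)"
    "symb N K m (p + 1) g'"
    using symb_SucE[OF Suc.prems(2)] by metis
  have "symb N K m p (\<lambda>t \<xi>. f t \<xi> + g t \<xi>)"
    by (intro Suc.IH symb_Suc[OF Suc.prems(1)] symb_Suc[OF Suc.prems(2)])
  from symb_to_0[OF this] show ?case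
    by (intro symb_SucI[where f' = "\<lambda>t \<xi>. f' t \<xi> + g' t \<xi>"] Suc.IH f'(2) g'(2) has_vector_derivative_add f'(1) g'(1))
qed

text \<open>One Leibniz rule for scalar, matrix, matrix-vector and inner products: a derivative
  costs one power of 1+t, whichever factor it falls on.\<close>

lemma symb_bilinear:
  fixes f :: "real \<Rightarrow> real^'n \<Rightarrow> 'b::real_normed_vector" and g :: "real \<Rightarrow> real^'n \<Rightarrow> 'c::real_normed_vector"
  assumes "bounded_bilinear B" "0 < N"
  shows "symb N K m p f \<Longrightarrow> symb N K m' p' g \<Longrightarrow> symb N K (m + m') (p + p') (\<lambda>t \<xi>. B (f t \<xi>) (g t \<xi>))"
proof (induction K arbitrary: p p' f g)
  interpret bounded_bilinear B by fact
  have zero: "symb N 0 (m + m') (p + p') (\<lambda>t \<xi>. B (f t \<xi>) (g t \<xi>))"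
    if fg: "symb N K m p f" "symb N K m' p' g" for K p p' and f :: "real \<Rightarrow> real^'n \<Rightarrow> 'b" and g :: "real \<Rightarrow> real^'n \<Rightarrow> 'c"
  proof -
    obtain C where C: "0 < C" "\<And>t \<xi>. (t, \<xi>) \<in> Zhyp N \<Longrightarrow> norm (f t \<xi>) \<le> C * (norm \<xi> powr m * (1 + t) powr (- p))"
      using symb_bound[OF fg(1)] by metis
    obtain D where D: "0 < D" "\<And>t \<xi>. (t, \<xi>) \<in> Zhyp N \<Longrightarrow> norm (g t \<xi>) \<le> D * (norm \<xi> powr m' * (1 + t) powr (- p'))"
      using symb_bound[OF fg(2)] by metis
    obtain L where L: "0 < L" "\<And>a b. norm (B a b) \<le> norm a * norm b * L"
      using pos_bounded by blast
    show ?thesis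
    proof (rule symb_0I[where C = "C * D * L"])
      fix t and \<xi> :: "real^'n" assume Z: "(t, \<xi>) \<in> Zhyp N"
      have "norm (B (f t \<xi>) (g t \<xi>)) \<le> norm (f t \<xi>) * norm (g t \<xi>) * L"
        by (rule L)
      also have "\<dots> \<le> (C * (norm \<xi> powr m * (1 + t) powr (- p))) * (D * (norm \<xi> powr m' * (1 + t) powr (- p'))) * L"
        using C D L Z by (intro mult_mono) auto
      also have "\<dots> = C * D * L * ((norm \<xi> powr m * norm \<xi> powr m') * ((1 + t) powr (- p) * (1 + t) powr (- p')))"
        by (simp only: ac_simps)
      also have "\<dots> = C * D * L * (norm \<xi> powr (m + m') * (1 + t) powr (- (p + p')))"
        by (simp only: powr_add[symmetric] minus_add_distrib)
      finally show "norm (B (f t \<xi>) (g t \<xi>)) \<le> C * D * L * (norm \<xi> powr (m + m') * (1 + t) powr (- (p + p')))" .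
    qed
  qed
  {
    case 0
    then show ?case by (rule zero)
  next
    case (Suc K)
    obtain f' where f': "\<And>t \<xi>. (t, \<xi>) \<in> Zhyp N \<Longrightarrow> ((\<lambda>s. f s \<xi>) has_vector_derivative f' t \<xi>) (at t within slice N \<xi>)"
      "symb N K m (p + 1) f'"
      using symb_SucE[OF Suc.prems(1)] by metis
    obtain g' where g': "\<And>t \<xi>. (t, \<xi>) \<in> Zhyp N \<Longrightarrow> ((\<lambda>s. g s \<xi>) has_vector_derivative g' t \<xi>) (at t within slice N \<xi>)"
      "symb N K m' (p' + 1) g'"
      using symb_SucE[OF Suc.prems(2)] by metis
    have 1: "symb N K (m + m') (p + (p' + 1)) (\<lambda>t \<xi>. B (f t \<xi>) (g' t \<xi>))"
      by (rule Suc.IH[OF symb_Suc[OF Suc.prems(1)] g'(2)])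
    have 2: "symb N K (m + m') ((p + 1) + p') (\<lambda>t \<xi>. B (f' t \<xi>) (g t \<xi>))"
      by (rule Suc.IH[OF f'(2) symb_Suc[OF Suc.prems(2)]])
    have "symb N K (m + m') (p + p' + 1) (\<lambda>t \<xi>. B (f t \<xi>) (g' t \<xi>) + B (f' t \<xi>) (g t \<xi>))"
      by (rule symb_add) (use 1 2 in \<open>simp_all only: ac_simps\<close>)
    then show ?case
      by (intro symb_SucI[where f' = "\<lambda>t \<xi>. B (f t \<xi>) (g' t \<xi>) + B (f' t \<xi>) (g t \<xi>)"] zero[OF Suc.prems]
          has_vector_derivative f'(1) g'(1))
  }
qed

lemmas symb_scaleR = symb_bilinear[OF bounded_bilinear_scaleR]

text \<open>A linear map is treated as the bilinear map (c, x) to c L x, applied to the constant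
  symbol c = 1 of order zero.\<close>

lemma symb_linear:
  fixes f :: "real \<Rightarrow> real^'n \<Rightarrow> 'b::real_normed_vector"
  assumes "bounded_linear L" "0 < N" "symb N K m p f"
  shows "symb N K m p (\<lambda>t \<xi>. L (f t \<xi>))"
proof -
  have "bounded_bilinear (\<lambda>c x. c *\<^sub>R L x)"
    by (intro bounded_bilinear.comp[OF bounded_bilinear_scaleR bounded_linear_ident assms(1)])
  from symb_bilinear[OF this assms(2) symb_const[OF assms(2), of K 1] assms(3)] show ?thesis
    by simp
qed

lemma symb_diff:
  assumes "0 < N" "symb N K m p f" "symb N K m p g"
  shows "symb N K m p (\<lambda>t \<xi>. f t \<xi> - g t \<xi>)"
  using symb_add[OF assms(2) symb_linear[OF bounded_linear_minus[OF bounded_linear_ident] assms(1,3)]] by simp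

lemma symb_sum:
  "(\<And>i. i \<in> I \<Longrightarrow> symb N K m p (f i)) \<Longrightarrow> symb N K m p (\<lambda>t \<xi>. \<Sum>i\<in>I. f i t \<xi>)"
  by (induction I rule: infinite_finite_induct) (auto intro: symb_add simp: symb_zero simp del: symb.simps)

lemma vec_eq_sum_axis: "x = (\<Sum>i\<in>UNIV. axis i (x $ i))"
  by (simp add: vec_eq_iff axis_def)

lemma bounded_linear_axis: "bounded_linear (axis i :: 'a::real_normed_vector \<Rightarrow> 'a^'n)"
proof (rule bounded_linear_intro[where K = 1])
  fix x :: 'a
  have "norm (axis i x :: 'a^'n) \<le> (\<Sum>j\<in>UNIV. norm ((axis i x :: 'a^'n) $ j))"
    unfolding norm_vec_def by (rule L2_set_le_sum) simp
  also have "\<dots> = (\<Sum>j\<in>UNIV. if j = i then norm x else 0)"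
    by (intro sum.cong) (auto simp: axis_def)
  finally show "norm (axis i x :: 'a^'n) \<le> norm x * 1"
    by simp
qed (auto simp: axis_def vec_eq_iff)

lemma symb_vec:
  assumes "0 < N" "\<And>i. symb N K m p (\<lambda>t \<xi>. f t \<xi> $ i)"
  shows "symb N K m p f"
proof -
  have "symb N K m p (\<lambda>t \<xi>. \<Sum>i\<in>UNIV. axis i (f t \<xi> $ i))"
    by (intro symb_sum symb_linear[OF bounded_linear_axis] assms)
  then show ?thesis
    by (simp flip: vec_eq_sum_axis)
qed

lemma symb_nth:
  assumes "0 < N" "symb N K m p f"
  shows "symb N K m p (\<lambda>t \<xi>. f t \<xi> $ i)"
  by (rule symb_linear[OF bounded_linear_vec_nth assms])

text \<open>On the hyperbolic zone \<open>1/(1+t)\<close> is dominated by \<open>|\<xi>|/N\<close>.\<close>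
lemma symb_weaken:
  fixes f :: "real \<Rightarrow> real^'n \<Rightarrow> 'b::real_normed_vector"
  assumes "0 < N"
  shows "symb N K m (p + 1) f \<Longrightarrow> symb N K (m + 1) p f"
proof (induction K arbitrary: p f)
  have zero: "symb N 0 (m + 1) p f" if f: "symb N K m (p + 1) f" for K p and f :: "real \<Rightarrow> real^'n \<Rightarrow> 'b"
  proof -
    obtain C where C: "0 < C" "\<And>t \<xi>. (t, \<xi>) \<in> Zhyp N \<Longrightarrow> norm (f t \<xi>) \<le> C * (norm \<xi> powr m * (1 + t) powr (- (p + 1)))"
      using symb_bound[OF f] by metis
    show ?thesis
    proof (rule symb_0I[where C = "C / N"])
      fix t and \<xi> :: "real^'n" assume Z: "(t, \<xi>) \<in> Zhyp N"
      note D = ZhypD[OF Z assms]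
      have "norm (f t \<xi>) \<le> C * (norm \<xi> powr m * (1 + t) powr (- (p + 1)))"
        using C Z by auto
      also have "(1 + t) powr (- (p + 1)) = (1 + t) powr (- p) * inverse (1 + t)"
        using D by (simp add: powr_diff powr_minus field_simps)
      also have "C * (norm \<xi> powr m * ((1 + t) powr (- p) * inverse (1 + t)))
          \<le> C * (norm \<xi> powr m * ((1 + t) powr (- p) * (norm \<xi> / N)))"
        using C D by (intro mult_left_mono) auto
      also have "\<dots> = C / N * (norm \<xi> powr (m + 1) * (1 + t) powr (- p))"
        using D by (simp add: powr_add)
      finally show "norm (f t \<xi>) \<le> C / N * (norm \<xi> powr (m + 1) * (1 + t) powr (- p))" .
    qed
  qed
  {
    case 0
    then show ?case by (rule zero)
  next
    case (Suc K)
    obtain f' where f': "\<And>t \<xi>. (t, \<xi>) \<in> Zhyp N \<Longrightarrow> ((\<lambda>s. f s \<xi>) has_vector_derivative f' t \<xi>) (at t within slice N \<xi>)"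
      "symb N K m (p + 1 + 1) f'"
      using symb_SucE[OF Suc.prems] by metis
    show ?case
      by (rule symb_SucI[OF zero[OF Suc.prems] f'(1) Suc.IH[OF f'(2)]])
  }
qed

text \<open>Ellipticity is required at order zero alone: the derivative -f'/f^2 is a product of f'
  with two copies of 1/f, for which the induction hypothesis holds.\<close>

lemma symb_inverse:
  fixes f :: "real \<Rightarrow> real^'n \<Rightarrow> real"
  assumes "0 < N" "0 < \<delta>" and lb: "\<And>t \<xi>. (t, \<xi>) \<in> Zhyp N \<Longrightarrow> \<delta> * norm \<xi> powr m \<le> \<bar>f t \<xi>\<bar>"
  shows "symb N K m 0 f \<Longrightarrow> symb N K (- m) 0 (\<lambda>t \<xi>. inverse (f t \<xi>))"
proof (induction K)
  have zero: "symb N 0 (- m) 0 (\<lambda>t \<xi>. inverse (f t \<xi>))"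
  proof (rule symb_0I[where C = "inverse \<delta>"])
    fix t and \<xi> :: "real^'n" assume Z: "(t, \<xi>) \<in> Zhyp N"
    note D = ZhypD[OF Z assms(1)]
    have "inverse \<bar>f t \<xi>\<bar> \<le> inverse (\<delta> * norm \<xi> powr m)"
      using D assms(2) by (intro le_imp_inverse_le lb Z) auto
    then show "norm (inverse (f t \<xi>)) \<le> inverse \<delta> * (norm \<xi> powr (- m) * (1 + t) powr (- 0))"
      using D by (simp add: powr_minus)
  qed
  {
    case 0
    show ?case by (rule zero)
  next
    case (Suc K)
    obtain f' where f': "\<And>t \<xi>. (t, \<xi>) \<in> Zhyp N \<Longrightarrow> ((\<lambda>s. f s \<xi>) has_vector_derivative f' t \<xi>) (at t within slice N \<xi>)"
      "symb N K m (0 + 1) f'"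
      using symb_SucE[OF Suc.prems(1)] by metis
    have I: "symb N K (- m) 0 (\<lambda>t \<xi>. inverse (f t \<xi>))"
      by (rule Suc.IH[OF symb_Suc[OF Suc.prems]])
    note mult = symb_bilinear[OF bounded_bilinear_mult assms(1)]
    have "symb N K (- m + m + - m) (0 + (0 + 1) + 0) (\<lambda>t \<xi>. - (inverse (f t \<xi>) * f' t \<xi> * inverse (f t \<xi>)))"
      by (intro symb_linear[OF bounded_linear_minus[OF bounded_linear_ident] assms(1)] mult I f'(2))
    moreover have "- m + m + - m = - m" "0 + (0 + 1) + 0 = 0 + (1::real)"
      by auto
    ultimately have S: "symb N K (- m) (0 + 1) (\<lambda>t \<xi>. - (inverse (f t \<xi>) * f' t \<xi> * inverse (f t \<xi>)))"
      by (simp only:)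
    show ?case
    proof (rule symb_SucI[OF zero _ S])
      fix t and \<xi> :: "real^'n" assume Z: "(t, \<xi>) \<in> Zhyp N"
      note D = ZhypD[OF Z assms(1)]
      have "f t \<xi> \<noteq> 0"
        using less_le_trans[OF _ lb[OF Z], of 0] mult_pos_pos[OF assms(2)] D(3) by force
      then show "((\<lambda>s. inverse (f s \<xi>)) has_vector_derivative - (inverse (f t \<xi>) * f' t \<xi> * inverse (f t \<xi>))) (at t within slice N \<xi>)"
        using DERIV_inverse'[of "\<lambda>s. f s \<xi>" "f' t \<xi>"] f'(1)[OF Z]
        unfolding has_real_derivative_iff_has_vector_derivative[symmetric] by blast
    qed
  }
qed

text \<open>Bootstrapping: the equation expresses v' through v and Q, so K controlled derivatives of
  v yield K controlled derivatives of v', with the extra decay supplied by Q.\<close>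

lemma symb_ode:
  fixes v :: "real \<Rightarrow> real^'n \<Rightarrow> 'b::real_normed_vector"
  assumes "bounded_bilinear B" "0 < N" and Q: "\<And>K. symb N K 0 1 Q" and v: "symb N 0 0 0 v"
    and ode: "\<And>t \<xi>. (t, \<xi>) \<in> Zhyp N \<Longrightarrow> ((\<lambda>s. v s \<xi>) has_vector_derivative B (Q t \<xi>) (v t \<xi>)) (at t within slice N \<xi>)"
  shows "symb N K 0 0 v"
proof (induction K)
  case (Suc K)
  have "symb N K 0 (0 + 1) (\<lambda>t \<xi>. B (Q t \<xi>) (v t \<xi>))"
    using symb_bilinear[OF assms(1,2) Q Suc] by simp
  then show ?case
    by (intro symb_SucI[OF v ode])
qed (use v in simp)

section \<open>Comparison with the iterated derivatives \<open>tD\<close>\<close>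

lemma tD_0: "tD Z f 0 = f"
  by (simp add: tD_def)

lemma tD_Suc: "tD Z f (Suc k) t \<xi> = vector_derivative (\<lambda>s. tD Z f k s \<xi>) (at t within {s. (s, \<xi>) \<in> Z})"
  by (simp add: tD_def)

text \<open>The set Z may exceed the zone (A is given on \<open>Zall\<close>): a derivative within
  the larger slice is also one within the smaller. The index k is universal because the induction on
  K moves on to the next derivative.\<close>

lemma symb_tD_symb0inf:
  fixes f :: "real \<Rightarrow> real^'n \<Rightarrow> 'b::real_normed_vector"
  assumes "symb0inf Z N m p f" "Zhyp N \<subseteq> Z" "0 < N"
  shows "symb N K m (p + real k) (tD Z f k)"
proof (induction K arbitrary: k)
  have zero: "symb N 0 m (p + real k) (tD Z f k)" for k
  proof -
    obtain C where C: "\<forall>(t, \<xi>) \<in> Z. norm (tD Z f k t \<xi>) \<le> C * xi_t N t \<xi> powr m * (1 + t) powr (- p - real k)"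
      using assms(1) unfolding symb0inf_def by blast
    show ?thesis
    proof (rule symb_0I[where C = C])
      fix t and \<xi> :: "real^'n" assume Z: "(t, \<xi>) \<in> Zhyp N"
      have "norm (tD Z f k t \<xi>) \<le> C * xi_t N t \<xi> powr m * (1 + t) powr (- p - real k)"
        using C Z assms(2) by auto
      then show "norm (tD Z f k t \<xi>) \<le> C * (norm \<xi> powr m * (1 + t) powr - (p + real k))"
        by (simp add: xi_t_Zhyp[OF Z assms(3)] mult.assoc)
    qed
  qed
  {
    case 0
    show ?case by (rule zero)
  next
    case (Suc K)
    show ?case
    proof (rule symb_SucI[OF zero])
      show "((\<lambda>s. tD Z f k s \<xi>) has_vector_derivative tD Z f (Suc k) t \<xi>) (at t within slice N \<xi>)"
        if "(t, \<xi>) \<in> Zhyp N" for t \<xi>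
      proof -
        have "(\<lambda>s. tD Z f k s \<xi>) differentiable (at t within {s. (s, \<xi>) \<in> Z})"
          using assms(1,2) that unfolding symb0inf_def by blast
        then show ?thesis
          unfolding tD_Suc vector_derivative_works
          by (rule has_vector_derivative_within_subset) (use assms(2) in auto)
      qed
      show "symb N K m (p + real k + 1) (tD Z f (Suc k))"
        using Suc[of "Suc k"] by (simp add: ac_simps)
    qed
  }
qed

lemma symb0inf_symb:
  assumes "symb0inf Z N m p f" "Zhyp N \<subseteq> Z" "0 < N"
  shows "symb N K m p f"
  using symb_tD_symb0inf[OF assms, of K 0] by (simp add: tD_0)

text \<open>The derivative hidden in \<open>symb\<close> is existential and could change with K.
  Uniqueness identifies all these witnesses on the zone with the one function f'.\<close>

lemma symb_vector_derivative:
  fixes f :: "real \<Rightarrow> real^'n \<Rightarrow> 'b::real_normed_vector"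
  assumes "\<And>K. symb N K m p f" "0 < N"
  defines "f' \<equiv> \<lambda>t \<xi>. vector_derivative (\<lambda>s. f s \<xi>) (at t within slice N \<xi>)"
  shows "symb N K m (p + 1) f'"
    and "(t, \<xi>) \<in> Zhyp N \<Longrightarrow> ((\<lambda>s. f s \<xi>) has_vector_derivative f' t \<xi>) (at t within slice N \<xi>)"
proof -
  obtain g where g: "\<And>t \<xi>. (t, \<xi>) \<in> Zhyp N \<Longrightarrow> ((\<lambda>s. f s \<xi>) has_vector_derivative g t \<xi>) (at t within slice N \<xi>)"
    "symb N K m (p + 1) g"
    using symb_SucE[OF assms(1)] by metis
  have eq: "g t \<xi> = f' t \<xi>" if "(t, \<xi>) \<in> Zhyp N" for t \<xi>
    unfolding f'_def by (rule vector_derivative_within[symmetric, OF at_within_slice_neq_bot[OF that assms(2)] g(1)[OF that]])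
  show "symb N K m (p + 1) f'"
    by (rule symb_cong[OF g(2) eq])
  show "((\<lambda>s. f s \<xi>) has_vector_derivative f' t \<xi>) (at t within slice N \<xi>)" if "(t, \<xi>) \<in> Zhyp N"
    using g(1)[OF that] eq[OF that] by simp
qed

lemma symb_tD:
  fixes f :: "real \<Rightarrow> real^'n \<Rightarrow> 'b::real_normed_vector"
  assumes "\<And>K. symb N K m p f" "0 < N"
  shows "symb N K m (p + real k) (tD (Zhyp N) f k)"
proof (induction k arbitrary: K)
  case (Suc k)
  show ?case
    using symb_vector_derivative(1)[OF Suc assms(2), of K] by (simp add: tD_Suc ac_simps)
qed (use assms in \<open>simp add: tD_0\<close>)

lemma symb_imp_symb0inf:
  assumes "\<And>K. symb N K m p f" "0 < N"
  shows "symb0inf (Zhyp N) N m p f"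
  unfolding symb0inf_def
proof (intro conjI allI ballI)
  fix k
  show "case x of (t, \<xi>) \<Rightarrow> (\<lambda>s. tD (Zhyp N) f k s \<xi>) differentiable (at t within slice N \<xi>)"
    if "x \<in> Zhyp N" for x
    using symb_vector_derivative(2)[OF symb_tD[OF assms, where k = k] assms(2)] that
    by (auto intro: differentiableI_vector)
  obtain C where C: "\<And>t \<xi>. (t, \<xi>) \<in> Zhyp N \<Longrightarrow> norm (tD (Zhyp N) f k t \<xi>) \<le> C * (norm \<xi> powr m * (1 + t) powr (- (p + real k)))"
    using symb_bound[OF symb_tD[OF assms, of 0 k]] by metis
  then show "\<exists>C. \<forall>(t, \<xi>)\<in>Zhyp N. norm (tD (Zhyp N) f k t \<xi>) \<le> C * xi_t N t \<xi> powr m * (1 + t) powr (- p - real k)"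
    by (intro exI[of _ C]) (auto simp: xi_t_Zhyp[OF _ assms(2)] mult.assoc)
qed

section \<open>Linear differential equations and Gronwall's inequality\<close>

text \<open>The hypothesis concerns the real inner product of v with v' and not the norm of v', so a
  skew part of the generator contributes nothing. The proof shows that |v|^2 exp (-2 H) decreases
  and |v|^2 exp (2 H) increases, which gives growth bounds in both time directions.\<close>

lemma gronwall:
  fixes v :: "real \<Rightarrow> 'a::real_inner"
  assumes "a \<le> b"
    and v: "\<And>t. t \<in> {a..b} \<Longrightarrow> (v has_vector_derivative v' t) (at t within {a..b})"
    and H: "\<And>t. t \<in> {a..b} \<Longrightarrow> (H has_real_derivative h t) (at t within {a..b})"
    and le: "\<And>t. t \<in> {a..b} \<Longrightarrow> \<bar>v t \<bullet> v' t\<bar> \<le> h t * (norm (v t))\<^sup>2"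
  shows "norm (v b) \<le> norm (v a) * exp (H b - H a)"
    and "norm (v a) \<le> norm (v b) * exp (H b - H a)"
proof -
  have D: "((\<lambda>t. (v t \<bullet> v t) * exp (c * H t)) has_real_derivative
      (2 * (v t \<bullet> v' t) + c * h t * (norm (v t))\<^sup>2) * exp (c * H t)) (at t within {a..b})"
    if "t \<in> {a..b}" for t c
  proof -
    have "((\<lambda>t. v t \<bullet> v t) has_real_derivative (v t \<bullet> v' t + v' t \<bullet> v t)) (at t within {a..b})"
      unfolding has_real_derivative_iff_has_vector_derivative
      by (intro bounded_bilinear.has_vector_derivative[OF bounded_bilinear_inner] v that)
    moreover have "((\<lambda>t. exp (c * H t)) has_real_derivative exp (c * H t) * (c * h t)) (at t within {a..b})"
      using H[OF that] by (auto intro!: derivative_eq_intros)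
    ultimately have "((\<lambda>t. (v t \<bullet> v t) * exp (c * H t)) has_real_derivative
        (v t \<bullet> v' t + v' t \<bullet> v t) * exp (c * H t) + exp (c * H t) * (c * h t) * (v t \<bullet> v t)) (at t within {a..b})"
      by (rule DERIV_mult)
    then show ?thesis
      by (rule DERIV_cong) (simp add: inner_commute power2_norm_eq_inner algebra_simps)
  qed
  have cont: "continuous_on {a..b} (\<lambda>t. (v t \<bullet> v t) * exp (c * H t))" for c
    by (rule DERIV_continuous_on[OF D])
  have at: "at t within {a..b} = at t" if "a < t" "t < b" for t
    using that by (rule at_within_Icc_at)
  have "(v b \<bullet> v b) * exp (- 2 * H b) \<le> (v a \<bullet> v a) * exp (- 2 * H a)"
  proof (rule DERIV_nonpos_imp_decreasing_open[OF assms(1) _ cont])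
    fix t assume t: "a < t" "t < b"
    have "(2 * (v t \<bullet> v' t) + - 2 * h t * (norm (v t))\<^sup>2) * exp (- 2 * H t) \<le> 0"
      using le[of t] t by (intro mult_nonpos_nonneg) auto
    then show "\<exists>y. ((\<lambda>t. v t \<bullet> v t * exp (- 2 * H t)) has_real_derivative y) (at t) \<and> y \<le> 0"
      using D[of t "- 2"] t at[OF t] by auto
  qed
  then have "(norm (v b))\<^sup>2 \<le> (norm (v a) * exp (H b - H a))\<^sup>2"
    by (simp add: dot_square_norm power_mult_distrib exp_diff exp_minus field_simps power2_eq_square flip: exp_add)
  then show "norm (v b) \<le> norm (v a) * exp (H b - H a)"
    by (rule power2_le_imp_le) simp
  have "(v a \<bullet> v a) * exp (2 * H a) \<le> (v b \<bullet> v b) * exp (2 * H b)"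
  proof (rule DERIV_nonneg_imp_increasing_open[OF assms(1) _ cont])
    fix t assume t: "a < t" "t < b"
    have "0 \<le> (2 * (v t \<bullet> v' t) + 2 * h t * (norm (v t))\<^sup>2) * exp (2 * H t)"
      using le[of t] t by (intro mult_nonneg_nonneg) auto
    then show "\<exists>y. ((\<lambda>t. v t \<bullet> v t * exp (2 * H t)) has_real_derivative y) (at t) \<and> 0 \<le> y"
      using D[of t 2] t at[OF t] by auto
  qed
  then have "(norm (v a))\<^sup>2 \<le> (norm (v b) * exp (H b - H a))\<^sup>2"
    by (simp add: dot_square_norm power_mult_distrib exp_diff exp_minus field_simps power2_eq_square flip: exp_add)
  then show "norm (v a) \<le> norm (v b) * exp (H b - H a)"
    by (rule power2_le_imp_le) simp
qed

lemma has_vector_derivative_Ici: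
  assumes "(f has_vector_derivative f') (at t within {a..b::real})" "t < b"
  shows "(f has_vector_derivative f') (at t within {a..})"
proof -
  have "at t within {a..} = at t within {a..b}"
    by (rule at_within_nhd[of t "{..<b}"]) (use assms(2) in auto)
  then show ?thesis
    using assms(1) by simp
qed

text \<open>Picard iteration, summed as a series; the exponential weight makes the series geometric.\<close>
lemma linear_ode_exists:
  fixes Q :: "real \<Rightarrow> 'q::real_normed_vector" and v0 :: "'v::banach"
  assumes "bounded_bilinear B" and Q: "continuous_on {a..} Q"
  shows "\<exists>v. v a = v0 \<and> (\<forall>t\<ge>a. (v has_vector_derivative B (Q t) (v t)) (at t within {a..}))"
proof -
  interpret bounded_bilinear B by fact
  \<comment> \<open>These are the terms of the series, not the Picard iterates: each is the integral
    of B applied to Q and the previous term, and the solution is their sum.\<close>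
  define y where "y = rec_nat (\<lambda>_. v0) (\<lambda>_ f t. integral {a..t} (\<lambda>s. B (Q s) (f s)))"
  have y_0: "y 0 = (\<lambda>_. v0)" and y_Suc: "y (Suc n) = (\<lambda>t. integral {a..t} (\<lambda>s. B (Q s) (y n s)))" for n
    by (simp_all add: y_def)
  have deriv: "((\<lambda>t. integral {a..t} g) has_vector_derivative g t) (at t within {a..})"
    if "continuous_on {a..} g" "a \<le> t" for g :: "real \<Rightarrow> 'v" and t
    by (rule has_vector_derivative_Ici[of _ _ _ _ "t + 1"], rule integral_has_vector_derivative)
      (use that in \<open>auto intro: continuous_on_subset\<close>)
  have cont_y: "continuous_on {a..} (y n)" for n
  proof (induction n)
    case (Suc n)
    then have "continuous_on {a..} (\<lambda>s. B (Q s) (y n s))"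
      by (intro continuous_on Q)
    then show ?case
      unfolding y_Suc using deriv has_vector_derivative_continuous
      by (fastforce simp: continuous_on_eq_continuous_within)
  qed (simp add: y_0)
  have cont_B: "continuous_on {a..} (\<lambda>s. B (Q s) (y n s))" for n
    by (intro continuous_on Q cont_y)
  define y' where "y' n t = (case n of 0 \<Rightarrow> 0 | Suc m \<Rightarrow> B (Q t) (y m t))" for n t
  have deriv_y: "(y n has_vector_derivative y' n t) (at t within {a..})" if "a \<le> t" for n t
    using deriv[OF cont_B that] by (cases n) (simp_all add: y'_def y_0 y_Suc)
  \<comment> \<open>Q is only locally bounded, so convergence is shown on each compact interval. The
    sum is defined pointwise and does not refer to T, hence the local statements fit
    together.\<close>
  have main: "(\<forall>t\<in>{a..T}. (\<lambda>n. y n t) sums (\<Sum>n. y n t)) \<and>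
      (\<forall>t\<in>{a..T}. ((\<lambda>t. \<Sum>n. y n t) has_vector_derivative B (Q t) (\<Sum>n. y n t)) (at t within {a..T}))"
    if "a \<le> T" for T
  proof -
    have "bounded (Q ` {a..T})"
      by (intro compact_imp_bounded compact_continuous_image continuous_on_subset[OF Q]) auto
    then obtain q where q: "\<And>t. t \<in> {a..T} \<Longrightarrow> norm (Q t) \<le> q"
      unfolding bounded_iff by (metis imageI)
    obtain L where L: "0 < L" "\<And>a b. norm (B a b) \<le> norm a * norm b * L"
      using pos_bounded by blast
    define k where "k = q * L + 1"
    have "0 \<le> q"
      using q[of a] that norm_ge_zero order_trans by (metis atLeastAtMost_iff order_refl)
    then have k: "0 < k"
      using L unfolding k_def by (simp add: add_nonneg_pos)
    have B_le: "norm (B (Q t) x) \<le> k * norm x" if "t \<in> {a..T}" for t x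
    proof -
      have "norm (B (Q t) x) \<le> norm (Q t) * norm x * L"
        by (rule L)
      also have "\<dots> \<le> q * norm x * L"
        using q[OF that] L by (intro mult_right_mono) auto
      also have "\<dots> \<le> k * norm x"
        by (simp add: k_def algebra_simps)
      finally show ?thesis .
    qed
    \<comment> \<open>Integrating exp (2 k (s - a)) gains 1/(2 k) against the factor k lost in B,
      hence a factor 1/2 per step.\<close>
    have y_le: "norm (y n t) \<le> norm v0 * (1/2)^n * exp (2 * k * (t - a))" if "t \<in> {a..T}" for n t
      using that
    proof (induction n arbitrary: t)
      case 0
      then show ?case
        using k by (simp add: y_0 mult_le_cancel_left1)
    next
      case (Suc n)
      let ?c = "norm v0 * (1/2)^n"
      have "((\<lambda>s. k * ?c * exp (2 * k * (s - a))) has_integral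
          (?c / 2 * exp (2 * k * (t - a)) - ?c / 2 * exp (2 * k * (a - a)))) {a..t}"
        using Suc.prems k
        by (intro fundamental_theorem_of_calculus)
          (auto intro!: derivative_eq_intros simp flip: has_real_derivative_iff_has_vector_derivative)
      note I = this
      have "norm (y (Suc n) t) \<le> integral {a..t} (\<lambda>s. k * ?c * exp (2 * k * (s - a)))"
        unfolding y_Suc
      proof (rule integral_norm_bound_integral)
        show "(\<lambda>s. B (Q s) (y n s)) integrable_on {a..t}"
          by (intro integrable_continuous_real continuous_on_subset[OF cont_B]) auto
        show "(\<lambda>s. k * ?c * exp (2 * k * (s - a))) integrable_on {a..t}"
          using I by blast
        fix s assume s: "s \<in> {a..t}"
        then have "s \<in> {a..T}"
          using Suc.prems by auto
        from B_le[OF this] show "norm (B (Q s) (y n s)) \<le> k * ?c * exp (2 * k * (s - a))"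
          using mult_left_mono[OF Suc.IH[OF \<open>s \<in> {a..T}\<close>], of k] k
          by (smt (verit, ccfv_threshold) mult.assoc)
      qed
      also have "\<dots> = ?c / 2 * exp (2 * k * (t - a)) - ?c / 2"
        using integral_unique[OF I] by simp
      also have "\<dots> \<le> norm v0 * (1/2)^Suc n * exp (2 * k * (t - a))"
        by simp
      finally show ?case .
    qed
    have summable: "summable (\<lambda>n. norm v0 * (1/2)^n * exp (2 * k * (T - a)))"
      by (intro summable_mult2 summable_mult summable_geometric) simp
    have y_le': "norm (y n t) \<le> norm v0 * (1/2)^n * exp (2 * k * (T - a))" if "t \<in> {a..T}" for n t
    proof -
      have "norm v0 * (1/2)^n * exp (2 * k * (t - a)) \<le> norm v0 * (1/2)^n * exp (2 * k * (T - a))"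
        using that k by (intro mult_left_mono) auto
      then show ?thesis
        using y_le[OF that, of n] by linarith
    qed
    have sums: "(\<lambda>n. y n t) sums (\<Sum>n. y n t)" if "t \<in> {a..T}" for t
      by (intro summable_sums summable_comparison_test'[OF summable] y_le' that)
    define M where "M n = (case n of 0 \<Rightarrow> 0 | Suc m \<Rightarrow> k * (norm v0 * (1/2)^m * exp (2 * k * (T - a))))" for n
    have "summable M"
      by (subst summable_Suc_iff[symmetric]) (use summable in \<open>simp add: M_def summable_mult\<close>)
    have y'_le: "norm (y' n t) \<le> M n" if "t \<in> {a..T}" for n t
    proof (cases n)
      case (Suc m)
      then show ?thesis
        using order_trans[OF B_le[OF that] mult_left_mono[OF y_le'[OF that]]] k
        by (simp add: y'_def M_def)
    qed (simp add: y'_def M_def)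
    have lim: "uniform_limit {a..T} (\<lambda>n t. \<Sum>i<n. y' i t) (\<lambda>t. \<Sum>i. y' i t) sequentially"
      by (rule Weierstrass_m_test[OF y'_le \<open>summable M\<close>])
    have y'_sum: "(\<Sum>i. y' i t) = B (Q t) (\<Sum>n. y n t)" if "t \<in> {a..T}" for t
    proof -
      have "(\<lambda>n. y' (Suc n) t) sums B (Q t) (\<Sum>n. y n t)"
        using bounded_linear.sums[OF bounded_linear_right sums[OF that]] by (simp add: y'_def)
      then have "(\<lambda>n. y' n t) sums (B (Q t) (\<Sum>n. y n t) + y' 0 t)"
        by (rule sums_Suc)
      then show ?thesis
        by (simp add: y'_def sums_iff)
    qed
    have "\<exists>g. \<forall>t\<in>{a..T}. (\<lambda>n. y n t) sums g t \<and>
        (g has_derivative (\<lambda>h. h *\<^sub>R (\<Sum>i. y' i t))) (at t within {a..T})"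
    proof (rule has_derivative_series[where x = a])
      show "(y n has_derivative (\<lambda>h. h *\<^sub>R y' n t)) (at t within {a..T})" if "t \<in> {a..T}" for n t
        using has_vector_derivative_within_subset[OF deriv_y, of t "{a..T}" n] that
        unfolding has_vector_derivative_def by auto
      show "\<forall>\<^sub>F n in sequentially. \<forall>t\<in>{a..T}. \<forall>h. norm ((\<Sum>i<n. h *\<^sub>R y' i t) - h *\<^sub>R (\<Sum>i. y' i t)) \<le> e * norm h"
        if "0 < e" for e
        using uniform_limitD[OF lim that]
      proof eventually_elim
        case (elim n)
        show ?case
        proof (intro ballI allI)
          fix t h assume "t \<in> {a..T}"
          then have "norm ((\<Sum>i<n. y' i t) - (\<Sum>i. y' i t)) \<le> e"
            using elim by (auto simp: dist_norm intro: less_imp_le)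
          then have "\<bar>h\<bar> * norm ((\<Sum>i<n. y' i t) - (\<Sum>i. y' i t)) \<le> \<bar>h\<bar> * e"
            by (rule mult_left_mono) simp
          then show "norm ((\<Sum>i<n. h *\<^sub>R y' i t) - h *\<^sub>R (\<Sum>i. y' i t)) \<le> e * norm h"
            by (simp add: mult.commute flip: scaleR_sum_right scaleR_diff_right)
        qed
      qed
    qed (use that sums in auto)
    then obtain g where g: "\<And>t. t \<in> {a..T} \<Longrightarrow> (\<lambda>n. y n t) sums g t"
      "\<And>t. t \<in> {a..T} \<Longrightarrow> (g has_vector_derivative (\<Sum>i. y' i t)) (at t within {a..T})"
      unfolding has_vector_derivative_def by blast
    have "((\<lambda>t. \<Sum>n. y n t) has_vector_derivative B (Q t) (\<Sum>n. y n t)) (at t within {a..T})"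
      if "t \<in> {a..T}" for t
      unfolding y'_sum[OF that, symmetric]
      by (rule has_vector_derivative_transform[OF that _ g(2)[OF that]]) (use g(1) in \<open>simp add: sums_iff\<close>)
    then show ?thesis
      using sums by auto
  qed
  show ?thesis
  proof (intro exI conjI allI impI)
    have "y (Suc n) a = 0" for n
      by (simp add: y_Suc)
    then have "(\<lambda>n. y n a) sums (0 + y 0 a)"
      by (intro sums_Suc) simp
    then show "(\<Sum>n. y n a) = v0"
      by (simp add: sums_iff y_0)
    \<comment> \<open>Working up to t + 1 leaves room to the right of t, so the derivative within
      the compact interval is the one within the half-line.\<close>
    show "((\<lambda>t. \<Sum>n. y n t) has_vector_derivative B (Q t) (\<Sum>n. y n t)) (at t within {a..})" if "a \<le> t" for t
      by (rule has_vector_derivative_Ici[of _ _ _ _ "t + 1"]) (use main[of "t + 1"] that in auto)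
  qed
qed

section \<open>Complex matrices with simple real spectrum\<close>

lemma matrix_mult_scaleR:
  fixes A B :: "complex^'m^'m"
  shows "(c *\<^sub>R A) ** B = c *\<^sub>R (A ** B)" "A ** (c *\<^sub>R B) = c *\<^sub>R (A ** B)"
  by (simp_all add: matrix_matrix_mult_def vec_eq_iff scaleR_sum_right)

lemma matrix_vector_scaleR:
  fixes A :: "complex^'m^'m"
  shows "(c *\<^sub>R A) *v x = c *\<^sub>R (A *v x)" "A *v (c *\<^sub>R x) = c *\<^sub>R (A *v x)"
  by (simp_all add: matrix_vector_mult_def vec_eq_iff scaleR_sum_right)

lemma bounded_bilinear_matrix_mult:
  "bounded_bilinear ((**) :: complex^'m^'m \<Rightarrow> complex^'m^'m \<Rightarrow> complex^'m^'m)"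
  unfolding bilinear_conv_bounded_bilinear[symmetric] bilinear_def
  by (intro conjI allI linearI)
    (simp_all add: matrix_mult_scaleR matrix_matrix_mult_def vec_eq_iff sum.distrib algebra_simps scaleR_sum_right)

lemma bounded_bilinear_matrix_vector:
  "bounded_bilinear ((*v) :: complex^'m^'m \<Rightarrow> complex^'m \<Rightarrow> complex^'m)"
  unfolding bilinear_conv_bounded_bilinear[symmetric] bilinear_def
  by (intro conjI allI linearI)
    (simp_all add: matrix_vector_right_distrib matrix_vector_mult_add_rdistrib matrix_vector_scaleR)

lemma matrix_mult_vec_distribs:
  fixes A B C :: "complex^'m^'m"
  shows "(A - B) ** C = A ** C - B ** C" "A ** (B - C) = A ** B - A ** C"
    "(A - B) *v x = A *v x - B *v x" "A *v (x - y) = A *v x - A *v y"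
    "(A + B) *v x = A *v x + B *v x" "A *v (x + y) = A *v x + A *v y"
    "(- A) *v x = - (A *v x)" "A *v (- x) = - (A *v x)"
  using bounded_bilinear.diff_left[OF bounded_bilinear_matrix_mult]
    bounded_bilinear.diff_right[OF bounded_bilinear_matrix_mult]
    bounded_bilinear.diff_left[OF bounded_bilinear_matrix_vector]
    bounded_bilinear.diff_right[OF bounded_bilinear_matrix_vector]
    bounded_bilinear.add_left[OF bounded_bilinear_matrix_vector]
    bounded_bilinear.add_right[OF bounded_bilinear_matrix_vector]
    bounded_bilinear.minus_left[OF bounded_bilinear_matrix_vector]
    bounded_bilinear.minus_right[OF bounded_bilinear_matrix_vector]
  by metis+

lemma bounded_linear_cmat_adj: "bounded_linear (cmat_adj :: complex^'m^'m \<Rightarrow> complex^'m^'m)"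
  unfolding linear_conv_bounded_linear[symmetric]
  by (rule linearI) (simp_all add: cmat_adj_def vec_eq_iff)

lemma bounded_linear_diag_part: "bounded_linear (diag_part :: complex^'m^'m \<Rightarrow> complex^'m^'m)"
  unfolding linear_conv_bounded_linear[symmetric]
  by (rule linearI) (simp_all add: diag_part_def vec_eq_iff)

text \<open>No conjugation in the second factor: an oblique spectral projection is then
  \<open>outer\<close> of a column of U and a row of its inverse, while
  \<open>outer u (vcnj u)\<close> is the Hermitian projection onto the line of a unit vector
  u.\<close>

definition outer :: "complex^'m \<Rightarrow> complex^'m \<Rightarrow> complex^'m^'m" where
  "outer u y = (\<chi> r c. u $ r * y $ c)"

definition vcnj :: "complex^'m \<Rightarrow> complex^'m" where
  "vcnj u = (\<chi> r. cnj (u $ r))"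

text \<open>The orthogonal projection onto the range of \<open>P\<close> when \<open>P\<close> has rank one.\<close>
definition orth :: "complex^'m^'m \<Rightarrow> complex^'m^'m" where
  "orth P = inverse (P \<bullet> P) *\<^sub>R (P ** cmat_adj P)"

lemma sum_norm_power2:
  fixes u :: "complex^'m"
  shows "(\<Sum>r\<in>UNIV. u $ r * cnj (u $ r)) = of_real ((norm u)\<^sup>2)"
proof -
  have "(norm u)\<^sup>2 = (\<Sum>r\<in>UNIV. (cmod (u $ r))\<^sup>2)"
    by (simp add: norm_vec_def L2_set_def sum_nonneg)
  then show ?thesis
    by (simp only: of_real_sum complex_norm_square)
qed

lemma outer_inner: "outer u y \<bullet> outer u y = (norm u)\<^sup>2 * (norm y)\<^sup>2"
  by (simp add: inner_vec_def outer_def dot_square_norm norm_mult power_mult_distrib norm_vec_def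
      L2_set_def sum_nonneg sum_product)

text \<open>Multiplying \<open>outer u y\<close> by its adjoint leaves the projection onto u times
  |y|^2, and |y|^2 is also its squared Frobenius norm, because |u| = 1.\<close>

lemma orth_outer:
  assumes "norm u = 1" "y \<noteq> 0"
  shows "orth (outer u y) = outer u (vcnj u)"
proof -
  have "outer u y ** cmat_adj (outer u y) = (norm y)\<^sup>2 *\<^sub>R outer u (vcnj u)"
    unfolding vec_eq_iff vector_scaleR_component scaleR_conv_of_real[where 'a = complex] sum_norm_power2[symmetric]
    by (simp add: matrix_matrix_mult_def outer_def vcnj_def cmat_adj_def sum_distrib_left sum_distrib_right mult_ac)
  then show ?thesis
    using assms by (simp add: orth_def outer_inner)
qed

lemma outer_mult_vec: "outer u y *v x = (\<Sum>c\<in>UNIV. y $ c * x $ c) *s u"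
  by (simp add: outer_def matrix_vector_mult_def vec_eq_iff sum_distrib_left mult_ac)

lemma outer_mult_outer: "outer u y ** outer v z = outer ((\<Sum>c\<in>UNIV. y $ c * v $ c) *s u) z"
  by (simp add: outer_def matrix_matrix_mult_def vec_eq_iff sum_distrib_left mult_ac)

lemma norm_smult: "norm (c *s (x :: complex^'m)) = cmod c * norm x"
  by (simp add: norm_vec_def norm_mult L2_set_right_distrib)

text \<open>For the last claim: a unit vector v on the line of u equals \<alpha> u with |\<alpha>| =
  1, and \<alpha> cancels against its conjugate.\<close>

lemma outer_vcnj:
  assumes u: "norm u = 1"
  shows "outer u (vcnj u) ** outer u y = outer u y"
    and "outer u (vcnj u) *v u = u"
    and "cmat_adj (outer u (vcnj u)) = outer u (vcnj u)"
    and "outer u (vcnj u) *v v = v \<Longrightarrow> norm v = 1 \<Longrightarrow> outer v (vcnj v) = outer u (vcnj u)"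
proof -
  have 1: "(\<Sum>c\<in>UNIV. vcnj u $ c * u $ c) = 1"
    using sum_norm_power2[of u] u by (simp add: vcnj_def mult.commute)
  show "outer u (vcnj u) ** outer u y = outer u y"
    by (simp add: outer_mult_outer 1)
  show "outer u (vcnj u) *v u = u"
    by (simp add: outer_mult_vec 1)
  show "cmat_adj (outer u (vcnj u)) = outer u (vcnj u)"
    by (simp add: cmat_adj_def outer_def vcnj_def vec_eq_iff mult.commute)
  show "outer v (vcnj v) = outer u (vcnj u)" if "outer u (vcnj u) *v v = v" "norm v = 1"
  proof -
    define \<alpha> where "\<alpha> = (\<Sum>c\<in>UNIV. vcnj u $ c * v $ c)"
    have v: "v = \<alpha> *s u"
      using that(1) unfolding outer_mult_vec \<alpha>_def by simp
    then have "cmod \<alpha> = 1"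
      using that(2) u by (metis norm_smult mult.right_neutral)
    then have "\<alpha> * cnj \<alpha> = 1"
      by (simp flip: complex_norm_square)
    then have "\<alpha> * a * (cnj \<alpha> * b) = a * b" for a b
      by (metis mult.assoc mult.left_commute mult_1)
    then show ?thesis
      by (simp add: v outer_def vcnj_def vec_eq_iff)
  qed
qed

text \<open>The inner product on complex vectors is the real part of the Hermitian one, so the
  conjugate transpose is the adjoint here as well.\<close>

lemma inner_cmat_adj:
  fixes A :: "complex^'m^'m"
  shows "x \<bullet> (A *v y) = (cmat_adj A *v x) \<bullet> y"
proof -
  have eq: "a \<bullet> (b * c) = (cnj b * a) \<bullet> c" for a b c :: complex
    by (simp add: inner_complex_def algebra_simps)
  have "x \<bullet> (A *v y) = (\<Sum>i\<in>UNIV. \<Sum>j\<in>UNIV. (cnj (A $ i $ j) * x $ i) \<bullet> (y $ j))"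
    by (simp add: inner_vec_def matrix_vector_mult_def inner_sum_right eq)
  also have "\<dots> = (\<Sum>j\<in>UNIV. \<Sum>i\<in>UNIV. (cnj (A $ i $ j) * x $ i) \<bullet> (y $ j))"
    by (rule sum.swap)
  also have "\<dots> = (cmat_adj A *v x) \<bullet> y"
    by (simp add: inner_vec_def matrix_vector_mult_def inner_sum_left cmat_adj_def)
  finally show ?thesis .
qed

section \<open>Spectral projections by Lagrange interpolation\<close>

fun lagrange :: "complex^'m^'m \<Rightarrow> ('m \<Rightarrow> real) \<Rightarrow> 'm \<Rightarrow> 'm list \<Rightarrow> complex^'m^'m" where
  "lagrange B \<mu> i [] = mat 1"
| "lagrange B \<mu> i (j # js) = inverse (\<mu> i - \<mu> j) *\<^sub>R (B - \<mu> j *\<^sub>R mat 1) ** lagrange B \<mu> i js"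

text \<open>The Lagrange basis polynomial at the i-th eigenvalue, evaluated at B. Being an explicit
  product in B and \<mu>, it inherits symbol estimates. The sorted list only fixes an order for the
  matrix factors.\<close>

definition eigproj :: "complex^'m::{finite,linorder}^'m::{finite,linorder} \<Rightarrow> ('m::{finite,linorder} \<Rightarrow> real) \<Rightarrow> 'm::{finite,linorder} \<Rightarrow> complex^'m::{finite,linorder}^'m::{finite,linorder}" where
  "eigproj B \<mu> i = lagrange B \<mu> i (sorted_list_of_set (UNIV - {i}))"

lemma lagrange_eigenvector:
  assumes "B *v u = \<mu> k *\<^sub>R u"
  shows "lagrange B \<mu> i js *v u = (\<Prod>j\<leftarrow>js. inverse (\<mu> i - \<mu> j) * (\<mu> k - \<mu> j)) *\<^sub>R u"
proof (induction js)
  case (Cons j js)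
  show ?case
    by (simp add: Cons matrix_vector_mul_assoc[symmetric] matrix_vector_scaleR matrix_mult_vec_distribs assms
        matrix_vector_mul_lid algebra_simps)
qed (simp add: matrix_vector_mul_lid)

lemma prod_list_eq_0_iff': "prod_list (map f xs) = (0::real) \<longleftrightarrow> (\<exists>x\<in>set xs. f x = 0)"
  by (induction xs) auto

text \<open>On the i-th eigenvector every factor equals 1; on the k-th one the factor belonging to j
  = k vanishes.\<close>

lemma eigproj_eigenvector:
  fixes \<mu> :: "'m::{finite,linorder} \<Rightarrow> real"
  assumes "inj \<mu>" "B *v u = \<mu> k *\<^sub>R u"
  shows "eigproj B \<mu> i *v u = (if k = i then u else 0)"
proof -
  have "(\<Prod>j\<leftarrow>js. inverse (\<mu> i - \<mu> j) * (\<mu> i - \<mu> j)) = 1" if "i \<notin> set js" for js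
    using that assms(1) by (induction js) (auto simp: inj_eq)
  moreover have "(\<Prod>j\<leftarrow>sorted_list_of_set (UNIV - {i}). inverse (\<mu> i - \<mu> j) * (\<mu> k - \<mu> j)) = 0" if "k \<noteq> i"
    unfolding prod_list_eq_0_iff' using that by (auto intro!: bexI[of _ k])
  ultimately show ?thesis
    unfolding eigproj_def lagrange_eigenvector[of B u \<mu> k, OF assms(2)] by auto
qed

lemma of_real_smult: "complex_of_real c *s x = c *\<^sub>R (x :: complex^'m)"
  by (simp add: vec_eq_iff scaleR_conv_of_real[where 'a = complex])

text \<open>The projections themselves prove that the eigenvectors form a basis: applied to U x, the
  i-th one isolates the i-th coefficient of x, so U has trivial kernel.\<close>

lemma eigen_decomposition:
  fixes B :: "complex^'m::{finite,linorder}^'m::{finite,linorder}" and \<mu> :: "'m::{finite,linorder} \<Rightarrow> real"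
  assumes "inj \<mu>" and eig: "\<And>i. is_eigenvalue B (complex_of_real (\<mu> i))"
  obtains U W where "U ** W = mat 1" "W ** U = mat 1"
    "\<And>i. norm (column i U) = 1" "\<And>i. B *v column i U = \<mu> i *\<^sub>R column i U"
    "\<And>i. eigproj B \<mu> i = outer (column i U) (row i W)"
    "(\<Sum>i\<in>UNIV. eigproj B \<mu> i) = mat 1"
    "\<And>i. row i W \<noteq> 0"
proof -
  have "\<exists>u. norm u = 1 \<and> B *v u = \<mu> i *\<^sub>R u" for i
  proof -
    obtain v where v: "v \<noteq> 0" "B *v v = \<mu> i *\<^sub>R v"
      using eig[of i] unfolding is_eigenvalue_def of_real_smult by auto
    then show ?thesis
      by (intro exI[of _ "inverse (norm v) *\<^sub>R v"]) (simp add: matrix_vector_scaleR)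
  qed
  then obtain u where u: "\<And>i. norm (u i) = 1" "\<And>i. B *v u i = \<mu> i *\<^sub>R u i"
    by metis
  define U :: "((complex, 'm) vec, 'm) vec" where "U = (\<chi> r c. u c $ r)"
  have col: "column i U = u i" for i
    by (simp add: column_def U_def vec_eq_iff)
  have P: "eigproj B \<mu> i *v u k = (if k = i then u k else 0)" for i k
    using eigproj_eigenvector[OF assms(1) u(2)] by auto
  have smult: "A *v (c *s x) = c *s (A *v x)" for A :: "((complex, 'm) vec, 'm) vec" and c x
    by (simp add: vec.scale)
  have PU: "eigproj B \<mu> i *v (U *v x) = x $ i *s u i" for i x
  proof -
    have "eigproj B \<mu> i *v (U *v x) = (\<Sum>k\<in>UNIV. x $ k *s (eigproj B \<mu> i *v u k))"
      by (simp add: matrix_mult_sum[of U] col bounded_bilinear.sum_right[OF bounded_bilinear_matrix_vector] smult)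
    also have "\<dots> = (\<Sum>k\<in>UNIV. if k = i then x $ i *s u i else 0)"
      by (intro sum.cong) (auto simp: P)
    finally show ?thesis
      by simp
  qed
  have "x = 0" if "U *v x = 0" for x
  proof -
    have "x $ i *s u i = 0" for i
      using PU[of i x] that by simp
    then have "cmod (x $ i) = 0" for i
      using u(1) by (metis norm_smult norm_zero mult.right_neutral)
    then show ?thesis
      by (simp add: vec_eq_iff)
  qed
  then obtain W where W: "W ** U = mat 1"
    using matrix_left_invertible_ker by blast
  then have W': "U ** W = mat 1"
    by (simp add: matrix_left_right_inverse)
  have proj: "eigproj B \<mu> i = outer (u i) (row i W)" for i
  proof -
    have "eigproj B \<mu> i *v x = outer (u i) (row i W) *v x" for x
    proof -
      have "eigproj B \<mu> i *v x = eigproj B \<mu> i *v (U *v (W *v x))"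
        by (simp add: matrix_vector_mul_assoc W' matrix_vector_mul_lid)
      also have "\<dots> = (W *v x) $ i *s u i"
        by (rule PU)
      also have "\<dots> = outer (u i) (row i W) *v x"
        by (subst outer_mult_vec) (simp add: matrix_vector_mult_def row_def)
      finally show ?thesis .
    qed
    then show ?thesis
      by (simp add: matrix_eq)
  qed
  have "(\<Sum>i\<in>UNIV. eigproj B \<mu> i) = U ** W"
    unfolding proj by (simp add: vec_eq_iff outer_def matrix_matrix_mult_def row_def U_def)
  moreover have "row i W \<noteq> 0" for i
  proof
    assume "row i W = 0"
    moreover have "(W ** U) $ i $ i = (\<Sum>k\<in>UNIV. row i W $ k * U $ k $ i)"
      by (simp add: matrix_matrix_mult_def row_def)
    ultimately show False
      by (simp add: W mat_def)
  qed
  ultimately show ?thesis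
    using that[of U W] W W' col u proj by simp
qed

text \<open>Turns a statement about the spectrum into equations between functions continuous in the
  matrix and the roots, which survive a passage to the limit.\<close>

lemma det_eigen:
  fixes B :: "complex^'m::{finite,linorder}^'m::{finite,linorder}" and \<mu> :: "'m::{finite,linorder} \<Rightarrow> real"
  assumes "inj \<mu>" and eig: "\<And>i. is_eigenvalue B (complex_of_real (\<mu> i))"
  shows "det (z *\<^sub>R mat 1 - B) = (\<Prod>i\<in>UNIV. complex_of_real (z - \<mu> i))"
proof -
  obtain U W where UW: "U ** W = mat 1" "\<And>i. B *v column i U = \<mu> i *\<^sub>R column i U"
    by (rule eigen_decomposition[OF assms]) blast
  let ?D = "\<chi> i j. if i = j then complex_of_real (z - \<mu> i) else 0"
  have BU: "(B ** U) $ r $ c = complex_of_real (\<mu> c) * U $ r $ c" for r c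
  proof -
    have "(B ** U) $ r $ c = (\<mu> c *\<^sub>R column c U) $ r"
      unfolding UW(2)[symmetric] by (simp add: matrix_matrix_mult_def matrix_vector_mult_def column_def)
    then show ?thesis
      by (simp add: column_def scaleR_conv_of_real[where 'a = complex])
  qed
  have UD: "(U ** ?D) $ r $ c = U $ r $ c * complex_of_real (z - \<mu> c)" for r c
    by (simp add: matrix_matrix_mult_def if_distrib[of "\<lambda>x. _ * x"] cong: if_cong)
  have "(z *\<^sub>R mat 1 - B) ** U = z *\<^sub>R U - B ** U"
    by (simp add: matrix_mult_vec_distribs matrix_mult_scaleR)
  also have "\<dots> = U ** ?D"
    by (simp add: vec_eq_iff BU UD scaleR_conv_of_real[where 'a = complex] right_diff_distrib mult.commute)
  finally have "(z *\<^sub>R mat 1 - B) ** U = U ** ?D" .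
  then have "det (z *\<^sub>R mat 1 - B) * det U = det U * det ?D"
    by (metis det_mul[of "z *\<^sub>R mat 1 - B" U] det_mul[of U ?D])
  moreover have "det U \<noteq> 0"
    using det_mul[of U W] UW(1) by auto
  moreover have "det ?D = (\<Prod>i\<in>UNIV. complex_of_real (z - \<mu> i))"
    by (subst det_diagonal) auto
  ultimately show ?thesis
    by simp
qed

section \<open>Uniform separation of the characteristic roots\<close>

lemma is_eigenvalue_scaleR:
  fixes B :: "complex^'m^'m"
  assumes "is_eigenvalue B (complex_of_real \<mu>)"
  shows "is_eigenvalue (c *\<^sub>R B) (complex_of_real (c * \<mu>))"
proof -
  obtain v where "v \<noteq> 0" "B *v v = \<mu> *\<^sub>R v"
    using assms unfolding is_eigenvalue_def of_real_smult by auto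
  then show ?thesis
    unfolding is_eigenvalue_def of_real_smult
    by (intro exI[of _ v]) (simp add: matrix_vector_scaleR)
qed

lemma continuous_on_det:
  fixes f :: "'a::topological_space \<Rightarrow> complex^'m^'m"
  assumes "continuous_on S f"
  shows "continuous_on S (\<lambda>p. det (f p))"
  unfolding det_def by (intro continuous_intros assms)

text \<open>The consequences of (A1) and (A2) on the zone, where the cut-off equals 1. Homogeneity
  is stated for \<open>A1\<close>, so the roots at \<xi> and at \<xi>/|\<xi>| have to be compared as
  sets, without regard to their labels.\<close>

locale hyperbolic_principal =
  fixes N :: real
    and A A1 :: "real \<Rightarrow> real^'n \<Rightarrow> complex^'m::{finite,linorder}^'m::{finite,linorder}"
    and lam :: "'m::{finite,linorder} \<Rightarrow> real \<Rightarrow> real^'n \<Rightarrow> real"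
  assumes N: "0 < N"
    and cont_A: "continuous_on ({0..} \<times> UNIV) (\<lambda>(t, \<xi>). A t \<xi>)"
    and A_symb: "symb N K 1 0 A"
    and hom: "0 < \<rho> \<Longrightarrow> A1 t (\<rho> *\<^sub>R \<xi>) = \<rho> *\<^sub>R A1 t \<xi>"
    and diff_symb: "symb N K 0 1 (\<lambda>t \<xi>. A t \<xi> - A1 t \<xi>)"
    and eigenvalues: "(t, \<xi>) \<in> Zhyp N \<Longrightarrow> {\<zeta>. is_eigenvalue (A1 t \<xi>) \<zeta>} = {complex_of_real (lam i t \<xi>) | i. True}"
    and inj_lam: "(t, \<xi>) \<in> Zhyp N \<Longrightarrow> inj (\<lambda>i. lam i t \<xi>)"
    and lam_symb: "symb N K 1 0 (lam i)"
    and far: "i \<noteq> j \<Longrightarrow> \<exists>\<delta>>0. \<forall>\<^sub>F t in at_top. \<forall>\<omega>. norm \<omega> = 1 \<longrightarrow> \<delta> \<le> \<bar>lam i t \<omega> - lam j t \<omega>\<bar>"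
begin

lemma eigenvalue_lam: "(t, \<xi>) \<in> Zhyp N \<Longrightarrow> is_eigenvalue (A1 t \<xi>) (complex_of_real (lam i t \<xi>))"
  using eigenvalues by blast

lemma eigenvalue_real_iff:
  "(t, \<xi>) \<in> Zhyp N \<Longrightarrow> is_eigenvalue (A1 t \<xi>) (complex_of_real x) \<longleftrightarrow> (\<exists>i. x = lam i t \<xi>)"
  using eigenvalues[of t \<xi>] by (auto simp: set_eq_iff)

text \<open>For small t the unit vector may lie outside the zone, where the spectrum is not
  prescribed; homogeneity carries it over from \<xi>.\<close>

lemma eigenvalue_direction:
  assumes "(t, \<xi>) \<in> Zhyp N"
  shows "is_eigenvalue (A1 t (inverse (norm \<xi>) *\<^sub>R \<xi>)) (complex_of_real (lam i t \<xi> / norm \<xi>))"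
proof -
  have "A1 t (inverse (norm \<xi>) *\<^sub>R \<xi>) = inverse (norm \<xi>) *\<^sub>R A1 t \<xi>"
    using ZhypD[OF assms N] by (intro hom) auto
  then show ?thesis
    using is_eigenvalue_scaleR[OF eigenvalue_lam[OF assms], of "inverse (norm \<xi>)" i]
    by (simp add: divide_inverse mult.commute)
qed

text \<open>By homogeneity the error of A(t, k \<omega>)/k is (A - A1)(t, k \<omega>)/k, at most C/k
  because A - A1 has order zero. Once k exceeds N, the point (t, k \<omega>) is in the zone for
  every t \<ge> 0, so the limit is uniform.\<close>

lemma continuous_A1: "continuous_on ({0..} \<times> sphere 0 1) (\<lambda>(t, \<omega>). A1 t \<omega>)"
proof -
  obtain C where C: "0 < C" "\<And>t \<xi>. (t, \<xi>) \<in> Zhyp N \<Longrightarrow> norm (A t \<xi> - A1 t \<xi>) \<le> C * (norm \<xi> powr 0 * (1 + t) powr - 1)"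
    using symb_bound[OF diff_symb[of 0]] by metis
  have C': "norm (A t \<xi> - A1 t \<xi>) \<le> C" if "(t, \<xi>) \<in> Zhyp N" for t \<xi>
  proof -
    have "norm (A t \<xi> - A1 t \<xi>) \<le> C * (norm \<xi> powr 0 * (1 + t) powr - 1)"
      by (rule C(2)[OF that])
    also have "\<dots> \<le> C * 1"
      using ZhypD[OF that N] C(1) by (intro mult_left_mono) (auto simp: powr_minus_divide)
    finally show ?thesis
      by simp
  qed
  define f where "f k = (\<lambda>(t, \<omega>). inverse (real k) *\<^sub>R A t (real k *\<^sub>R \<omega>))" for k
  have "uniform_limit ({0..} \<times> sphere 0 1) f (\<lambda>(t, \<omega>). A1 t \<omega>) sequentially"
  proof (rule uniform_limitI)
    fix e :: real assume e: "0 < e"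
    have "eventually (\<lambda>k. C / e < real k) sequentially" "eventually (\<lambda>k. N < real k) sequentially"
      using filterlim_real_sequentially by (auto simp: filterlim_at_top_dense)
    then show "\<forall>\<^sub>F k in sequentially. \<forall>x\<in>{0..} \<times> sphere 0 1. dist (f k x) (case x of (t, \<omega>) \<Rightarrow> A1 t \<omega>) < e"
    proof eventually_elim
      case (elim k)
      have k: "0 < real k"
        using elim N by linarith
      show ?case
      proof (rule ballI)
        fix x :: "real \<times> (real^'n)" assume "x \<in> {0..} \<times> sphere 0 1"
        then obtain t \<omega> where x: "x = (t, \<omega>)" and t: "0 \<le> t" and "norm \<omega> = 1"
          by auto
        have "real k \<le> (1 + t) * real k"
          using t k by simp
        then have "N \<le> (1 + t) * real k"
          using elim by linarith
        then have "(t, real k *\<^sub>R \<omega>) \<in> Zhyp N"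
          unfolding Zhyp_def using t \<open>norm \<omega> = 1\<close> by simp
        then have "norm (inverse (real k) *\<^sub>R (A t (real k *\<^sub>R \<omega>) - A1 t (real k *\<^sub>R \<omega>))) \<le> inverse (real k) * C"
          using C' k by (simp add: mult_left_mono)
        also have "inverse (real k) * C < e"
          using elim k e by (simp add: field_simps)
        finally have "dist (inverse (real k) *\<^sub>R A t (real k *\<^sub>R \<omega>)) (A1 t \<omega>) < e"
          using hom[OF k, of t \<omega>] k by (simp add: dist_norm scaleR_diff_right)
        then show "dist (f k x) (case x of (t, \<omega>) \<Rightarrow> A1 t \<omega>) < e"
          by (simp add: f_def x)
      qed
    qed
  qed
  moreover have "continuous_on ({0..} \<times> sphere 0 1) (f k)" for k
  proof -
    have "continuous_on ({0..} \<times> sphere 0 1) (\<lambda>p. (\<lambda>(t, \<xi>). A t \<xi>) (fst p, real k *\<^sub>R snd p))"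
      by (rule continuous_on_compose2[OF cont_A]) (auto intro!: continuous_intros)
    then show ?thesis
      unfolding f_def case_prod_unfold by (intro continuous_intros) simp
  qed
  ultimately show ?thesis
    by (intro uniform_limit_theorem[where F = sequentially and f = f]) auto
qed

lemma gap_bounded_time:
  assumes "0 \<le> T" "i \<noteq> j"
  shows "\<exists>\<delta>>0. \<forall>t \<xi>. (t, \<xi>) \<in> Zhyp N \<longrightarrow> t \<le> T \<longrightarrow> \<delta> * norm \<xi> \<le> \<bar>lam i t \<xi> - lam j t \<xi>\<bar>"
proof -
  have "\<exists>C. \<forall>t \<xi>. (t, \<xi>) \<in> Zhyp N \<longrightarrow> \<bar>lam i t \<xi>\<bar> \<le> C * norm \<xi>" for i
  proof -
    obtain C where C: "\<And>t \<xi>. (t, \<xi>) \<in> Zhyp N \<Longrightarrow> norm (lam i t \<xi>) \<le> C * (norm \<xi> powr 1 * (1 + t) powr - 0)"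
      using symb_bound[OF lam_symb[of 0 i]] by metis
    have "\<bar>lam i t \<xi>\<bar> \<le> C * norm \<xi>" if "(t, \<xi>) \<in> Zhyp N" for t \<xi>
      using C[OF that] ZhypD[OF that N] by simp
    then show ?thesis
      by blast
  qed
  then obtain C where C: "\<And>i t \<xi>. (t, \<xi>) \<in> Zhyp N \<Longrightarrow> \<bar>lam i t \<xi>\<bar> \<le> C i * norm \<xi>"
    by metis
  \<comment> \<open>The radius bounds the vector of roots divided by |\<xi>|, so that every point of
    the zone with t \<le> T gives an element of K.\<close>
  define D where "D = {0..T} \<times> (sphere 0 1 :: (real^'n) set) \<times> (cball 0 (\<Sum>i\<in>UNIV. C i) :: ((real, 'm) vec) set)"
  define g where "g z p = det (z *\<^sub>R mat 1 - A1 (fst p) (fst (snd p))) - (\<Prod>l\<in>UNIV. complex_of_real (z - snd (snd p) $ l))"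
    for z and p :: "real \<times> (real^'n) \<times> ((real, 'm) vec)"
  define K where "K = {p \<in> D. \<forall>z. g z p = 0}"
  have "compact D"
    unfolding D_def by (intro compact_Times) auto
  have cont_A1: "continuous_on D (\<lambda>p. A1 (fst p) (fst (snd p)))"
  proof -
    have "continuous_on D (\<lambda>p. (\<lambda>(t, \<omega>). A1 t \<omega>) (fst p, fst (snd p)))"
      by (rule continuous_on_compose2[OF continuous_A1]) (auto intro!: continuous_intros simp: D_def)
    then show ?thesis
      by simp
  qed
  have "continuous_on D (g z)" for z
    unfolding g_def by (intro continuous_intros continuous_on_det cont_A1)
  then have "closed {p \<in> D. g z p = 0}" for z
    by (intro continuous_closed_preimage_constant compact_imp_closed \<open>compact D\<close>)
  then have "closed (D \<inter> (\<Inter>z. {p \<in> D. g z p = 0}))"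
    by (intro closed_Int closed_INT compact_imp_closed \<open>compact D\<close>) auto
  moreover have K_eq: "K = D \<inter> (\<Inter>z. {p \<in> D. g z p = 0})"
    unfolding K_def by auto
  ultimately have "closed K"
    by simp
  then have "compact (D \<inter> K)"
    by (rule compact_Int_closed[OF \<open>compact D\<close>])
  moreover have "D \<inter> K = K"
    unfolding K_def by auto
  ultimately have "compact K"
    by simp
  have K_inj: "inj (\<lambda>l. x $ l)" if "(t, \<omega>, x) \<in> K" for t \<omega> x
  proof -
    have t: "0 \<le> t" "norm \<omega> = 1" and x: "\<And>z. det (z *\<^sub>R mat 1 - A1 t \<omega>) = (\<Prod>l\<in>UNIV. complex_of_real (z - x $ l))"
      using that unfolding K_def D_def g_def by (simp_all add: mem_Times_iff)
    \<comment> \<open>The point N \<omega> lies in the zone for all t \<ge> 0, so scaling from there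
      determines the spectrum at \<omega>.\<close>
    have Z: "(t, N *\<^sub>R \<omega>) \<in> Zhyp N"
      using t N by (simp add: Zhyp_def)
    define \<mu> where "\<mu> l = lam l t (N *\<^sub>R \<omega>) / N" for l
    have "is_eigenvalue (A1 t \<omega>) (complex_of_real (\<mu> l))" for l
      using eigenvalue_direction[OF Z, of l] t N by (simp add: \<mu>_def)
    moreover have "inj \<mu>"
      using inj_lam[OF Z] N by (auto simp: \<mu>_def inj_on_def)
    ultimately have "(\<Prod>l\<in>UNIV. complex_of_real (z - \<mu> l)) = (\<Prod>l\<in>UNIV. complex_of_real (z - x $ l))" for z
      using det_eigen[of \<mu> "A1 t \<omega>" z] x[of z] by simp
    note eq = this
    have "\<exists>l. \<mu> k = x $ l" for k
    proof -
      have "(\<Prod>l\<in>UNIV. complex_of_real (\<mu> k - x $ l)) = 0"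
        unfolding eq[symmetric] by (intro prod_zero) auto
      then show ?thesis
        by (simp add: prod_zero_iff)
    qed
    \<comment> \<open>Counting: as many distinct roots as x has entries all occur among these
      entries, so the entries are distinct.\<close>
    then have "range \<mu> \<subseteq> range (\<lambda>l. x $ l)"
      by auto
    then have "card (range \<mu>) \<le> card (range (\<lambda>l. x $ l))"
      by (intro card_mono) auto
    moreover have "card (range \<mu>) = CARD('m)"
      by (intro card_image \<open>inj \<mu>\<close>)
    ultimately show ?thesis
      using card_image_le[of UNIV "\<lambda>l. x $ l"] by (intro eq_card_imp_inj_on) auto
  qed
  have "\<exists>\<delta>>0. \<forall>p\<in>K. \<delta> \<le> \<bar>snd (snd p) $ i - snd (snd p) $ j\<bar>"
  proof (cases "K = {}")
    case True
    then show ?thesis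
      by (intro exI[of _ 1]) auto
  next
    case False
    have "continuous_on K (\<lambda>p. \<bar>snd (snd p) $ i - snd (snd p) $ j\<bar>)"
      by (intro continuous_intros)
    then obtain p where p: "p \<in> K" "\<And>q. q \<in> K \<Longrightarrow> \<bar>snd (snd p) $ i - snd (snd p) $ j\<bar> \<le> \<bar>snd (snd q) $ i - snd (snd q) $ j\<bar>"
      using continuous_attains_inf[OF \<open>compact K\<close> False] by blast
    have "inj (\<lambda>l. snd (snd p) $ l)"
      using K_inj[of "fst p" "fst (snd p)" "snd (snd p)"] p(1) by simp
    then have "snd (snd p) $ i \<noteq> snd (snd p) $ j"
      using injD[of "\<lambda>l. snd (snd p) $ l" i j] assms(2) by blast
    then show ?thesis
      using p(2) by (intro exI[of _ "\<bar>snd (snd p) $ i - snd (snd p) $ j\<bar>"]) auto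
  qed
  then obtain \<delta> where \<delta>: "0 < \<delta>" "\<And>p. p \<in> K \<Longrightarrow> \<delta> \<le> \<bar>snd (snd p) $ i - snd (snd p) $ j\<bar>"
    by auto
  have "\<delta> * norm \<xi> \<le> \<bar>lam i t \<xi> - lam j t \<xi>\<bar>" if Z: "(t, \<xi>) \<in> Zhyp N" and "t \<le> T" for t \<xi>
  proof -
    define \<omega> where "\<omega> = inverse (norm \<xi>) *\<^sub>R \<xi>"
    define x :: "(real, 'm) vec" where "x = (\<chi> l. lam l t \<xi> / norm \<xi>)"
    have pos: "0 < norm \<xi>" "0 \<le> t"
      using ZhypD[OF Z N] by auto
    have "norm x \<le> (\<Sum>l\<in>UNIV. \<bar>x $ l\<bar>)"
      by (rule norm_le_l1_cart)
    also have "\<dots> \<le> (\<Sum>l\<in>UNIV. C l)"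
      using C[OF Z] pos by (intro sum_mono) (simp add: x_def divide_le_eq)
    finally have "(t, \<omega>, x) \<in> D"
      using pos that(2) by (simp add: D_def \<omega>_def)
    moreover have "inj (\<lambda>l. x $ l)"
      using inj_lam[OF Z] pos by (auto simp: x_def inj_on_def)
    then have "g z (t, \<omega>, x) = 0" for z
      using det_eigen[of "\<lambda>l. x $ l" "A1 t \<omega>" z] eigenvalue_direction[OF Z]
      by (simp add: g_def x_def \<omega>_def)
    ultimately have "(t, \<omega>, x) \<in> K"
      by (simp add: K_def)
    from \<delta>(2)[OF this] show ?thesis
      using pos by (simp add: x_def pos_le_divide_eq flip: diff_divide_distrib)
  qed
  then show ?thesis
    using \<delta>(1) by blast
qed

lemma gap_pair:
  assumes "i \<noteq> j"
  shows "\<exists>\<delta>>0. \<forall>t \<xi>. (t, \<xi>) \<in> Zhyp N \<longrightarrow> \<delta> * norm \<xi> \<le> \<bar>lam i t \<xi> - lam j t \<xi>\<bar>"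
proof -
  have "\<exists>\<delta>>0. \<forall>\<^sub>F t in at_top. \<forall>\<omega>. norm \<omega> = 1 \<longrightarrow> (k \<noteq> l \<longrightarrow> \<delta> \<le> \<bar>lam k t \<omega> - lam l t \<omega>\<bar>)" for k l
  proof (cases "k = l")
    case True
    then show ?thesis
      by (intro exI[of _ 1]) simp
  qed (use far[of k l] in simp)
  then have "\<exists>d. \<forall>k l. 0 < d k l \<and> (\<forall>\<^sub>F t in at_top. \<forall>\<omega>. norm \<omega> = 1 \<longrightarrow> (k \<noteq> l \<longrightarrow> d k l \<le> \<bar>lam k t \<omega> - lam l t \<omega>\<bar>))"
    by (intro choice allI)
  then obtain d where d: "\<And>k l. 0 < d k l"
    "\<And>k l. \<forall>\<^sub>F t in at_top. \<forall>\<omega>. norm \<omega> = 1 \<longrightarrow> (k \<noteq> l \<longrightarrow> d k l \<le> \<bar>lam k t \<omega> - lam l t \<omega>\<bar>)"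
    by blast
  \<comment> \<open>The roots i and j at \<xi> may reappear at \<omega> under other labels k and l,
    so a bound valid for all pairs is taken.\<close>
  define \<delta>1 where "\<delta>1 = Min (range (\<lambda>p. d (fst p) (snd p)))"
  have "0 < \<delta>1"
    unfolding \<delta>1_def using d(1) by (subst Min_gr_iff) auto
  moreover have "\<delta>1 \<le> d k l" for k l
    unfolding \<delta>1_def using Min_le[OF _ rangeI[of "\<lambda>p. d (fst p) (snd p)" "(k, l)"]] by simp
  ultimately have \<delta>1: "0 < \<delta>1" "\<And>k l. \<delta>1 \<le> d k l"
    by blast+
  have "\<forall>\<^sub>F t in at_top. \<forall>k l. \<forall>\<omega>. norm \<omega> = 1 \<longrightarrow> (k \<noteq> l \<longrightarrow> d k l \<le> \<bar>lam k t \<omega> - lam l t \<omega>\<bar>)"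
    by (intro eventually_all_finite d(2))
  then obtain T0 where T0: "\<And>t k l \<omega>. T0 \<le> t \<Longrightarrow> norm \<omega> = 1 \<Longrightarrow> k \<noteq> l \<Longrightarrow> d k l \<le> \<bar>lam k t \<omega> - lam l t \<omega>\<bar>"
    unfolding eventually_at_top_linorder by blast
  \<comment> \<open>Beyond N every unit vector is in the zone, and beyond T0 the separation at
    infinity applies.\<close>
  define T where "T = max T0 N"
  have "0 \<le> T"
    using N by (simp add: T_def)
  from gap_bounded_time[OF this assms] obtain \<delta>2 where \<delta>2: "0 < \<delta>2"
    "\<And>t \<xi>. (t, \<xi>) \<in> Zhyp N \<Longrightarrow> t \<le> T \<Longrightarrow> \<delta>2 * norm \<xi> \<le> \<bar>lam i t \<xi> - lam j t \<xi>\<bar>"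
    by blast
  have "min \<delta>1 \<delta>2 * norm \<xi> \<le> \<bar>lam i t \<xi> - lam j t \<xi>\<bar>" if Z: "(t, \<xi>) \<in> Zhyp N" for t \<xi>
  proof (cases "t \<le> T")
    case True
    have "min \<delta>1 \<delta>2 * norm \<xi> \<le> \<delta>2 * norm \<xi>"
      by (intro mult_right_mono) auto
    then show ?thesis
      using \<delta>2(2)[OF Z True] by linarith
  next
    case False
    define \<omega> where "\<omega> = inverse (norm \<xi>) *\<^sub>R \<xi>"
    have pos: "0 < norm \<xi>" "0 \<le> t" and "norm \<omega> = 1"
      using ZhypD[OF Z N] by (auto simp: \<omega>_def)
    have "(t, \<omega>) \<in> Zhyp N"
      using False \<open>norm \<omega> = 1\<close> pos by (simp add: Zhyp_def T_def)
    note eig = eigenvalue_real_iff[OF this]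
    have dir: "is_eigenvalue (A1 t \<omega>) (complex_of_real (lam k t \<xi> / norm \<xi>))" for k
      unfolding \<omega>_def by (rule eigenvalue_direction[OF Z])
    obtain k where k: "lam i t \<xi> / norm \<xi> = lam k t \<omega>"
      using eig[THEN iffD1, OF dir] by blast
    obtain l where l: "lam j t \<xi> / norm \<xi> = lam l t \<omega>"
      using eig[THEN iffD1, OF dir] by blast
    have "lam i t \<xi> \<noteq> lam j t \<xi>"
      using injD[OF inj_lam[OF Z], of i j] assms by blast
    then have "lam i t \<xi> / norm \<xi> \<noteq> lam j t \<xi> / norm \<xi>"
      using pos by simp
    then have "k \<noteq> l"
      using k l by metis
    then have "\<delta>1 \<le> \<bar>lam i t \<xi> / norm \<xi> - lam j t \<xi> / norm \<xi>\<bar>"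
      unfolding k l using False by (intro order_trans[OF \<delta>1(2) T0] \<open>norm \<omega> = 1\<close>) (auto simp: T_def)
    then have "\<delta>1 * norm \<xi> \<le> \<bar>lam i t \<xi> - lam j t \<xi>\<bar>"
      using pos by (simp add: pos_le_divide_eq flip: diff_divide_distrib)
    moreover have "min \<delta>1 \<delta>2 * norm \<xi> \<le> \<delta>1 * norm \<xi>"
      by (intro mult_right_mono) auto
    ultimately show ?thesis
      by linarith
  qed
  then show ?thesis
    using \<delta>1(1) \<delta>2(1) by (intro exI[of _ "min \<delta>1 \<delta>2"]) auto
qed

lemma inverse_gap_symb:
  assumes "i \<noteq> j"
  shows "symb N K (- 1) 0 (\<lambda>t \<xi>. inverse (lam i t \<xi> - lam j t \<xi>))"
proof -
  obtain \<delta> where \<delta>: "0 < \<delta>" "\<And>t \<xi>. (t, \<xi>) \<in> Zhyp N \<Longrightarrow> \<delta> * norm \<xi> \<le> \<bar>lam i t \<xi> - lam j t \<xi>\<bar>"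
    using gap_pair[OF assms] by blast
  show ?thesis
    by (rule symb_inverse[OF N \<delta>(1)]) (use \<delta>(2) in \<open>auto intro: symb_diff N lam_symb\<close>)
qed

end

section \<open>Construction of the diagonaliser\<close>

text \<open>Product rules deliver exponents as unevaluated sums; this adjusts them
  afterwards.\<close>

lemma symb_exponents: "symb N K m p f \<Longrightarrow> m = m' \<Longrightarrow> p = p' \<Longrightarrow> symb N K m' p' f"
  by simp

lemma norm_matrix_vector:
  "\<exists>L>0. \<forall>(A :: complex^'m^'m) x. norm (A *v x) \<le> norm A * norm x * L"
  by (rule bounded_bilinear.pos_bounded[OF bounded_bilinear_matrix_vector])

context hyperbolic_principal
begin

lemma A1_symb: "symb N K 1 0 A1"
proof -
  have 1: "symb N K (0 + 1) 0 (\<lambda>t \<xi>. A t \<xi> - A1 t \<xi>)"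
    by (rule symb_weaken[OF N]) (use diff_symb in simp)
  have "symb N K 1 0 (\<lambda>t \<xi>. A t \<xi> - (A t \<xi> - A1 t \<xi>))"
    by (rule symb_diff[OF N A_symb symb_exponents[OF 1]]) simp_all
  then show ?thesis
    by (rule symb_cong) simp
qed

lemma lagrange_symb:
  "i \<notin> set js \<Longrightarrow> symb N K 0 0 (\<lambda>t \<xi>. lagrange (A1 t \<xi>) (\<lambda>j. lam j t \<xi>) i js)"
proof (induction js)
  case (Cons j js)
  have 1: "symb N K (1 + 0) (0 + 0) (\<lambda>t \<xi>. lam j t \<xi> *\<^sub>R (mat 1 :: ((complex, 'm) vec, 'm) vec))"
    by (intro symb_scaleR N lam_symb symb_const)
  have 2: "symb N K 1 0 (\<lambda>t \<xi>. A1 t \<xi> - lam j t \<xi> *\<^sub>R (mat 1 :: ((complex, 'm) vec, 'm) vec))"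
    by (intro symb_diff N A1_symb symb_exponents[OF 1]) simp_all
  have "symb N K (- 1 + 1 + 0) (0 + 0 + 0) (\<lambda>t \<xi>. (inverse (lam i t \<xi> - lam j t \<xi>) *\<^sub>R
      (A1 t \<xi> - lam j t \<xi> *\<^sub>R mat 1)) ** lagrange (A1 t \<xi>) (\<lambda>j. lam j t \<xi>) i js)"
    using Cons by (intro symb_bilinear[OF bounded_bilinear_matrix_mult N] symb_scaleR[OF N] 2 inverse_gap_symb) auto
  then show ?case
    unfolding lagrange.simps by (rule symb_exponents) simp_all
qed (simp add: symb_const N)

definition P :: "'m \<Rightarrow> real \<Rightarrow> real^'n \<Rightarrow> ((complex, 'm) vec, 'm) vec" where
  "P i t \<xi> = eigproj (A1 t \<xi>) (\<lambda>j. lam j t \<xi>) i"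

text \<open>\<open>P\<close> is in general an oblique projection; \<open>J\<close> is the orthogonal
  one onto the same eigenline.\<close>

definition J :: "'m \<Rightarrow> real \<Rightarrow> real^'n \<Rightarrow> ((complex, 'm) vec, 'm) vec" where
  "J i t \<xi> = orth (P i t \<xi>)"

lemma P_symb: "symb N K 0 0 (P i)"
  unfolding P_def eigproj_def by (rule lagrange_symb) simp

lemma P_sum: "(t, \<xi>) \<in> Zhyp N \<Longrightarrow> (\<Sum>i\<in>UNIV. P i t \<xi>) = mat 1"
  unfolding P_def
  by (rule eigen_decomposition[OF inj_lam eigenvalue_lam]) auto

lemma P_J_eigenvector:
  assumes "(t, \<xi>) \<in> Zhyp N"
  obtains u where "norm u = 1" "A1 t \<xi> *v u = lam i t \<xi> *\<^sub>R u" "P i t \<xi> *v u = u"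
    "J i t \<xi> = outer u (vcnj u)" "J i t \<xi> ** P i t \<xi> = P i t \<xi>"
proof (rule eigen_decomposition[OF inj_lam[OF assms] eigenvalue_lam[OF assms]])
  fix U W
  assume UW: "\<And>i. norm (column i U) = 1" "\<And>i. A1 t \<xi> *v column i U = lam i t \<xi> *\<^sub>R column i U"
    "\<And>i. eigproj (A1 t \<xi>) (\<lambda>i. lam i t \<xi>) i = outer (column i U) (row i W)"
    "\<And>i. row i W \<noteq> 0"
  have P: "P i t \<xi> = outer (column i U) (row i W)"
    unfolding P_def by (rule UW)
  have J: "J i t \<xi> = outer (column i U) (vcnj (column i U))"
    unfolding J_def P by (rule orth_outer[OF UW(1,4)])
  have "P i t \<xi> *v column i U = column i U"
    unfolding P_def using eigproj_eigenvector[OF inj_lam[OF assms] UW(2)] by simp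
  moreover have "J i t \<xi> ** P i t \<xi> = P i t \<xi>"
    unfolding J P by (rule outer_vcnj(1)[OF UW(1)])
  ultimately show thesis
    by (intro that[OF UW(1) UW(2) _ J])
qed

text \<open>The denominator in \<open>orth\<close> is elliptic of order zero: \<open>P\<close> fixes
  a unit vector, so its norm is at least 1/L.\<close>

lemma J_symb: "symb N K 0 0 (J i)"
proof -
  obtain L where L: "0 < L" "\<And>(A :: ((complex, 'm) vec, 'm) vec) x. norm (A *v x) \<le> norm A * norm x * L"
    using norm_matrix_vector[where 'm = 'm] by blast
  have "inverse (L\<^sup>2) * norm \<xi> powr 0 \<le> \<bar>P i t \<xi> \<bullet> P i t \<xi>\<bar>" if Z: "(t, \<xi>) \<in> Zhyp N" for t \<xi>
  proof -
    obtain u where u: "norm u = 1" "P i t \<xi> *v u = u"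
      by (rule P_J_eigenvector[OF Z, of i]) blast
    then have "1 \<le> norm (P i t \<xi>) * L"
      using L(2)[of "P i t \<xi>" u] by simp
    then have "inverse L \<le> norm (P i t \<xi>)"
      using L(1) by (simp add: inverse_eq_divide pos_divide_le_eq)
    then have "(inverse L)\<^sup>2 \<le> (norm (P i t \<xi>))\<^sup>2"
      using L(1) by (intro power_mono) auto
    then show ?thesis
      using ZhypD[OF Z N] by (simp add: power_inverse power2_norm_eq_inner)
  qed
  note lb = this
  have "symb N K (0 + 0) (0 + 0) (\<lambda>t \<xi>. P i t \<xi> \<bullet> P i t \<xi>)"
    by (intro symb_bilinear[OF bounded_bilinear_inner N] P_symb)
  then have PP: "symb N K 0 0 (\<lambda>t \<xi>. P i t \<xi> \<bullet> P i t \<xi>)"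
    by (rule symb_exponents) simp_all
  have "0 < inverse (L\<^sup>2)"
    using L(1) by simp
  then have "symb N K (- 0) 0 (\<lambda>t \<xi>. inverse (P i t \<xi> \<bullet> P i t \<xi>))"
    by (rule symb_inverse[OF N _ lb PP])
  then have "symb N K (- 0 + (0 + 0)) (0 + (0 + 0)) (\<lambda>t \<xi>. inverse (P i t \<xi> \<bullet> P i t \<xi>) *\<^sub>R (P i t \<xi> ** cmat_adj (P i t \<xi>)))"
    by (intro symb_scaleR[OF N] symb_bilinear[OF bounded_bilinear_matrix_mult N] P_symb symb_linear[OF bounded_linear_cmat_adj N])
  then show ?thesis
    unfolding J_def orth_def by (rule symb_exponents) simp_all
qed

section \<open>Derivatives of the eigenprojections and transport along them\<close>

definition J' :: "'m \<Rightarrow> real \<Rightarrow> real^'n \<Rightarrow> ((complex, 'm) vec, 'm) vec" where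
  "J' i t \<xi> = vector_derivative (\<lambda>s. J i s \<xi>) (at t within slice N \<xi>)"

lemma J'_symb: "symb N K 0 1 (J' i)"
  using symb_vector_derivative(1)[OF J_symb N, of K i] unfolding J'_def[abs_def] by simp

lemma J_deriv:
  "(t, \<xi>) \<in> Zhyp N \<Longrightarrow> ((\<lambda>s. J i s \<xi>) has_vector_derivative J' i t \<xi>) (at t within slice N \<xi>)"
  using symb_vector_derivative(2)[OF J_symb N] unfolding J'_def .

lemma J_idem: "(t, \<xi>) \<in> Zhyp N \<Longrightarrow> J i t \<xi> ** J i t \<xi> = J i t \<xi>"
proof -
  assume Z: "(t, \<xi>) \<in> Zhyp N"
  obtain u where "norm u = 1" "J i t \<xi> = outer u (vcnj u)"
    by (rule P_J_eigenvector[OF Z, of i]) blast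
  then show ?thesis
    using outer_vcnj(1)[of u] by simp
qed

lemma J_adj: "(t, \<xi>) \<in> Zhyp N \<Longrightarrow> cmat_adj (J i t \<xi>) = J i t \<xi>"
proof -
  assume Z: "(t, \<xi>) \<in> Zhyp N"
  obtain u where "norm u = 1" "J i t \<xi> = outer u (vcnj u)"
    by (rule P_J_eigenvector[OF Z, of i]) blast
  then show ?thesis
    using outer_vcnj(3)[of u] by simp
qed

text \<open>Differentiate J J = J and multiply by J from the left: the derivative of a projection
  has no component from its range back into its range.\<close>

lemma J_J'_J:
  assumes Z: "(t, \<xi>) \<in> Zhyp N"
  shows "J i t \<xi> ** J' i t \<xi> ** J i t \<xi> = 0"
proof -
  have "((\<lambda>s. J i s \<xi> ** J i s \<xi>) has_vector_derivative J i t \<xi> ** J' i t \<xi> + J' i t \<xi> ** J i t \<xi>) (at t within slice N \<xi>)"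
    by (intro bounded_bilinear.has_vector_derivative[OF bounded_bilinear_matrix_mult] J_deriv Z)
  then have "((\<lambda>s. J i s \<xi>) has_vector_derivative J i t \<xi> ** J' i t \<xi> + J' i t \<xi> ** J i t \<xi>) (at t within slice N \<xi>)"
    by (rule has_vector_derivative_transform[rotated 2]) (use Z J_idem in auto)
  then have "J i t \<xi> ** J' i t \<xi> + J' i t \<xi> ** J i t \<xi> = J' i t \<xi>"
    by (rule vector_derivative_unique_within[OF at_within_slice_neq_bot[OF Z N] _ J_deriv[OF Z]])
  then have "J i t \<xi> ** (J i t \<xi> ** J' i t \<xi> + J' i t \<xi> ** J i t \<xi>) = J i t \<xi> ** J' i t \<xi>"
    by simp
  then show ?thesis
    by (simp add: matrix_add_ldistrib matrix_mul_assoc J_idem[OF Z])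
qed

lemma symb_continuous_slice:
  fixes f :: "real \<Rightarrow> real^'z \<Rightarrow> 'b::real_normed_vector"
  assumes "\<And>K. symb M K m p f"
  shows "continuous_on (slice M \<xi>) (\<lambda>t. f t \<xi>)"
  unfolding continuous_on_eq_continuous_within
  using symb_SucE[OF assms[of 1, unfolded One_nat_def]] has_vector_derivative_continuous by (metis mem_Collect_eq)

text \<open>Parallel transport along the eigenline bundle for the connection induced by the Hermitian
  metric: unlike the transport by the (oblique) spectral projections it preserves the length.\<close>
lemma unit_frame_slice:
  assumes "\<xi> \<noteq> 0"
  shows "\<exists>v. \<forall>t. (t, \<xi>) \<in> Zhyp N \<longrightarrow>
    (v has_vector_derivative J' i t \<xi> *v v t) (at t within slice N \<xi>) \<and> J i t \<xi> *v v t = v t \<and> norm (v t) = 1"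
proof -
  define a where "a = max 0 (N / norm \<xi> - 1)"
  have slice: "slice N \<xi> = {a..}"
    unfolding a_def by (rule slice_eq[OF N assms])
  then have Z: "(t, \<xi>) \<in> Zhyp N" if "a \<le> t" for t
    using that by auto
  obtain u where u: "norm u = 1" "J i a \<xi> = outer u (vcnj u)"
    by (rule P_J_eigenvector[OF Z[OF order_refl], of i]) blast
  obtain v where v: "v a = u" "\<And>t. a \<le> t \<Longrightarrow> (v has_vector_derivative J' i t \<xi> *v v t) (at t within {a..})"
    using linear_ode_exists[OF bounded_bilinear_matrix_vector, of a "\<lambda>t. J' i t \<xi>" u]
      symb_continuous_slice[OF J'_symb, of \<xi> i] unfolding slice by blast
  have JJ'J: "J i t \<xi> *v (J' i t \<xi> *v (J i t \<xi> *v x)) = 0" if "a \<le> t" for t x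
    using J_J'_J[OF Z[OF that], of i] by (simp add: matrix_vector_mul_assoc matrix_mul_assoc)
  \<comment> \<open>The defect of v from the eigenline solves a homogeneous linear equation of its
    own and vanishes at a, hence everywhere.\<close>
  define z where "z t = v t - J i t \<xi> *v v t" for t
  have z: "(z has_vector_derivative - (J i t \<xi> *v (J' i t \<xi> *v z t))) (at t within {a..})" if "a \<le> t" for t
  proof -
    have "(z has_vector_derivative J' i t \<xi> *v v t - (J i t \<xi> *v (J' i t \<xi> *v v t) + J' i t \<xi> *v v t)) (at t within {a..})"
      unfolding z_def
      by (intro has_vector_derivative_diff bounded_bilinear.has_vector_derivative[OF bounded_bilinear_matrix_vector]
          v that J_deriv[OF Z[OF that], unfolded slice])
    moreover have "J i t \<xi> *v (J' i t \<xi> *v z t) = J i t \<xi> *v (J' i t \<xi> *v v t)"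
      by (simp add: z_def matrix_mult_vec_distribs JJ'J[OF that])
    ultimately show ?thesis
      by simp
  qed
  have "z T = 0" if "a \<le> T" for T
  proof -
    have "{a..T} \<subseteq> slice N \<xi>"
      unfolding slice by auto
    then have "continuous_on {a..T} (\<lambda>t. J i t \<xi>)" "continuous_on {a..T} (\<lambda>t. J' i t \<xi>)"
      by (rule continuous_on_subset[OF symb_continuous_slice[OF J_symb]],
          rule continuous_on_subset[OF symb_continuous_slice[OF J'_symb]])
    then have "continuous_on {a..T} (\<lambda>t. J i t \<xi> ** J' i t \<xi>)"
      by (rule bounded_bilinear.continuous_on[OF bounded_bilinear_matrix_mult])
    then have "bounded ((\<lambda>t. J i t \<xi> ** J' i t \<xi>) ` {a..T})"
      by (intro compact_imp_bounded compact_continuous_image) auto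
    then obtain c where c: "\<forall>t\<in>{a..T}. norm (J i t \<xi> ** J' i t \<xi>) \<le> c"
      unfolding bounded_iff ball_simps by blast
    obtain L where L: "0 < L" "\<And>(A :: ((complex, 'm) vec, 'm) vec) x. norm (A *v x) \<le> norm A * norm x * L"
      using norm_matrix_vector[where 'm = 'm] by blast
    have "norm (z T) \<le> norm (z a) * exp (c * L * T - c * L * a)"
    proof (rule gronwall(1)[OF that])
      fix t assume t: "t \<in> {a..T}"
      show "(z has_vector_derivative - (J i t \<xi> *v (J' i t \<xi> *v z t))) (at t within {a..T})"
        by (rule has_vector_derivative_within_subset[OF z]) (use t in auto)
      show "((\<lambda>t. c * L * t) has_real_derivative c * L) (at t within {a..T})"
        by (auto intro!: derivative_eq_intros)
      have "\<bar>z t \<bullet> - (J i t \<xi> *v (J' i t \<xi> *v z t))\<bar> \<le> norm (z t) * norm ((J i t \<xi> ** J' i t \<xi>) *v z t)"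
        using Cauchy_Schwarz_ineq2[of "z t" "(J i t \<xi> ** J' i t \<xi>) *v z t"] by (simp add: matrix_vector_mul_assoc)
      also have "\<dots> \<le> norm (z t) * (c * norm (z t) * L)"
        using L c t by (intro mult_left_mono order_trans[OF L(2)] mult_right_mono) auto
      finally show "\<bar>z t \<bullet> - (J i t \<xi> *v (J' i t \<xi> *v z t))\<bar> \<le> c * L * (norm (z t))\<^sup>2"
        by (simp add: power2_eq_square mult_ac)
    qed
    moreover have "z a = 0"
      using v(1) u by (simp add: z_def outer_vcnj(2))
    ultimately show ?thesis
      by simp
  qed
  then have Jv: "J i t \<xi> *v v t = v t" if "a \<le> t" for t
    using that by (simp add: z_def)
  have "norm (v T) = 1" if "a \<le> T" for T
  proof -
    \<comment> \<open>With v = J v and J self-adjoint, this product equals that of v with J J' J v,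
      which is zero; the length is therefore constant.\<close>
    have "v t \<bullet> (J' i t \<xi> *v v t) = 0" if "a \<le> t" for t
    proof -
      have "v t \<bullet> (J' i t \<xi> *v v t) = (cmat_adj (J i t \<xi>) *v v t) \<bullet> (J' i t \<xi> *v (J i t \<xi> *v v t))"
        by (simp add: J_adj[OF Z[OF that]] Jv[OF that])
      also have "\<dots> = v t \<bullet> (J i t \<xi> *v (J' i t \<xi> *v (J i t \<xi> *v v t)))"
        by (rule inner_cmat_adj[symmetric])
      finally show ?thesis
        by (simp add: JJ'J[OF that])
    qed
    then have "norm (v T) \<le> norm (v a) * exp (0 - 0)" "norm (v a) \<le> norm (v T) * exp (0 - 0)"
      using that
      by (intro gronwall[where v' = "\<lambda>t. J' i t \<xi> *v v t" and H = "\<lambda>_. 0" and h = "\<lambda>_. 0"]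
          has_vector_derivative_within_subset[OF v(2)]; auto)+
    then show ?thesis
      using v(1) u(1) by simp
  qed
  then show ?thesis
    using v(2) Jv unfolding slice by (intro exI[of _ v]) (use slice in auto)
qed

lemma diagonaliser_exists:
  "\<exists>M Minv. (\<forall>(t, \<xi>) \<in> Zhyp N. M t \<xi> ** Minv t \<xi> = mat 1 \<and> Minv t \<xi> ** M t \<xi> = mat 1 \<and>
      A1 t \<xi> ** M t \<xi> = M t \<xi> ** diag_mat (\<lambda>i. complex_of_real (lam i t \<xi>))) \<and>
    (\<forall>K. symb N K 0 0 M) \<and> (\<forall>K. symb N K 0 0 Minv)"
proof -
  \<comment> \<open>The frame is chosen separately for each index and each \<xi>; uniformity in
    \<xi> comes afterwards from |v| = 1 and the estimates for \<open>J'\<close>.\<close>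
  have "\<exists>v. \<forall>i \<xi>. \<xi> \<noteq> 0 \<longrightarrow> (\<forall>t. (t, \<xi>) \<in> Zhyp N \<longrightarrow>
    (v i \<xi> has_vector_derivative J' i t \<xi> *v v i \<xi> t) (at t within slice N \<xi>) \<and> J i t \<xi> *v v i \<xi> t = v i \<xi> t \<and> norm (v i \<xi> t) = 1)"
    by (intro choice allI) (use unit_frame_slice in blast)
  then obtain w where w: "\<And>i t \<xi>. (t, \<xi>) \<in> Zhyp N \<Longrightarrow> (w i \<xi> has_vector_derivative J' i t \<xi> *v w i \<xi> t) (at t within slice N \<xi>)"
    "\<And>i t \<xi>. (t, \<xi>) \<in> Zhyp N \<Longrightarrow> J i t \<xi> *v w i \<xi> t = w i \<xi> t" "\<And>i t \<xi>. (t, \<xi>) \<in> Zhyp N \<Longrightarrow> norm (w i \<xi> t) = 1"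
    using ZhypD(4)[OF _ N] by blast
  define v where "v i t \<xi> = w i \<xi> t" for i t \<xi>
  have v_symb: "symb N K 0 0 (v i)" for K i
  proof (rule symb_ode[OF bounded_bilinear_matrix_vector N J'_symb])
    show "symb N 0 0 0 (v i)"
      by (rule symb_0I[where C = 1]) (use w(3) ZhypD(1,4)[OF _ N] in \<open>fastforce simp: v_def\<close>)
    show "((\<lambda>s. v i s \<xi>) has_vector_derivative J' i t \<xi> *v v i t \<xi>) (at t within slice N \<xi>)"
      if "(t, \<xi>) \<in> Zhyp N" for t \<xi>
      using w(1)[OF that, of i] unfolding v_def .
  qed
  define M :: "real \<Rightarrow> real^'n \<Rightarrow> ((complex, 'm) vec, 'm) vec" where "M t \<xi> = (\<chi> r c. v c t \<xi> $ r)" for t \<xi>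
  \<comment> \<open>Row r is the conjugate transpose of v_r times P_r. Then M Minv is the sum of J_i
    P_i = P_i, hence the identity, and the explicit formula gives symbol estimates without inverting
    M.\<close>
  define Minv :: "real \<Rightarrow> real^'n \<Rightarrow> ((complex, 'm) vec, 'm) vec"
    where "Minv t \<xi> = (\<chi> r c. \<Sum>l\<in>UNIV. cnj (v r t \<xi> $ l) * P r t \<xi> $ l $ c)" for t \<xi>
  have "symb N K 0 0 M" for K
    unfolding M_def by (intro symb_vec[OF N]) (simp add: symb_nth[OF N v_symb])
  moreover have "symb N K 0 0 Minv" for K
  proof -
    have "symb N K (0 + 0) (0 + 0) (\<lambda>t \<xi>. cnj (v r t \<xi> $ l) * P r t \<xi> $ l $ c)" for r l c
      by (intro symb_bilinear[OF bounded_bilinear_mult N] symb_linear[OF bounded_linear_cnj N] symb_nth[OF N] v_symb P_symb)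
    then show ?thesis
      unfolding Minv_def by (intro symb_vec[OF N]) (simp add: symb_sum)
  qed
  moreover have "M t \<xi> ** Minv t \<xi> = mat 1 \<and> Minv t \<xi> ** M t \<xi> = mat 1 \<and>
      A1 t \<xi> ** M t \<xi> = M t \<xi> ** diag_mat (\<lambda>i. complex_of_real (lam i t \<xi>))" if Z: "(t, \<xi>) \<in> Zhyp N" for t \<xi>
  proof -
    have Jv: "J i t \<xi> *v v i t \<xi> = v i t \<xi>" "norm (v i t \<xi>) = 1" for i
      using w(2,3)[OF Z] by (auto simp: v_def)
    have JP: "J i t \<xi> ** P i t \<xi> = P i t \<xi>" "outer (v i t \<xi>) (vcnj (v i t \<xi>)) = J i t \<xi>"
      "A1 t \<xi> *v v i t \<xi> = lam i t \<xi> *\<^sub>R v i t \<xi>" for i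
    proof -
      obtain u where u: "norm u = 1" "A1 t \<xi> *v u = lam i t \<xi> *\<^sub>R u" "J i t \<xi> = outer u (vcnj u)"
        "J i t \<xi> ** P i t \<xi> = P i t \<xi>"
        by (rule P_J_eigenvector[OF Z, of i]) blast
      show "J i t \<xi> ** P i t \<xi> = P i t \<xi>"
        by fact
      show "outer (v i t \<xi>) (vcnj (v i t \<xi>)) = J i t \<xi>"
        using outer_vcnj(4)[OF u(1), of "v i t \<xi>"] Jv[of i] u(3) by simp
      obtain c where c: "v i t \<xi> = c *s u"
        using Jv(1)[of i] unfolding u(3) outer_mult_vec by metis
      show "A1 t \<xi> *v v i t \<xi> = lam i t \<xi> *\<^sub>R v i t \<xi>"
        unfolding c vec.scale u(2) of_real_smult[symmetric] by (simp add: mult.commute)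
    qed
    have "M t \<xi> ** Minv t \<xi> = (\<Sum>i\<in>UNIV. outer (v i t \<xi>) (vcnj (v i t \<xi>)) ** P i t \<xi>)"
      by (simp add: vec_eq_iff M_def Minv_def matrix_matrix_mult_def outer_def vcnj_def sum_distrib_left mult.assoc)
    also have "\<dots> = mat 1"
      by (simp add: JP P_sum[OF Z])
    finally have inv: "M t \<xi> ** Minv t \<xi> = mat 1" .
    have "(A1 t \<xi> ** M t \<xi>) $ r $ c = (M t \<xi> ** diag_mat (\<lambda>i. complex_of_real (lam i t \<xi>))) $ r $ c" for r c
    proof -
      have "(A1 t \<xi> ** M t \<xi>) $ r $ c = (A1 t \<xi> *v v c t \<xi>) $ r"
        by (simp add: M_def matrix_matrix_mult_def matrix_vector_mult_def)
      also have "\<dots> = complex_of_real (lam c t \<xi>) * v c t \<xi> $ r"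
        by (simp add: JP scaleR_conv_of_real[where 'a = complex])
      also have "\<dots> = (M t \<xi> ** diag_mat (\<lambda>i. complex_of_real (lam i t \<xi>))) $ r $ c"
        by (simp add: M_def matrix_matrix_mult_def diag_mat_def if_distrib[of "\<lambda>x. _ * x"] cong: if_cong)
      finally show ?thesis .
    qed
    then have "A1 t \<xi> ** M t \<xi> = M t \<xi> ** diag_mat (\<lambda>i. complex_of_real (lam i t \<xi>))"
      by (simp add: vec_eq_iff)
    then show ?thesis
      using inv matrix_left_right_inverse[of "M t \<xi>" "Minv t \<xi>"] by simp
  qed
  ultimately show ?thesis
    by (intro exI[of _ M] exI[of _ Minv]) auto
qed

end

section \<open>Normal form of the system\<close>

text \<open>Scaling by the imaginary unit as a matrix product: the scalar action of the normed
  structure is real, and in this form the bilinear calculus applies.\<close>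

definition imat :: "complex^'m^'m" where
  "imat = mat \<i>"

lemma imat_nth: "(imat ** B) $ r $ c = \<i> * B $ r $ c"
  by (simp add: imat_def matrix_matrix_mult_def mat_def if_distrib[of "\<lambda>x. x * _"] cong: if_cong)

lemma imat_commute: "B ** imat = imat ** B"
proof -
  have "(B ** imat) $ r $ c = (imat ** B) $ r $ c" for r c
    unfolding imat_nth by (simp add: imat_def matrix_matrix_mult_def mat_def if_distrib[of "\<lambda>x. _ * x"] cong: if_cong)
  then show ?thesis
    by (simp add: vec_eq_iff)
qed

lemma imat_vec_nth: "(imat *v x) $ r = \<i> * x $ r"
  by (simp add: imat_def matrix_vector_mult_def mat_def if_distrib[of "\<lambda>x. x * _"] cong: if_cong)

text \<open>Written as a sum over fixed matrices with real coefficients, so that integration reduces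
  to scalar integrals.\<close>

lemma cmat_Im_diag_part:
  "cmat_Im (diag_part B) = (\<Sum>j\<in>UNIV. Im (B $ j $ j) *\<^sub>R diag_mat (\<lambda>i. if i = j then 1 else 0))"
proof -
  have "(z - cnj z) / (2 * \<i>) = complex_of_real (Im z)" for z
    by (simp add: complex_eq_iff Re_divide Im_divide)
  then have "cmat_Im (diag_part B) $ r $ c = (if r = c then complex_of_real (Im (B $ r $ r)) else 0)" for r c
    by (simp add: cmat_Im_def diag_part_def cmat_adj_def)
  then show ?thesis
    by (simp add: vec_eq_iff diag_mat_def if_distrib[of "\<lambda>x. _ * x"] scaleR_conv_of_real[where 'a = complex] cong: if_cong)
qed

text \<open>The diagonaliser is arbitrary: one implication takes it from (A3), the other from
  \<open>diagonaliser_exists\<close>.\<close>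

locale diagonalised = hyperbolic_principal N A A1 lam
  for N :: real and A A1 :: "real \<Rightarrow> real^'n \<Rightarrow> complex^'m::{finite,linorder}^'m::{finite,linorder}"
    and lam :: "'m::{finite,linorder} \<Rightarrow> real \<Rightarrow> real^'n \<Rightarrow> real" +
  fixes M Minv :: "real \<Rightarrow> real^'n \<Rightarrow> complex^'m::{finite,linorder}^'m::{finite,linorder}"
  assumes M_Minv: "(t, \<xi>) \<in> Zhyp N \<Longrightarrow> M t \<xi> ** Minv t \<xi> = mat 1"
    and Minv_M: "(t, \<xi>) \<in> Zhyp N \<Longrightarrow> Minv t \<xi> ** M t \<xi> = mat 1"
    and A1_M: "(t, \<xi>) \<in> Zhyp N \<Longrightarrow> A1 t \<xi> ** M t \<xi> = M t \<xi> ** diag_mat (\<lambda>i. complex_of_real (lam i t \<xi>))"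
    and M_symb: "symb N K 0 0 M" and Minv_symb: "symb N K 0 0 Minv"
begin

definition Lam :: "real \<Rightarrow> real^'n \<Rightarrow> ((complex, 'm) vec, 'm) vec" where
  "Lam t \<xi> = diag_mat (\<lambda>i. complex_of_real (lam i t \<xi>))"

definition M' :: "real \<Rightarrow> real^'n \<Rightarrow> ((complex, 'm) vec, 'm) vec" where
  "M' = tD (Zhyp N) M 1"

definition R :: "real \<Rightarrow> real^'n \<Rightarrow> ((complex, 'm) vec, 'm) vec" where
  "R t \<xi> = Minv t \<xi> ** (A t \<xi> - A1 t \<xi>) ** M t \<xi> - Minv t \<xi> ** DtM (Zhyp N) M t \<xi>"

abbreviation F :: "real \<Rightarrow> real^'n \<Rightarrow> ((complex, 'm) vec, 'm) vec" where
  "F \<equiv> F0 N A A1 M Minv"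

text \<open>Off the diagonal, \<open>\<Lambda> N1 - N1 \<Lambda> = -R\<close>; the diagonal vanishes because \<open>inverse 0 = 0\<close>.\<close>
definition N1 :: "real \<Rightarrow> real^'n \<Rightarrow> ((complex, 'm) vec, 'm) vec" where
  "N1 t \<xi> = (\<chi> j k. inverse (lam k t \<xi> - lam j t \<xi>) *\<^sub>R R t \<xi> $ j $ k)"

definition N1' :: "real \<Rightarrow> real^'n \<Rightarrow> ((complex, 'm) vec, 'm) vec" where
  "N1' t \<xi> = vector_derivative (\<lambda>s. N1 s \<xi>) (at t within slice N \<xi>)"

text \<open>What is left after the commutator of \<open>Lam\<close> and \<open>N1\<close> has
  cancelled the off-diagonal part of \<open>R\<close>. Every term gains one power of 1/|\<xi>| and
  has decay of order two in t.\<close>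

definition G :: "real \<Rightarrow> real^'n \<Rightarrow> ((complex, 'm) vec, 'm) vec" where
  "G t \<xi> = imat ** (F t \<xi> ** N1 t \<xi> - N1 t \<xi> ** R t \<xi>) - N1' t \<xi>"

lemma F_eq: "F t \<xi> = diag_part (R t \<xi>)"
  by (simp add: F0_def R_def)

lemma imat_DtM: "imat ** DtM (Zhyp N) M t \<xi> = M' t \<xi>"
  by (simp add: vec_eq_iff imat_nth DtM_def M'_def)

lemma M'_symb: "symb N K 0 1 M'"
  using symb_tD[OF M_symb N, of K 1] unfolding M'_def by simp

lemma M_deriv: "(t, \<xi>) \<in> Zhyp N \<Longrightarrow> ((\<lambda>s. M s \<xi>) has_vector_derivative M' t \<xi>) (at t within slice N \<xi>)"
  using symb_vector_derivative(2)[OF M_symb N] by (simp add: M'_def tD_Suc tD_0 One_nat_def)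

lemmas symb_mult = symb_bilinear[OF bounded_bilinear_matrix_mult N]

lemma symb_imat:
  "symb N K m p f \<Longrightarrow> symb N K m p (\<lambda>t \<xi>. imat ** f t \<xi>)" for f :: "real \<Rightarrow> real^'n \<Rightarrow> ((complex, 'm) vec, 'm) vec"
  by (rule symb_linear[OF bounded_bilinear.bounded_linear_right[OF bounded_bilinear_matrix_mult] N])

lemma R_symb: "symb N K 0 1 R"
proof -
  have 1: "symb N K (0 + 0 + 0) (0 + 1 + 0) (\<lambda>t \<xi>. Minv t \<xi> ** (A t \<xi> - A1 t \<xi>) ** M t \<xi>)"
    by (intro symb_mult M_symb Minv_symb diff_symb)
  have "symb N K 0 1 (\<lambda>t \<xi>. - (imat ** M' t \<xi>))"
    by (intro symb_linear[OF bounded_linear_minus[OF bounded_linear_ident] N] symb_imat M'_symb)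
  moreover have "- (imat ** M' t \<xi>) = DtM (Zhyp N) M t \<xi>" for t \<xi>
    by (simp add: vec_eq_iff imat_nth DtM_def M'_def)
  ultimately have "symb N K 0 1 (DtM (Zhyp N) M)"
    by simp
  then have 2: "symb N K (0 + 0) (0 + 1) (\<lambda>t \<xi>. Minv t \<xi> ** DtM (Zhyp N) M t \<xi>)"
    by (intro symb_mult Minv_symb)
  show ?thesis
    unfolding R_def by (rule symb_diff[OF N symb_exponents[OF 1] symb_exponents[OF 2]]) simp_all
qed

lemma F_symb: "symb N K 0 1 F"
  using symb_linear[OF bounded_linear_diag_part N R_symb] by (simp add: F_eq[abs_def])

lemma N1_symb: "symb N K (- 1) 1 N1"
proof -
  have "symb N K (- 1) 1 (\<lambda>t \<xi>. inverse (lam k t \<xi> - lam j t \<xi>) *\<^sub>R R t \<xi> $ j $ k)" for j k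
  proof (cases "k = j")
    case False
    have "symb N K (- 1 + 0) (0 + 1) (\<lambda>t \<xi>. inverse (lam k t \<xi> - lam j t \<xi>) *\<^sub>R R t \<xi> $ j $ k)"
      by (intro symb_scaleR[OF N] inverse_gap_symb symb_nth[OF N] R_symb False)
    then show ?thesis
      by simp
  qed (simp add: symb_zero)
  then show ?thesis
    unfolding N1_def by (intro symb_vec[OF N]) simp
qed

lemma N1_deriv: "(t, \<xi>) \<in> Zhyp N \<Longrightarrow> ((\<lambda>s. N1 s \<xi>) has_vector_derivative N1' t \<xi>) (at t within slice N \<xi>)"
  using symb_vector_derivative(2)[OF N1_symb N] unfolding N1'_def .

lemma G_symb: "symb N K (- 1) 2 G"
proof -
  have 1: "symb N K (- 1) (1 + 1) N1'"
    using symb_vector_derivative(1)[OF N1_symb N, of K] unfolding N1'_def[abs_def] .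
  have 2: "symb N K (0 + - 1) (1 + 1) (\<lambda>t \<xi>. F t \<xi> ** N1 t \<xi>)" "symb N K (- 1 + 0) (1 + 1) (\<lambda>t \<xi>. N1 t \<xi> ** R t \<xi>)"
    by (intro symb_mult F_symb N1_symb R_symb)+
  show ?thesis
    unfolding G_def
    by (intro symb_diff[OF N] symb_imat symb_exponents[OF 1] symb_exponents[OF 2(1)] symb_exponents[OF 2(2)]) simp_all
qed

lemma homological_equation: "Lam t \<xi> ** N1 t \<xi> - N1 t \<xi> ** Lam t \<xi> = F t \<xi> - R t \<xi>" if "(t, \<xi>) \<in> Zhyp N"
proof -
  have 1: "(Lam t \<xi> ** N1 t \<xi>) $ j $ k = complex_of_real (lam j t \<xi>) * N1 t \<xi> $ j $ k"
    and 2: "(N1 t \<xi> ** Lam t \<xi>) $ j $ k = N1 t \<xi> $ j $ k * complex_of_real (lam k t \<xi>)" for j k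
    by (simp_all add: Lam_def diag_mat_def matrix_matrix_mult_def if_distrib[of "\<lambda>x. x * _"]
        if_distrib[of "\<lambda>x. _ * x"] cong: if_cong)
  have "complex_of_real (lam j t \<xi>) * N1 t \<xi> $ j $ k - N1 t \<xi> $ j $ k * complex_of_real (lam k t \<xi>) = - R t \<xi> $ j $ k"
    if "j \<noteq> k" for j k
  proof -
    have "lam k t \<xi> - lam j t \<xi> \<noteq> 0"
      using injD[OF inj_lam[OF \<open>(t, \<xi>) \<in> Zhyp N\<close>], of k j] that by auto
    moreover have "complex_of_real (lam j t \<xi>) * N1 t \<xi> $ j $ k - N1 t \<xi> $ j $ k * complex_of_real (lam k t \<xi>)
        = - (complex_of_real ((lam k t \<xi> - lam j t \<xi>) * inverse (lam k t \<xi> - lam j t \<xi>)) * R t \<xi> $ j $ k)"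
      by (simp add: N1_def scaleR_conv_of_real algebra_simps)
    ultimately show ?thesis
      by simp
  qed
  then have "(Lam t \<xi> ** N1 t \<xi> - N1 t \<xi> ** Lam t \<xi>) $ j $ k = (F t \<xi> - R t \<xi>) $ j $ k" for j k
    by (cases "j = k") (simp_all add: 1 2 F_eq diag_part_def)
  then show ?thesis
    by (simp add: vec_eq_iff)
qed

section \<open>Differential equations of the transformed unknowns\<close>

definition solution :: "real^'n \<Rightarrow> (real \<Rightarrow> (complex, 'm) vec) \<Rightarrow> bool" where
  "solution \<xi> V \<longleftrightarrow> (\<forall>t. (t, \<xi>) \<in> Zhyp N \<longrightarrow>
    (V has_vector_derivative imat *v (A t \<xi> *v V t)) (at t within slice N \<xi>))"

definition diagW :: "real^'n \<Rightarrow> (real \<Rightarrow> (complex, 'm) vec) \<Rightarrow> real \<Rightarrow> (complex, 'm) vec" where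
  "diagW \<xi> V t = Minv t \<xi> *v V t"

definition diagX :: "real^'n \<Rightarrow> (real \<Rightarrow> (complex, 'm) vec) \<Rightarrow> real \<Rightarrow> (complex, 'm) vec" where
  "diagX \<xi> V t = diagW \<xi> V t - N1 t \<xi> *v diagW \<xi> V t"

lemma Minv_deriv:
  assumes Z: "(t, \<xi>) \<in> Zhyp N"
  shows "((\<lambda>s. Minv s \<xi>) has_vector_derivative - (Minv t \<xi> ** M' t \<xi> ** Minv t \<xi>)) (at t within slice N \<xi>)"
proof -
  define D where "D = vector_derivative (\<lambda>s. Minv s \<xi>) (at t within slice N \<xi>)"
  have D: "((\<lambda>s. Minv s \<xi>) has_vector_derivative D) (at t within slice N \<xi>)"
    unfolding D_def by (rule symb_vector_derivative(2)[OF Minv_symb N Z])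
  have "((\<lambda>s. Minv s \<xi> ** M s \<xi>) has_vector_derivative Minv t \<xi> ** M' t \<xi> + D ** M t \<xi>) (at t within slice N \<xi>)"
    by (intro bounded_bilinear.has_vector_derivative[OF bounded_bilinear_matrix_mult] M_deriv Z D)
  then have "((\<lambda>s. mat 1) has_vector_derivative Minv t \<xi> ** M' t \<xi> + D ** M t \<xi>) (at t within slice N \<xi>)"
    by (rule has_vector_derivative_transform[rotated 2]) (use Z Minv_M in auto)
  then have "Minv t \<xi> ** M' t \<xi> + D ** M t \<xi> = 0"
    by (rule vector_derivative_unique_within[OF at_within_slice_neq_bot[OF Z N] _ has_vector_derivative_const])
  then have "D ** M t \<xi> = - (Minv t \<xi> ** M' t \<xi>)"
    by (simp add: eq_neg_iff_add_eq_0 add.commute)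
  then have "D ** M t \<xi> ** Minv t \<xi> = - (Minv t \<xi> ** M' t \<xi>) ** Minv t \<xi>"
    by simp
  then have "D = - (Minv t \<xi> ** M' t \<xi> ** Minv t \<xi>)"
    by (simp add: matrix_mul_assoc[symmetric] M_Minv[OF Z] bounded_bilinear.minus_left[OF bounded_bilinear_matrix_mult])
  then show ?thesis
    using D by simp
qed

lemma diagW_deriv:
  assumes Z: "(t, \<xi>) \<in> Zhyp N" and V: "solution \<xi> V"
  shows "(diagW \<xi> V has_vector_derivative (imat ** (Lam t \<xi> + R t \<xi>)) *v diagW \<xi> V t) (at t within slice N \<xi>)"
proof -
  have V': "(V has_vector_derivative imat *v (A t \<xi> *v V t)) (at t within slice N \<xi>)"
    using V Z unfolding solution_def by blast
  have "(diagW \<xi> V has_vector_derivative Minv t \<xi> *v (imat *v (A t \<xi> *v V t))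
      + (- (Minv t \<xi> ** M' t \<xi> ** Minv t \<xi>)) *v V t) (at t within slice N \<xi>)"
    unfolding diagW_def
    by (intro bounded_bilinear.has_vector_derivative[OF bounded_bilinear_matrix_vector] Minv_deriv V' Z)
  moreover have "V t = M t \<xi> *v diagW \<xi> V t"
    by (simp add: diagW_def matrix_vector_mul_assoc M_Minv[OF Z])
  then have "A t \<xi> *v V t = (A t \<xi> ** M t \<xi>) *v diagW \<xi> V t"
    by (simp add: matrix_vector_mul_assoc)
  then have "Minv t \<xi> *v (imat *v (A t \<xi> *v V t)) = (imat ** (Minv t \<xi> ** A t \<xi> ** M t \<xi>)) *v diagW \<xi> V t"
    by (simp add: matrix_vector_mul_assoc matrix_mul_assoc imat_commute)
  moreover have "(- (Minv t \<xi> ** M' t \<xi> ** Minv t \<xi>)) *v V t = - ((Minv t \<xi> ** M' t \<xi>) *v diagW \<xi> V t)"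
    by (simp add: diagW_def matrix_vector_mul_assoc matrix_mult_vec_distribs)
  moreover have "imat ** (Lam t \<xi> + R t \<xi>) = imat ** (Minv t \<xi> ** A t \<xi> ** M t \<xi>) - Minv t \<xi> ** M' t \<xi>"
  proof -
    have "Minv t \<xi> ** A1 t \<xi> ** M t \<xi> = Lam t \<xi>"
      by (simp add: matrix_mul_assoc[symmetric] A1_M[OF Z] Lam_def) (simp add: matrix_mul_assoc Minv_M[OF Z])
    then have "Lam t \<xi> + R t \<xi> = Minv t \<xi> ** A t \<xi> ** M t \<xi> - Minv t \<xi> ** DtM (Zhyp N) M t \<xi>"
      by (simp add: R_def matrix_mult_vec_distribs)
    moreover have "imat ** (Minv t \<xi> ** DtM (Zhyp N) M t \<xi>) = Minv t \<xi> ** M' t \<xi>"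
      unfolding imat_DtM[symmetric] by (simp add: matrix_mul_assoc imat_commute)
    ultimately show ?thesis
      by (simp add: matrix_mult_vec_distribs)
  qed
  ultimately show ?thesis
    by (simp add: matrix_mult_vec_distribs)
qed

text \<open>The remainder is left acting on \<open>diagW\<close>, so the identity holds on the whole
  zone, also where I - N1 may fail to be invertible.\<close>

lemma diagX_deriv:
  assumes Z: "(t, \<xi>) \<in> Zhyp N" and V: "solution \<xi> V"
  shows "(diagX \<xi> V has_vector_derivative
    (imat ** (Lam t \<xi> + F t \<xi>)) *v diagX \<xi> V t + G t \<xi> *v diagW \<xi> V t) (at t within slice N \<xi>)"
proof -
  let ?W = "diagW \<xi> V t"
  have "(diagX \<xi> V has_vector_derivative (imat ** (Lam t \<xi> + R t \<xi>)) *v ?W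
     - (N1 t \<xi> *v ((imat ** (Lam t \<xi> + R t \<xi>)) *v ?W) + N1' t \<xi> *v ?W)) (at t within slice N \<xi>)"
    unfolding diagX_def
    by (intro has_vector_derivative_diff bounded_bilinear.has_vector_derivative[OF bounded_bilinear_matrix_vector]
        diagW_deriv N1_deriv Z V)
  moreover have "imat ** (Lam t \<xi> + R t \<xi>) - (N1 t \<xi> ** (imat ** (Lam t \<xi> + R t \<xi>)) + N1' t \<xi>)
     = imat ** (Lam t \<xi> + F t \<xi>) - imat ** (Lam t \<xi> + F t \<xi>) ** N1 t \<xi> + G t \<xi>"
  proof -
    have "N1 t \<xi> ** (imat ** (Lam t \<xi> + R t \<xi>)) = imat ** (N1 t \<xi> ** Lam t \<xi> + N1 t \<xi> ** R t \<xi>)"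
      by (simp add: matrix_mul_assoc imat_commute matrix_add_ldistrib)
    moreover have "imat ** (Lam t \<xi> + F t \<xi>) ** N1 t \<xi> = imat ** (Lam t \<xi> ** N1 t \<xi> + F t \<xi> ** N1 t \<xi>)"
      by (simp add: matrix_mul_assoc[symmetric] bounded_bilinear.add_left[OF bounded_bilinear_matrix_mult])
    moreover have "N1 t \<xi> ** Lam t \<xi> = Lam t \<xi> ** N1 t \<xi> - F t \<xi> + R t \<xi>"
      using homological_equation[OF Z] by (simp add: algebra_simps)
    ultimately show ?thesis
      by (simp add: G_def matrix_mult_vec_distribs matrix_add_ldistrib)
  qed
  then have "(imat ** (Lam t \<xi> + R t \<xi>) - (N1 t \<xi> ** (imat ** (Lam t \<xi> + R t \<xi>)) + N1' t \<xi>)) *v ?W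
    = (imat ** (Lam t \<xi> + F t \<xi>) - imat ** (Lam t \<xi> + F t \<xi>) ** N1 t \<xi> + G t \<xi>) *v ?W"
    by simp
  ultimately show ?thesis
    by (simp add: matrix_mult_vec_distribs diagX_def matrix_vector_mul_assoc)
qed

lemma F_nth: "j \<noteq> k \<Longrightarrow> F t \<xi> $ j $ k = 0"
  by (simp add: F_eq diag_part_def)

lemma diagX_nth_deriv:
  assumes Z: "(t, \<xi>) \<in> Zhyp N" and V: "solution \<xi> V"
  shows "((\<lambda>s. diagX \<xi> V s $ j) has_vector_derivative
    \<i> * (complex_of_real (lam j t \<xi>) + F t \<xi> $ j $ j) * diagX \<xi> V t $ j + (G t \<xi> *v diagW \<xi> V t) $ j) (at t within slice N \<xi>)"
proof -
  have LF: "(Lam t \<xi> + F t \<xi>) $ j $ k = (if k = j then complex_of_real (lam j t \<xi>) + F t \<xi> $ j $ j else 0)" for k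
    using F_nth[of j k] by (auto simp: Lam_def diag_mat_def)
  have "((imat ** (Lam t \<xi> + F t \<xi>)) *v diagX \<xi> V t) $ j
      = \<i> * (complex_of_real (lam j t \<xi>) + F t \<xi> $ j $ j) * diagX \<xi> V t $ j"
    unfolding matrix_vector_mult_def vec_lambda_beta imat_nth LF
    by (simp add: if_distrib[of "\<lambda>x. x * _"] if_distrib[of "\<lambda>x. _ * x"] cong: if_cong)
  then show ?thesis
    using bounded_linear.has_vector_derivative[OF bounded_linear_vec_nth diagX_deriv[OF Z V], of j] by simp
qed

end

section \<open>Energy estimates\<close>

lemma norm_le_sum_nth: "norm (x :: 'a::real_normed_vector^'z) \<le> (\<Sum>i\<in>UNIV. norm (x $ i))"
  unfolding norm_vec_def by (rule L2_set_le_sum) simp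

lemma has_vector_derivative_vec_lambda:
  fixes f :: "'z::finite \<Rightarrow> real \<Rightarrow> 'a::real_normed_vector"
  assumes "\<And>j. (f j has_vector_derivative f' j) (at t within S)"
  shows "((\<lambda>t. \<chi> j. f j t) has_vector_derivative (\<chi> j. f' j)) (at t within S)"
proof -
  have eq: "(\<chi> j. g j) = (\<Sum>j\<in>UNIV. axis j (g j))" for g :: "'z \<Rightarrow> 'a"
    using vec_eq_sum_axis[of "\<chi> j. g j"] by simp
  show ?thesis
    unfolding eq
    by (intro has_vector_derivative_sum bounded_linear.has_vector_derivative[OF bounded_linear_axis] assms)
qed

lemma norm_imat_vec: "norm (imat *v x) = norm x"
proof -
  have "imat *v x = \<i> *s x"
    by (simp add: vec_eq_iff imat_vec_nth)
  then show ?thesis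
    by (simp add: norm_smult)
qed

text \<open>Only the imaginary part of the coefficient changes the modulus, so the real roots drop
  out of the energy.\<close>

lemma inner_ii_mult: "z \<bullet> (\<i> * a * z) = - Im a * (cmod z)\<^sup>2"
  unfolding cmod_power2 by (simp add: inner_complex_def power2_eq_square algebra_simps)

lemma decay_weight:
  fixes r c :: real
  assumes "0 < r" "0 \<le> t"
  shows "((\<lambda>t. - (c / (r * (1 + t)))) has_real_derivative c / (r * (1 + t)\<^sup>2)) (at t within S)"
proof -
  have "((\<lambda>t. - (c / r) * inverse (1 + t)) has_real_derivative - (c / r) * - (inverse (1 + t) * 1 * inverse (1 + t))) (at t within S)"
    by (rule DERIV_cmult, rule DERIV_inverse') (use assms in \<open>auto intro!: derivative_eq_intros\<close>)
  then show ?thesis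
    by (simp add: divide_inverse power2_eq_square mult_ac)
qed

text \<open>The remainder has finite mass up to infinity, at most c/(r (1 + a)); with r = |\<xi>|
  this makes the Gronwall constants independent of \<xi> and of the length of the interval.\<close>

lemma decay_weight_le:
  fixes r c \<Theta> :: real
  assumes "0 < r" "0 \<le> a" "a \<le> b" "0 \<le> c" "0 < \<Theta>" "\<Theta> \<le> (1 + a) * r"
  shows "- (c / (r * (1 + b))) - - (c / (r * (1 + a))) \<le> c / \<Theta>"
proof -
  have "0 \<le> c / (r * (1 + b))"
    using assms by simp
  moreover have "c / (r * (1 + a)) \<le> c / \<Theta>"
    using assms by (intro divide_left_mono) (auto simp: mult.commute)
  ultimately show ?thesis
    by simp
qed

context diagonalised
begin

section \<open>Phases and bounds below and above a threshold of |\<xi>| (1+t)\<close>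

lemma Zhyp_mono: "(s, \<xi>) \<in> Zhyp N \<Longrightarrow> s \<le> t \<Longrightarrow> (t, \<xi>) \<in> Zhyp N"
  using slice_obtain[of s \<xi> N] N by (metis atLeast_iff mem_Collect_eq order_trans)

lemma Icc_subset_slice: "(s, \<xi>) \<in> Zhyp N \<Longrightarrow> {s..t} \<subseteq> slice N \<xi>"
  using Zhyp_mono by auto

text \<open>The phase is integrated from the left end of the slice, but only its differences
  matter.\<close>

definition phi :: "real^'n \<Rightarrow> 'm \<Rightarrow> real \<Rightarrow> real" where
  "phi \<xi> j t = integral {max 0 (N / norm \<xi> - 1)..t} (\<lambda>s. Im (F s \<xi> $ j $ j))"

lemma phi_deriv:
  assumes Z: "(t, \<xi>) \<in> Zhyp N"
  shows "(phi \<xi> j has_real_derivative Im (F t \<xi> $ j $ j)) (at t within slice N \<xi>)"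
proof -
  define a where "a = max 0 (N / norm \<xi> - 1)"
  have slice: "slice N \<xi> = {a..}"
    unfolding a_def by (rule slice_eq[OF N ZhypD(4)[OF Z N]])
  then have t: "t \<in> {a..t + 1}"
    using Z by auto
  have "continuous_on (slice N \<xi>) (\<lambda>s. F s \<xi>)"
    by (rule symb_continuous_slice[OF F_symb])
  then have "continuous_on {a..t + 1} (\<lambda>s. Im (F s \<xi> $ j $ j))"
    unfolding slice by (intro continuous_intros) (auto elim!: continuous_on_subset)
  from integral_has_vector_derivative[OF this t] show ?thesis
    unfolding slice has_real_derivative_iff_has_vector_derivative phi_def a_def[symmetric]
    by (rule has_vector_derivative_Ici) simp
qed

lemma phi_continuous: "(s, \<xi>) \<in> Zhyp N \<Longrightarrow> continuous_on {s..t} (phi \<xi> j)"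
  by (rule continuous_on_subset[OF DERIV_continuous_on Icc_subset_slice]) (use phi_deriv in auto)

lemma phi_has_integral:
  assumes "(s, \<xi>) \<in> Zhyp N" "s \<le> t"
  shows "((\<lambda>\<theta>. Im (F \<theta> \<xi> $ j $ j)) has_integral (phi \<xi> j t - phi \<xi> j s)) {s..t}"
proof (rule fundamental_theorem_of_calculus[OF assms(2)])
  fix \<theta> assume "\<theta> \<in> {s..t}"
  then have "(\<theta>, \<xi>) \<in> Zhyp N"
    using Zhyp_mono[OF assms(1)] by auto
  from phi_deriv[OF this] show "(phi \<xi> j has_vector_derivative Im (F \<theta> \<xi> $ j $ j)) (at \<theta> within {s..t})"
    unfolding has_real_derivative_iff_has_vector_derivative
    by (rule has_vector_derivative_within_subset) (rule Icc_subset_slice[OF assms(1)])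
qed

lemma cmat_Im_has_integral:
  assumes "(s, \<xi>) \<in> Zhyp N" "s \<le> t"
  shows "((\<lambda>\<theta>. cmat_Im (F \<theta> \<xi>)) has_integral
    (\<Sum>j\<in>UNIV. (phi \<xi> j t - phi \<xi> j s) *\<^sub>R (diag_mat (\<lambda>i. if i = j then 1 else 0) :: ((complex, 'm) vec, 'm) vec))) {s..t}"
proof -
  have "cmat_Im (F \<theta> \<xi>) = (\<Sum>j\<in>UNIV. Im (F \<theta> \<xi> $ j $ j) *\<^sub>R diag_mat (\<lambda>i. if i = j then 1 else 0))" for \<theta>
    unfolding F_eq cmat_Im_diag_part by (simp add: diag_part_def)
  then show ?thesis
    using phi_has_integral[OF assms] by (simp add: has_integral_sum has_integral_scaleR_left)
qed

lemma F_bound: "\<exists>c>0. \<forall>t \<xi> j. (t, \<xi>) \<in> Zhyp N \<longrightarrow> \<bar>Im (F t \<xi> $ j $ j)\<bar> \<le> c * norm \<xi>"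
proof -
  have "symb N K (0 + 1) 0 F" for K
    by (rule symb_weaken[OF N]) (use F_symb in simp)
  then obtain c where c: "0 < c" "\<And>t \<xi>. (t, \<xi>) \<in> Zhyp N \<Longrightarrow> norm (F t \<xi>) \<le> c * (norm \<xi> powr (0 + 1) * (1 + t) powr - 0)"
    using symb_bound[of N 0 "0 + 1" 0 F] by blast
  have "\<bar>Im (F t \<xi> $ j $ j)\<bar> \<le> c * norm \<xi>" if Z: "(t, \<xi>) \<in> Zhyp N" for t \<xi> j
  proof -
    have "\<bar>Im (F t \<xi> $ j $ j)\<bar> \<le> cmod (F t \<xi> $ j $ j)"
      by (rule abs_Im_le_cmod)
    also have "\<dots> \<le> norm (F t \<xi>)"
      by (intro order_trans[OF Finite_Cartesian_Product.norm_nth_le] Finite_Cartesian_Product.norm_nth_le)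
    also have "\<dots> \<le> c * norm \<xi>"
      using c(2)[OF Z] ZhypD[OF Z N] by simp
    finally show ?thesis .
  qed
  then show ?thesis
    using c(1) by blast
qed

text \<open>The integrand is at most c |\<xi>| and the interval has length at most
  \<Theta>/|\<xi>|.\<close>

lemma phi_low_zone:
  "\<exists>c>0. \<forall>s t \<xi> j \<Theta>. (s, \<xi>) \<in> Zhyp N \<longrightarrow> s \<le> t \<longrightarrow> (1 + t) * norm \<xi> \<le> \<Theta> \<longrightarrow> \<bar>phi \<xi> j t - phi \<xi> j s\<bar> \<le> c * \<Theta>"
proof -
  obtain c where c: "0 < c" "\<And>t \<xi> j. (t, \<xi>) \<in> Zhyp N \<Longrightarrow> \<bar>Im (F t \<xi> $ j $ j)\<bar> \<le> c * norm \<xi>"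
    using F_bound by blast
  have "\<bar>phi \<xi> j t - phi \<xi> j s\<bar> \<le> c * \<Theta>"
    if s: "(s, \<xi>) \<in> Zhyp N" "s \<le> t" and \<Theta>: "(1 + t) * norm \<xi> \<le> \<Theta>" for s t \<xi> j \<Theta>
  proof -
    have "norm (phi \<xi> j t - phi \<xi> j s) \<le> c * norm \<xi> * (t - s)"
      using has_integral_bound_real[OF _ _ phi_has_integral[OF s, of j], of "c * norm \<xi>" "{}"] c Zhyp_mono[OF s(1)] s(2)
      by simp
    also have "\<dots> \<le> c * (norm \<xi> * (1 + t))"
      using s ZhypD[OF s(1) N] c(1) by (simp add: mult_left_mono)
    also have "\<dots> \<le> c * \<Theta>"
      using c(1) \<Theta> by (intro mult_left_mono) (simp_all add: mult.commute)
    finally show ?thesis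
      by simp
  qed
  then show ?thesis
    using c(1) by blast
qed

text \<open>The same scaling for solutions: A is O(|\<xi>|) on the zone, so Gronwall's exponent is
  at most c \<Theta>.\<close>

lemma solution_low_zone:
  "\<exists>c>0. \<forall>s t \<xi> V \<Theta>. solution \<xi> V \<longrightarrow> (s, \<xi>) \<in> Zhyp N \<longrightarrow> s \<le> t \<longrightarrow> (1 + t) * norm \<xi> \<le> \<Theta> \<longrightarrow>
    norm (V t) \<le> exp (c * \<Theta>) * norm (V s) \<and> norm (V s) \<le> exp (c * \<Theta>) * norm (V t)"
proof -
  obtain cA where cA: "0 < cA" "\<And>t \<xi>. (t, \<xi>) \<in> Zhyp N \<Longrightarrow> norm (A t \<xi>) \<le> cA * (norm \<xi> powr 1 * (1 + t) powr - 0)"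
    using symb_bound[OF A_symb[of 0]] by blast
  obtain L where L: "0 < L" "\<And>(B :: ((complex, 'm) vec, 'm) vec) x. norm (B *v x) \<le> norm B * norm x * L"
    using norm_matrix_vector[where 'm = 'm] by blast
  define c where "c = cA * L"
  have c: "0 < c"
    using cA(1) L(1) by (simp add: c_def)
  have "norm (V t) \<le> exp (c * \<Theta>) * norm (V s) \<and> norm (V s) \<le> exp (c * \<Theta>) * norm (V t)"
    if V: "solution \<xi> V" and s: "(s, \<xi>) \<in> Zhyp N" "s \<le> t" and \<Theta>: "(1 + t) * norm \<xi> \<le> \<Theta>" for s t \<xi> V \<Theta>
  proof -
    let ?V' = "\<lambda>\<tau>. imat *v (A \<tau> \<xi> *v V \<tau>)"
    have 1: "(V has_vector_derivative ?V' \<tau>) (at \<tau> within {s..t})" if "\<tau> \<in> {s..t}" for \<tau>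
      using V Zhyp_mono[OF s(1)] that unfolding solution_def
      by (intro has_vector_derivative_within_subset[OF _ Icc_subset_slice[OF s(1)]]) auto
    have 2: "((\<lambda>\<tau>. c * norm \<xi> * \<tau>) has_real_derivative c * norm \<xi>) (at \<tau> within {s..t})" for \<tau>
      by (auto intro!: derivative_eq_intros)
    have 3: "\<bar>V \<tau> \<bullet> ?V' \<tau>\<bar> \<le> c * norm \<xi> * (norm (V \<tau>))\<^sup>2" if "\<tau> \<in> {s..t}" for \<tau>
    proof -
      have Z: "(\<tau>, \<xi>) \<in> Zhyp N"
        using Zhyp_mono[OF s(1)] that by auto
      have "\<bar>V \<tau> \<bullet> ?V' \<tau>\<bar> \<le> norm (V \<tau>) * norm (?V' \<tau>)"
        by (rule Cauchy_Schwarz_ineq2)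
      also have "\<dots> \<le> norm (V \<tau>) * (norm (A \<tau> \<xi>) * norm (V \<tau>) * L)"
        unfolding norm_imat_vec by (intro mult_left_mono L) simp
      also have "\<dots> \<le> norm (V \<tau>) * (cA * norm \<xi> * norm (V \<tau>) * L)"
        using cA(2)[OF Z] ZhypD[OF Z N] L(1) by (intro mult_left_mono mult_right_mono) auto
      finally show ?thesis
        by (simp add: c_def power2_eq_square mult_ac)
    qed
    have "c * norm \<xi> * t - c * norm \<xi> * s \<le> c * ((1 + t) * norm \<xi>)"
      using c ZhypD[OF s(1) N] s(2) by (simp add: algebra_simps)
    also have "\<dots> \<le> c * \<Theta>"
      using c \<Theta> by simp
    finally have e: "exp (c * norm \<xi> * t - c * norm \<xi> * s) \<le> exp (c * \<Theta>)"
      by simp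
    show ?thesis
      using order_trans[OF gronwall(1)[OF s(2) 1 2 3] mult_left_mono[OF e norm_ge_zero]]
        order_trans[OF gronwall(2)[OF s(2) 1 2 3] mult_left_mono[OF e norm_ge_zero]]
      by (simp add: mult.commute)
  qed
  then show ?thesis
    using c by blast
qed

lemma norm_diagonaliser:
  "\<exists>c>0. \<forall>t \<xi> V. (t, \<xi>) \<in> Zhyp N \<longrightarrow> norm (diagW \<xi> V t) \<le> c * norm (V t) \<and> norm (V t) \<le> c * norm (diagW \<xi> V t)"
proof -
  obtain L where L: "0 < L" "\<And>(B :: ((complex, 'm) vec, 'm) vec) x. norm (B *v x) \<le> norm B * norm x * L"
    using norm_matrix_vector[where 'm = 'm] by blast
  obtain c1 where c1: "0 < c1" "\<And>t \<xi>. (t, \<xi>) \<in> Zhyp N \<Longrightarrow> norm (M t \<xi>) \<le> c1 * (norm \<xi> powr 0 * (1 + t) powr - 0)"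
    using symb_bound[OF M_symb[of 0]] by blast
  obtain c2 where c2: "0 < c2" "\<And>t \<xi>. (t, \<xi>) \<in> Zhyp N \<Longrightarrow> norm (Minv t \<xi>) \<le> c2 * (norm \<xi> powr 0 * (1 + t) powr - 0)"
    using symb_bound[OF Minv_symb[of 0]] by blast
  have "norm (diagW \<xi> V t) \<le> (max c1 c2 * L) * norm (V t) \<and> norm (V t) \<le> (max c1 c2 * L) * norm (diagW \<xi> V t)"
    if Z: "(t, \<xi>) \<in> Zhyp N" for t \<xi> V
  proof -
    have "norm (M t \<xi>) \<le> max c1 c2" "norm (Minv t \<xi>) \<le> max c1 c2"
      using c1(2)[OF Z] c2(2)[OF Z] ZhypD[OF Z N] by auto
    moreover have "norm (V t) \<le> norm (M t \<xi>) * norm (diagW \<xi> V t) * L"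
      using L(2)[of "M t \<xi>" "diagW \<xi> V t"] by (simp add: diagW_def matrix_vector_mul_assoc M_Minv[OF Z])
    moreover have "norm (diagW \<xi> V t) \<le> norm (Minv t \<xi>) * norm (V t) * L"
      unfolding diagW_def by (rule L(2))
    ultimately have "norm (V t) \<le> max c1 c2 * norm (diagW \<xi> V t) * L" "norm (diagW \<xi> V t) \<le> max c1 c2 * norm (V t) * L"
      using L(1) by (auto elim!: order_trans intro!: mult_right_mono)
    then show ?thesis
      by (simp add: mult_ac)
  qed
  moreover have "0 < max c1 c2 * L"
    using c1 L by (simp add: less_max_iff_disj)
  ultimately show ?thesis
    by blast
qed

text \<open>\<open>N1\<close> is O(1/(|\<xi>| (1+t))), and the threshold 2 c L brings its operator
  norm down to 1/2. From there on X and W are comparable up to a factor 2.\<close>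

lemma high_zone:
  "\<exists>\<Theta>\<ge>N. \<forall>t \<xi> V. (t, \<xi>) \<in> Zhyp N \<longrightarrow> \<Theta> \<le> (1 + t) * norm \<xi> \<longrightarrow>
    norm (N1 t \<xi> *v V) \<le> norm V / 2"
proof -
  obtain L where L: "0 < L" "\<And>(B :: ((complex, 'm) vec, 'm) vec) x. norm (B *v x) \<le> norm B * norm x * L"
    using norm_matrix_vector[where 'm = 'm] by blast
  obtain c where c: "0 < c" "\<And>t \<xi>. (t, \<xi>) \<in> Zhyp N \<Longrightarrow> norm (N1 t \<xi>) \<le> c * (norm \<xi> powr - 1 * (1 + t) powr - 1)"
    using symb_bound[OF N1_symb[of 0]] by blast
  have "norm (N1 t \<xi> *v V) \<le> norm V / 2"
    if Z: "(t, \<xi>) \<in> Zhyp N" and \<Theta>: "max N (2 * c * L) \<le> (1 + t) * norm \<xi>" for t \<xi> V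
  proof -
    have "norm (N1 t \<xi>) \<le> c / ((1 + t) * norm \<xi>)"
      using c(2)[OF Z] ZhypD[OF Z N] by (simp add: powr_minus divide_inverse mult_ac)
    then have "norm (N1 t \<xi>) * L \<le> c / ((1 + t) * norm \<xi>) * L"
      using L(1) by (intro mult_right_mono) auto
    also have "\<dots> \<le> 1 / 2"
      using \<Theta> ZhypD[OF Z N] by (simp add: pos_divide_le_eq mult_ac)
    finally have "norm (N1 t \<xi>) * L * norm V \<le> 1 / 2 * norm V"
      by (rule mult_right_mono) simp
    then show ?thesis
      using L(2)[of "N1 t \<xi>" V] by (simp add: mult_ac)
  qed
  then show ?thesis
    by (intro exI[of _ "max N (2 * c * L)"]) auto
qed

lemma diagX_diagW:
  assumes "norm (N1 t \<xi> *v diagW \<xi> V t) \<le> norm (diagW \<xi> V t) / 2"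
  shows "norm (diagW \<xi> V t) \<le> 2 * norm (diagX \<xi> V t)" "norm (diagX \<xi> V t) \<le> 2 * norm (diagW \<xi> V t)"
  using assms norm_triangle_ineq2[of "diagW \<xi> V t" "N1 t \<xi> *v diagW \<xi> V t"]
    norm_triangle_ineq4[of "diagW \<xi> V t" "N1 t \<xi> *v diagW \<xi> V t"] norm_ge_zero[of "diagW \<xi> V t"]
  unfolding diagX_def by linarith+

lemma G_bound:
  "\<exists>c>0. \<forall>t \<xi> W. (t, \<xi>) \<in> Zhyp N \<longrightarrow> norm (G t \<xi> *v W) \<le> c / (norm \<xi> * (1 + t)\<^sup>2) * norm W"
proof -
  obtain L where L: "0 < L" "\<And>(B :: ((complex, 'm) vec, 'm) vec) x. norm (B *v x) \<le> norm B * norm x * L"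
    using norm_matrix_vector[where 'm = 'm] by blast
  obtain c where c: "0 < c" "\<And>t \<xi>. (t, \<xi>) \<in> Zhyp N \<Longrightarrow> norm (G t \<xi>) \<le> c * (norm \<xi> powr - 1 * (1 + t) powr - 2)"
    using symb_bound[OF G_symb[of 0]] by blast
  have "norm (G t \<xi> *v W) \<le> c * L / (norm \<xi> * (1 + t)\<^sup>2) * norm W" if Z: "(t, \<xi>) \<in> Zhyp N" for t \<xi> W
  proof -
    have "norm (G t \<xi>) \<le> c / (norm \<xi> * (1 + t)\<^sup>2)"
      using c(2)[OF Z] ZhypD[OF Z N] by (simp add: powr_minus divide_inverse mult_ac powr_numeral)
    then have "norm (G t \<xi>) * norm W * L \<le> c / (norm \<xi> * (1 + t)\<^sup>2) * norm W * L"
      using L(1) by (intro mult_right_mono) auto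
    then show ?thesis
      using L(2)[of "G t \<xi>" W] by (simp add: mult_ac)
  qed
  then show ?thesis
    using c L by (intro exI[of _ "c * L"]) auto
qed

text \<open>The parameter p is a reference value of the phase: at a time where the phase equals p
  the weight is 1, which keeps constants independent of \<xi>.\<close>

definition Y :: "real^'n \<Rightarrow> (real \<Rightarrow> (complex, 'm) vec) \<Rightarrow> 'm \<Rightarrow> real \<Rightarrow> real \<Rightarrow> complex" where
  "Y \<xi> V j p t = exp (phi \<xi> j t - p) *\<^sub>R (diagX \<xi> V t $ j)"

definition Y' :: "real^'n \<Rightarrow> (real \<Rightarrow> (complex, 'm) vec) \<Rightarrow> 'm \<Rightarrow> real \<Rightarrow> real \<Rightarrow> complex" where
  "Y' \<xi> V j p t = exp (phi \<xi> j t - p) *\<^sub>R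
    (\<i> * (complex_of_real (lam j t \<xi>) + F t \<xi> $ j $ j) * diagX \<xi> V t $ j + (G t \<xi> *v diagW \<xi> V t) $ j) +
    (exp (phi \<xi> j t - p) * Im (F t \<xi> $ j $ j)) *\<^sub>R (diagX \<xi> V t $ j)"

lemma Y_deriv:
  assumes Z: "(t, \<xi>) \<in> Zhyp N" and V: "solution \<xi> V"
  shows "(Y \<xi> V j p has_vector_derivative Y' \<xi> V j p t) (at t within slice N \<xi>)"
proof -
  have "((\<lambda>t. exp (phi \<xi> j t - p)) has_real_derivative exp (phi \<xi> j t - p) * Im (F t \<xi> $ j $ j)) (at t within slice N \<xi>)"
    using phi_deriv[OF Z, of j] by (auto intro!: derivative_eq_intros)
  then show ?thesis
    unfolding Y_def[abs_def] Y'_def by (rule has_vector_derivative_scaleR[OF _ diagX_nth_deriv[OF Z V]])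
qed

text \<open>The exponential factor removes the imaginary part of the diagonal, the real part does not
  contribute to the growth of the modulus.\<close>
lemma Y_inner: "Y \<xi> V j p t \<bullet> Y' \<xi> V j p t = exp (phi \<xi> j t - p) * (Y \<xi> V j p t \<bullet> (G t \<xi> *v diagW \<xi> V t) $ j)"
  unfolding Y_def Y'_def inner_scaleR_left inner_scaleR_right inner_add_right inner_ii_mult
  by (simp add: dot_square_norm algebra_simps)

lemma Y_inner_le: "\<bar>Y \<xi> V j p t \<bullet> Y' \<xi> V j p t\<bar> \<le> exp (phi \<xi> j t - p) * cmod (Y \<xi> V j p t) * norm (G t \<xi> *v diagW \<xi> V t)"
proof -
  have "\<bar>Y \<xi> V j p t \<bullet> (G t \<xi> *v diagW \<xi> V t) $ j\<bar> \<le> cmod (Y \<xi> V j p t) * cmod ((G t \<xi> *v diagW \<xi> V t) $ j)"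
    by (rule Cauchy_Schwarz_ineq2)
  also have "\<dots> \<le> cmod (Y \<xi> V j p t) * norm (G t \<xi> *v diagW \<xi> V t)"
    by (intro mult_left_mono Finite_Cartesian_Product.norm_nth_le) simp
  finally show ?thesis
    unfolding Y_inner by (simp add: abs_mult mult.assoc)
qed


section \<open>From bounded phases to bounded solutions\<close>

lemma split_time:
  assumes s: "(s, \<xi>) \<in> Zhyp N" "s \<le> t" and "N \<le> \<Theta>"
  obtains "(1 + t) * norm \<xi> \<le> \<Theta>" | "\<Theta> \<le> (1 + s) * norm \<xi>"
    | b where "s \<le> b" "b \<le> t" "(1 + b) * norm \<xi> = \<Theta>"
proof -
  have r: "0 < norm \<xi>"
    using ZhypD[OF s(1) N] by simp
  \<comment> \<open>The only time at which the increasing quantity (1 + t) |\<xi>| passes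
    \<Theta>.\<close>
  define b where "b = \<Theta> / norm \<xi> - 1"
  have b: "(1 + b) * norm \<xi> = \<Theta>"
    using r by (simp add: b_def)
  show thesis
  proof (cases "(1 + t) * norm \<xi> \<le> \<Theta> \<or> \<Theta> \<le> (1 + s) * norm \<xi>")
    case True
    then show ?thesis
      using that by blast
  next
    case False
    then have "1 + s \<le> 1 + b" "1 + b \<le> 1 + t"
      using r unfolding b[symmetric] by auto
    then show ?thesis
      using that(3)[OF _ _ b] by simp
  qed
qed

text \<open>With the phase differences bounded by B, every weight lies between exp (-B) and exp B.
  The vector of all normalised components is then comparable to V, and only the integrable remainder
  \<open>G\<close> drives its norm.\<close>

lemma high_zone_solution:
  assumes B: "\<And>s t \<xi> j. (s, \<xi>) \<in> Zhyp N \<Longrightarrow> s \<le> t \<Longrightarrow> \<bar>phi \<xi> j t - phi \<xi> j s\<bar> \<le> B"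
  shows "\<exists>\<Theta>\<ge>N. \<exists>C>0. \<forall>s t \<xi> V. solution \<xi> V \<longrightarrow> (s, \<xi>) \<in> Zhyp N \<longrightarrow> s \<le> t \<longrightarrow> \<Theta> \<le> (1 + s) * norm \<xi> \<longrightarrow>
    norm (V t) \<le> C * norm (V s) \<and> norm (V s) \<le> C * norm (V t)"
proof -
  obtain \<Theta> where \<Theta>: "N \<le> \<Theta>" "\<And>t \<xi> V. (t, \<xi>) \<in> Zhyp N \<Longrightarrow> \<Theta> \<le> (1 + t) * norm \<xi> \<Longrightarrow>
    norm (N1 t \<xi> *v V) \<le> norm V / 2"
    using high_zone by blast
  obtain \<kappa> where \<kappa>: "0 < \<kappa>" "\<And>t \<xi> W. (t, \<xi>) \<in> Zhyp N \<Longrightarrow> norm (G t \<xi> *v W) \<le> \<kappa> / (norm \<xi> * (1 + t)\<^sup>2) * norm W"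
    using G_bound by blast
  obtain d where d: "0 < d" "\<And>t \<xi> V. (t, \<xi>) \<in> Zhyp N \<Longrightarrow> norm (diagW \<xi> V t) \<le> d * norm (V t)"
    "\<And>t \<xi> V. (t, \<xi>) \<in> Zhyp N \<Longrightarrow> norm (V t) \<le> d * norm (diagW \<xi> V t)"
    using norm_diagonaliser by blast
  \<comment> \<open>q compares X with the vector y of normalised components. The rate c uses q once
    for summing the components and once, with the factor 2, for bounding W by y. In C, passing from
    V to y and back costs d, 2 and q twice each.\<close>
  define q where "q = real CARD('m) * exp B"
  define c where "c = 2 * \<kappa> * q\<^sup>2"
  define C where "C = 4 * d\<^sup>2 * q\<^sup>2 * exp (c / \<Theta>)"
  have q: "0 < q" and c: "0 < c"
    using \<kappa>(1) by (simp_all add: q_def c_def)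
  have C: "0 < C"
    using d(1) q by (simp add: C_def)
  have main: "norm (V t) \<le> C * norm (V s) \<and> norm (V s) \<le> C * norm (V t)"
    if V: "solution \<xi> V" and s: "(s, \<xi>) \<in> Zhyp N" "s \<le> t" "\<Theta> \<le> (1 + s) * norm \<xi>" for s t \<xi> V
  proof -
    define y where "y \<tau> = (\<chi> j. Y \<xi> V j (phi \<xi> j s) \<tau>)" for \<tau>
    define y' where "y' \<tau> = (\<chi> j. Y' \<xi> V j (phi \<xi> j s) \<tau>)" for \<tau>
    define h where "h \<tau> = c / (norm \<xi> * (1 + \<tau>)\<^sup>2)" for \<tau>
    have r: "0 < norm \<xi>" "0 \<le> s"
      using ZhypD[OF s(1) N] by auto
    have Z: "(\<tau>, \<xi>) \<in> Zhyp N" "\<Theta> \<le> (1 + \<tau>) * norm \<xi>" "0 \<le> \<tau>" if "\<tau> \<in> {s..t}" for \<tau>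
    proof -
      show "(\<tau>, \<xi>) \<in> Zhyp N"
        using Zhyp_mono[OF s(1)] that by auto
      have "(1 + s) * norm \<xi> \<le> (1 + \<tau>) * norm \<xi>"
        using that by (intro mult_right_mono) auto
      then show "\<Theta> \<le> (1 + \<tau>) * norm \<xi>"
        using s(3) by linarith
      show "0 \<le> \<tau>"
        using r that by auto
    qed
    have e: "exp (phi \<xi> j \<tau> - phi \<xi> j s) \<le> exp B" "1 \<le> exp B * exp (phi \<xi> j \<tau> - phi \<xi> j s)" if "\<tau> \<in> {s..t}" for j \<tau>
    proof -
      have "\<bar>phi \<xi> j \<tau> - phi \<xi> j s\<bar> \<le> B"
        using B[OF s(1)] that by simp
      then show "exp (phi \<xi> j \<tau> - phi \<xi> j s) \<le> exp B" "1 \<le> exp B * exp (phi \<xi> j \<tau> - phi \<xi> j s)"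
        by (auto simp flip: exp_add)
    qed
    have y_X: "norm (y \<tau>) \<le> q * norm (diagX \<xi> V \<tau>)" if "\<tau> \<in> {s..t}" for \<tau>
    proof -
      have "norm (y \<tau>) \<le> (\<Sum>j\<in>UNIV. norm (y \<tau> $ j))"
        by (rule norm_le_sum_nth)
      also have "\<dots> \<le> (\<Sum>j\<in>(UNIV :: 'm set). exp B * norm (diagX \<xi> V \<tau>))"
        using e[OF that] by (intro sum_mono) (auto simp: y_def Y_def intro!: mult_mono Finite_Cartesian_Product.norm_nth_le)
      finally show ?thesis
        by (simp add: q_def)
    qed
    have X_y: "norm (diagX \<xi> V \<tau>) \<le> q * norm (y \<tau>)" if "\<tau> \<in> {s..t}" for \<tau>
    proof -
      have "norm (diagX \<xi> V \<tau>) \<le> (\<Sum>j\<in>UNIV. norm (diagX \<xi> V \<tau> $ j))"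
        by (rule norm_le_sum_nth)
      also have "\<dots> \<le> (\<Sum>j\<in>(UNIV :: 'm set). exp B * norm (y \<tau>))"
      proof (rule sum_mono)
        fix j
        have "norm (diagX \<xi> V \<tau> $ j) \<le> exp B * exp (phi \<xi> j \<tau> - phi \<xi> j s) * norm (diagX \<xi> V \<tau> $ j)"
          using mult_right_mono[OF e(2)[OF that, of j], of "norm (diagX \<xi> V \<tau> $ j)"] by simp
        also have "\<dots> = exp B * norm (y \<tau> $ j)"
          by (simp add: y_def Y_def)
        also have "\<dots> \<le> exp B * norm (y \<tau>)"
          by (intro mult_left_mono Finite_Cartesian_Product.norm_nth_le) simp
        finally show "norm (diagX \<xi> V \<tau> $ j) \<le> exp B * norm (y \<tau>)" .
      qed
      finally show ?thesis
        by (simp add: q_def)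
    qed
    have W_X: "norm (diagW \<xi> V \<tau>) \<le> 2 * norm (diagX \<xi> V \<tau>)" "norm (diagX \<xi> V \<tau>) \<le> 2 * norm (diagW \<xi> V \<tau>)"
      if "\<tau> \<in> {s..t}" for \<tau>
      using diagX_diagW[OF \<Theta>(2)[OF Z(1,2)[OF that]]] by auto
    have 1: "(y has_vector_derivative y' \<tau>) (at \<tau> within {s..t})" if "\<tau> \<in> {s..t}" for \<tau>
      unfolding y_def[abs_def] y'_def
      by (intro has_vector_derivative_vec_lambda has_vector_derivative_within_subset[OF Y_deriv[OF Z(1)[OF that] V]]
          Icc_subset_slice[OF s(1)])
    have 2: "((\<lambda>\<tau>. - (c / (norm \<xi> * (1 + \<tau>)))) has_real_derivative h \<tau>) (at \<tau> within {s..t})" if "\<tau> \<in> {s..t}" for \<tau>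
      unfolding h_def by (rule decay_weight[OF r(1) Z(3)[OF that]])
    have 3: "\<bar>y \<tau> \<bullet> y' \<tau>\<bar> \<le> h \<tau> * (norm (y \<tau>))\<^sup>2" if "\<tau> \<in> {s..t}" for \<tau>
    proof -
      let ?g = "norm (G \<tau> \<xi> *v diagW \<xi> V \<tau>)"
      let ?w = "\<kappa> / (norm \<xi> * (1 + \<tau>)\<^sup>2)"
      have "\<bar>y \<tau> \<bullet> y' \<tau>\<bar> \<le> (\<Sum>j\<in>UNIV. \<bar>Y \<xi> V j (phi \<xi> j s) \<tau> \<bullet> Y' \<xi> V j (phi \<xi> j s) \<tau>\<bar>)"
        unfolding inner_vec_def y_def y'_def vec_lambda_beta by (rule sum_abs)
      also have "\<dots> \<le> (\<Sum>j\<in>(UNIV :: 'm set). exp B * norm (y \<tau>) * ?g)"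
      proof (rule sum_mono)
        fix j
        have "cmod (Y \<xi> V j (phi \<xi> j s) \<tau>) \<le> norm (y \<tau>)"
          using Finite_Cartesian_Product.norm_nth_le[of "y \<tau>" j] by (simp add: y_def)
        then show "\<bar>Y \<xi> V j (phi \<xi> j s) \<tau> \<bullet> Y' \<xi> V j (phi \<xi> j s) \<tau>\<bar> \<le> exp B * norm (y \<tau>) * ?g"
          using e(1)[OF that, of j] by (intro order_trans[OF Y_inner_le] mult_right_mono mult_mono) auto
      qed
      also have "\<dots> = q * norm (y \<tau>) * ?g"
        by (simp add: q_def)
      also have "\<dots> \<le> q * norm (y \<tau>) * (?w * (2 * (q * norm (y \<tau>))))"
      proof -
        have "?g \<le> ?w * norm (diagW \<xi> V \<tau>)"
          by (rule \<kappa>(2)[OF Z(1)[OF that]])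
        also have "\<dots> \<le> ?w * (2 * (q * norm (y \<tau>)))"
          using W_X(1)[OF that] X_y[OF that] \<kappa>(1) r Z(3)[OF that] by (intro mult_left_mono) auto
        finally show ?thesis
          using q by (intro mult_left_mono) auto
      qed
      also have "\<dots> = h \<tau> * (norm (y \<tau>))\<^sup>2"
        by (simp add: h_def c_def power2_eq_square)
      finally show ?thesis .
    qed
    define E where "E = exp (c / \<Theta>)"
    have "exp (- (c / (norm \<xi> * (1 + t))) - - (c / (norm \<xi> * (1 + s)))) \<le> E"
      unfolding E_def exp_le_cancel_iff using c r s \<Theta>(1) N by (intro decay_weight_le) auto
    then have gron: "norm (y t) \<le> norm (y s) * E" "norm (y s) \<le> norm (y t) * E"
      using order_trans[OF gronwall(1)[OF s(2) 1 2 3] mult_left_mono[OF _ norm_ge_zero]]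
        order_trans[OF gronwall(2)[OF s(2) 1 2 3] mult_left_mono[OF _ norm_ge_zero]] by blast+
    \<comment> \<open>The pair (a, b) will be (t, s) and (s, t), so one chain gives both
      inequalities.\<close>
    have "norm (V a) \<le> C * norm (V b)"
      if "a \<in> {s..t}" "b \<in> {s..t}" and ab: "norm (y a) \<le> norm (y b) * E" for a b
    proof -
      have "norm (V a) \<le> d * norm (diagW \<xi> V a)"
        by (rule d(3)[OF Z(1)[OF that(1)]])
      also have "\<dots> \<le> d * (2 * (q * norm (y a)))"
        using W_X(1)[OF that(1)] X_y[OF that(1)] d(1) by (intro mult_left_mono) auto
      also have "\<dots> \<le> d * (2 * (q * (norm (y b) * E)))"
        using ab d(1) q by (intro mult_left_mono) auto
      also have "\<dots> \<le> d * (2 * (q * ((q * (2 * (d * norm (V b)))) * E)))"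
      proof -
        have "norm (y b) \<le> q * norm (diagX \<xi> V b)"
          by (rule y_X[OF that(2)])
        also have "\<dots> \<le> q * (2 * (d * norm (V b)))"
          using q W_X(2)[OF that(2)] d(2)[OF Z(1)[OF that(2)], of V] by (intro mult_left_mono) auto
        finally show ?thesis
          using d(1) q by (intro mult_left_mono mult_right_mono) (auto simp: E_def)
      qed
      also have "\<dots> = C * norm (V b)"
        by (simp add: C_def E_def power2_eq_square)
      finally show ?thesis .
    qed
    then show ?thesis
      using gron s(2) by auto
  qed
  show ?thesis
    using \<Theta>(1) C main by blast
qed

lemma solution_bound:
  assumes B: "\<And>s t \<xi> j. (s, \<xi>) \<in> Zhyp N \<Longrightarrow> s \<le> t \<Longrightarrow> \<bar>phi \<xi> j t - phi \<xi> j s\<bar> \<le> B"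
  shows "\<exists>C>0. \<forall>s t \<xi> V. solution \<xi> V \<longrightarrow> (s, \<xi>) \<in> Zhyp N \<longrightarrow> (t, \<xi>) \<in> Zhyp N \<longrightarrow> norm (V t) \<le> C * norm (V s)"
proof -
  obtain \<Theta> C1 where \<Theta>: "N \<le> \<Theta>" and "0 < C1" and C1: "\<And>s t \<xi> V. solution \<xi> V \<Longrightarrow> (s, \<xi>) \<in> Zhyp N \<Longrightarrow> s \<le> t \<Longrightarrow> \<Theta> \<le> (1 + s) * norm \<xi> \<Longrightarrow>
    norm (V t) \<le> C1 * norm (V s) \<and> norm (V s) \<le> C1 * norm (V t)"
    using high_zone_solution[OF B] by blast
  obtain c where c: "\<And>s t \<xi> V \<Theta>. solution \<xi> V \<Longrightarrow> (s, \<xi>) \<in> Zhyp N \<Longrightarrow> s \<le> t \<Longrightarrow> (1 + t) * norm \<xi> \<le> \<Theta> \<Longrightarrow>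
    norm (V t) \<le> exp (c * \<Theta>) * norm (V s) \<and> norm (V s) \<le> exp (c * \<Theta>) * norm (V t)"
    using solution_low_zone by blast
  define C0 where "C0 = exp (c * \<Theta>)"
  \<comment> \<open>Dominates the factors of all three cases: below the threshold, above it, and
    across it.\<close>
  define C where "C = C0 + C1 + C0 * C1"
  have pos: "0 < C0" "0 < C1" "C0 \<le> C" "C1 \<le> C" "C0 * C1 \<le> C"
    using \<open>0 < C1\<close> by (auto simp: C0_def C_def)
  have main: "norm (V t) \<le> C * norm (V s) \<and> norm (V s) \<le> C * norm (V t)"
    if V: "solution \<xi> V" and s: "(s, \<xi>) \<in> Zhyp N" "s \<le> t" for s t \<xi> V
  proof -
    have weaken: "norm x \<le> C * norm y" if "norm x \<le> D * norm y" "D \<le> C" for x y :: "(complex, 'm) vec" and D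
      using that by (meson mult_right_mono norm_ge_zero order_trans)
    from s \<Theta> show ?thesis
    proof (cases rule: split_time)
      case 1
      then show ?thesis
        using c[OF V s] weaken pos unfolding C0_def by blast
    next
      case 2
      then show ?thesis
        using C1[OF V s] weaken pos by blast
    next
      case (3 b)
      have Zb: "(b, \<xi>) \<in> Zhyp N"
        by (rule Zhyp_mono[OF s(1) 3(1)])
      have 4: "norm (V b) \<le> C0 * norm (V s)" "norm (V s) \<le> C0 * norm (V b)"
        using c[OF V s(1) 3(1), of \<Theta>] 3(3) by (auto simp: C0_def)
      have 5: "norm (V t) \<le> C1 * norm (V b)" "norm (V b) \<le> C1 * norm (V t)"
        using C1[OF V Zb 3(2)] 3(3) by auto
      have "norm (V t) \<le> (C0 * C1) * norm (V s)"
        using order_trans[OF 5(1) mult_left_mono[OF 4(1), of C1]] pos by (simp add: mult_ac)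
      moreover have "norm (V s) \<le> (C0 * C1) * norm (V t)"
        using order_trans[OF 4(2) mult_left_mono[OF 5(2), of C0]] pos by (simp add: mult_ac)
      ultimately show ?thesis
        using weaken pos by blast
    qed
  qed
  \<comment> \<open>For t < s the second of the two inequalities applies with the times
    exchanged.\<close>
  then have "norm (V t) \<le> C * norm (V s)" if "solution \<xi> V" "(s, \<xi>) \<in> Zhyp N" "(t, \<xi>) \<in> Zhyp N" for s t \<xi> V
    using that by (cases "s \<le> t") auto
  moreover have "0 < C"
    using pos by linarith
  ultimately show ?thesis
    by blast
qed

section \<open>From bounded solutions to bounded phases\<close>

lemma exists_diagX:
  assumes Z: "(a, \<xi>) \<in> Zhyp N" and half: "\<And>V. norm (N1 a \<xi> *v V) \<le> norm V / 2"
  obtains V0 where "\<And>V. V a = V0 \<Longrightarrow> diagX \<xi> V a = e"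
proof -
  have "x = 0" if "(mat 1 - N1 a \<xi>) *v x = 0" for x
  proof -
    have "x = N1 a \<xi> *v x"
      using that by (simp add: matrix_mult_vec_distribs)
    then have "norm x \<le> norm x / 2"
      using half[of x] by simp
    then show ?thesis
      by simp
  qed
  \<comment> \<open>Since I - N1 is injective it has an inverse B, and the data M B e produce the
    prescribed value e of X.\<close>
  then obtain B where "B ** (mat 1 - N1 a \<xi>) = mat 1"
    using matrix_left_invertible_ker by blast
  then have B: "(mat 1 - N1 a \<xi>) ** B = mat 1"
    by (simp add: matrix_left_right_inverse)
  have "diagX \<xi> V a = e" if "V a = M a \<xi> *v (B *v e)" for V
  proof -
    have "diagW \<xi> V a = B *v e"
      unfolding diagW_def that by (simp add: matrix_vector_mul_assoc matrix_mul_assoc Minv_M[OF Z])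
    then have "diagX \<xi> V a = (mat 1 - N1 a \<xi>) *v (B *v e)"
      by (simp add: diagX_def matrix_mult_vec_distribs)
    then show ?thesis
      by (simp add: matrix_vector_mul_assoc B)
  qed
  then show thesis
    by (rule that)
qed

text \<open>Starting at a maximum \<open>a\<close> of the phase \<open>phi\<close> with the \<open>j\<close>-th unit vector, the perturbation
  stays small, so that the solution really grows like \<open>exp (phi a - phi b)\<close>. Adjoining the constant
  component \<open>1\<close> turns this inhomogeneous estimate into an instance of Gronwall's inequality.\<close>
lemma phi_bound:
  assumes K: "0 < K" and E: "\<And>\<xi> a V0. (a, \<xi>) \<in> Zhyp N \<Longrightarrow>
    \<exists>V. solution \<xi> V \<and> V a = V0 \<and> (\<forall>t. (t, \<xi>) \<in> Zhyp N \<longrightarrow> norm (V t) \<le> K * norm V0)"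
  shows "\<exists>B. \<forall>s t \<xi> j. (s, \<xi>) \<in> Zhyp N \<longrightarrow> s \<le> t \<longrightarrow> \<bar>phi \<xi> j t - phi \<xi> j s\<bar> \<le> B"
proof -
  obtain \<Theta>0 where \<Theta>0: "N \<le> \<Theta>0" "\<And>t \<xi> V. (t, \<xi>) \<in> Zhyp N \<Longrightarrow> \<Theta>0 \<le> (1 + t) * norm \<xi> \<Longrightarrow>
    norm (N1 t \<xi> *v V) \<le> norm V / 2"
    using high_zone by blast
  obtain \<kappa> where \<kappa>: "0 < \<kappa>" "\<And>t \<xi> W. (t, \<xi>) \<in> Zhyp N \<Longrightarrow> norm (G t \<xi> *v W) \<le> \<kappa> / (norm \<xi> * (1 + t)\<^sup>2) * norm W"
    using G_bound by blast
  obtain d where d: "0 < d" "\<And>t \<xi> V. (t, \<xi>) \<in> Zhyp N \<Longrightarrow> norm (diagW \<xi> V t) \<le> d * norm (V t)"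
    "\<And>t \<xi> V. (t, \<xi>) \<in> Zhyp N \<Longrightarrow> norm (V t) \<le> d * norm (diagW \<xi> V t)"
    using norm_diagonaliser by blast
  obtain cl where cl: "0 < cl" "\<And>s t \<xi> j \<Theta>. (s, \<xi>) \<in> Zhyp N \<Longrightarrow> s \<le> t \<Longrightarrow> (1 + t) * norm \<xi> \<le> \<Theta> \<Longrightarrow> \<bar>phi \<xi> j t - phi \<xi> j s\<bar> \<le> cl * \<Theta>"
    using phi_low_zone by blast
  \<comment> \<open>Bounds W along the solution with unit X at a: the data satisfy |V0| \<le> 2 d,
    and returning to W costs another d K.\<close>
  define K' where "K' = 2 * d\<^sup>2 * K"
  define c where "c = \<kappa> * K'"
  \<comment> \<open>The value 8 c makes Gronwall's exponent at most 1/8. Then |y|^2 = 2 at a leaves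
    at least 2 exp (-1/4) \<ge> 3/2 at b; removing the constant component still leaves |Y|^2 \<ge>
    1/2, more than the 1/4 used below.\<close>
  define \<Theta> where "\<Theta> = max \<Theta>0 (8 * c)"
  have K': "0 < K'" and c: "0 < c"
    using d(1) K \<kappa>(1) by (auto simp: K'_def c_def)
  have \<Theta>: "N \<le> \<Theta>" "0 < \<Theta>" "c / \<Theta> \<le> 1 / 8"
  proof -
    show "N \<le> \<Theta>"
      using \<Theta>0(1) by (simp add: \<Theta>_def)
    then show "0 < \<Theta>"
      using N by linarith
    then show "c / \<Theta> \<le> 1 / 8"
      by (simp add: pos_divide_le_eq \<Theta>_def)
  qed
  \<comment> \<open>The maximum a is one end of the interval and b the other, so forward and
    backward evolution are covered together by the two forms of Gronwall's inequality.\<close>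
  have core: "phi \<xi> j a - phi \<xi> j b \<le> ln (4 * K')"
    if l: "(l, \<xi>) \<in> Zhyp N" "l \<le> u" "\<Theta> \<le> (1 + l) * norm \<xi>" and ab: "a = l \<and> b = u \<or> a = u \<and> b = l"
      and max: "\<And>\<tau>. \<tau> \<in> {l..u} \<Longrightarrow> phi \<xi> j \<tau> \<le> phi \<xi> j a" for a b l u \<xi> j
  proof -
    have r: "0 < norm \<xi>" "0 \<le> l"
      using ZhypD[OF l(1) N] by auto
    have Z: "(\<tau>, \<xi>) \<in> Zhyp N" "0 \<le> \<tau>" and half: "\<And>V. norm (N1 \<tau> \<xi> *v V) \<le> norm V / 2" if "\<tau> \<in> {l..u}" for \<tau>
    proof -
      show Z: "(\<tau>, \<xi>) \<in> Zhyp N"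
        using Zhyp_mono[OF l(1)] that by auto
      show "0 \<le> \<tau>"
        using r that by auto
      have "(1 + l) * norm \<xi> \<le> (1 + \<tau>) * norm \<xi>"
        using that by (intro mult_right_mono) auto
      then have "\<Theta>0 \<le> (1 + \<tau>) * norm \<xi>"
        using l(3) by (simp add: \<Theta>_def)
      then show "norm (N1 \<tau> \<xi> *v V) \<le> norm V / 2" for V
        by (rule \<Theta>0(2)[OF Z])
    qed
    have in_lu: "a \<in> {l..u}" "b \<in> {l..u}"
      using ab l(2) by auto
    obtain V0 where V0: "\<And>V. V a = V0 \<Longrightarrow> diagX \<xi> V a = axis j 1"
      using exists_diagX[OF Z(1)[OF in_lu(1)] half[OF in_lu(1)]] by metis
    obtain V where V: "solution \<xi> V" "V a = V0" "\<And>t. (t, \<xi>) \<in> Zhyp N \<Longrightarrow> norm (V t) \<le> K * norm V0"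
      using E[OF Z(1)[OF in_lu(1)]] by blast
    have Xa: "diagX \<xi> V a = axis j 1"
      by (rule V0[of V, OF V(2)])
    have W_le: "norm (diagW \<xi> V \<tau>) \<le> K'" if "\<tau> \<in> {l..u}" for \<tau>
    proof -
      have "norm V0 \<le> d * norm (diagW \<xi> V a)"
        using d(3)[OF Z(1)[OF in_lu(1)], of V] V(2) by simp
      also have "\<dots> \<le> d * (2 * norm (diagX \<xi> V a))"
        using diagX_diagW(1)[OF half[OF in_lu(1)]] d(1) by (intro mult_left_mono) auto
      finally have "norm V0 \<le> 2 * d"
        by (simp add: Xa norm_axis_1)
      then have "d * (K * norm V0) \<le> d * (K * (2 * d))"
        using d(1) K by (intro mult_left_mono) auto
      moreover have "norm (diagW \<xi> V \<tau>) \<le> d * (K * norm V0)"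
        using order_trans[OF d(2)[OF Z(1)[OF that], of V] mult_left_mono[OF V(3)[OF Z(1)[OF that]]]] d(1) by simp
      ultimately show ?thesis
        by (simp add: K'_def power2_eq_square mult_ac)
    qed
    define p where "p = phi \<xi> j a"
    define y where "y \<tau> = (Y \<xi> V j p \<tau>, 1 :: real)" for \<tau>
    define h where "h \<tau> = c / (norm \<xi> * (1 + \<tau>)\<^sup>2)" for \<tau>
    have 1: "(y has_vector_derivative (Y' \<xi> V j p \<tau>, 0)) (at \<tau> within {l..u})" if "\<tau> \<in> {l..u}" for \<tau>
      unfolding y_def[abs_def]
      by (intro has_vector_derivative_Pair has_vector_derivative_const
          has_vector_derivative_within_subset[OF Y_deriv[OF Z(1)[OF that] V(1)]] Icc_subset_slice[OF l(1)])
    have 2: "((\<lambda>\<tau>. - (c / (norm \<xi> * (1 + \<tau>)))) has_real_derivative h \<tau>) (at \<tau> within {l..u})" if "\<tau> \<in> {l..u}" for \<tau>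
      unfolding h_def by (rule decay_weight[OF r(1) Z(2)[OF that]])
    have 3: "\<bar>y \<tau> \<bullet> (Y' \<xi> V j p \<tau>, 0)\<bar> \<le> h \<tau> * (norm (y \<tau>))\<^sup>2" if "\<tau> \<in> {l..u}" for \<tau>
    proof -
      have "norm (G \<tau> \<xi> *v diagW \<xi> V \<tau>) \<le> \<kappa> / (norm \<xi> * (1 + \<tau>)\<^sup>2) * norm (diagW \<xi> V \<tau>)"
        by (rule \<kappa>(2)[OF Z(1)[OF that]])
      also have "\<dots> \<le> \<kappa> / (norm \<xi> * (1 + \<tau>)\<^sup>2) * K'"
        using \<kappa>(1) r by (intro mult_left_mono W_le that) auto
      finally have g: "norm (G \<tau> \<xi> *v diagW \<xi> V \<tau>) \<le> h \<tau>"
        by (simp add: h_def c_def)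
      have "0 \<le> h \<tau>"
        using c r by (simp add: h_def)
      have "\<bar>y \<tau> \<bullet> (Y' \<xi> V j p \<tau>, 0)\<bar> \<le> exp (phi \<xi> j \<tau> - p) * cmod (Y \<xi> V j p \<tau>) * norm (G \<tau> \<xi> *v diagW \<xi> V \<tau>)"
        unfolding y_def by (simp add: inner_Pair Y_inner_le)
      \<comment> \<open>Since a maximises the phase, the weight relative to p = phi a never exceeds
        1.\<close>
      also have "\<dots> \<le> 1 * cmod (Y \<xi> V j p \<tau>) * h \<tau>"
        using max[OF that] g by (intro mult_mono) (auto simp: p_def)
      also have "\<dots> \<le> h \<tau> * (norm (y \<tau>))\<^sup>2"
      proof -
        have "(norm (y \<tau>))\<^sup>2 = (cmod (Y \<xi> V j p \<tau>))\<^sup>2 + 1"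
          by (simp add: y_def norm_Pair)
        moreover have "2 * cmod (Y \<xi> V j p \<tau>) \<le> (cmod (Y \<xi> V j p \<tau>))\<^sup>2 + 1"
          using zero_le_power2[of "cmod (Y \<xi> V j p \<tau>) - 1"] by (simp add: power2_diff)
        ultimately have "cmod (Y \<xi> V j p \<tau>) \<le> (norm (y \<tau>))\<^sup>2"
          using norm_ge_zero[of "Y \<xi> V j p \<tau>"] by linarith
        then show ?thesis
          using \<open>0 \<le> h \<tau>\<close> by (simp add: mult.commute mult_left_mono)
      qed
      finally show ?thesis .
    qed
    have "- (c / (norm \<xi> * (1 + u))) - - (c / (norm \<xi> * (1 + l))) \<le> c / \<Theta>"
      using c r l \<Theta> by (intro decay_weight_le) auto
    then have e: "exp (- (c / (norm \<xi> * (1 + u))) - - (c / (norm \<xi> * (1 + l)))) \<le> exp (1 / 8)"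
      unfolding exp_le_cancel_iff using \<Theta>(3) by linarith
    have "norm (y a) \<le> norm (y b) * exp (1 / 8)"
      using ab order_trans[OF gronwall(1)[OF l(2) 1 2 3] mult_left_mono[OF e norm_ge_zero]]
        order_trans[OF gronwall(2)[OF l(2) 1 2 3] mult_left_mono[OF e norm_ge_zero]] by blast
    then have "(norm (y a))\<^sup>2 \<le> (norm (y b) * exp (1 / 8))\<^sup>2"
      by (intro power_mono) auto
    moreover have "(norm (y a))\<^sup>2 = 2"
      by (simp add: y_def norm_Pair Y_def p_def Xa)
    moreover have "(norm (y b) * exp (1 / 8))\<^sup>2 = ((cmod (Y \<xi> V j p b))\<^sup>2 + 1) * exp (1 / 4)"
      by (simp add: y_def norm_Pair power_mult_distrib flip: exp_of_nat_mult)
    ultimately have "2 * exp (- (1 / 4)) \<le> (cmod (Y \<xi> V j p b))\<^sup>2 + 1"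
      by (simp add: exp_minus field_simps)
    moreover have "1 + - (1 / 4) \<le> exp (- (1 / 4) :: real)"
      by (rule exp_ge_add_one_self)
    ultimately have "(1 / 2)\<^sup>2 \<le> (cmod (Y \<xi> V j p b))\<^sup>2"
      by (simp add: power2_eq_square)
    then have "1 / 2 \<le> cmod (Y \<xi> V j p b)"
      by (rule power2_le_imp_le) simp
    also have "\<dots> \<le> exp (phi \<xi> j b - p) * (2 * K')"
    proof -
      have "cmod (diagX \<xi> V b $ j) \<le> norm (diagX \<xi> V b)"
        by (rule Finite_Cartesian_Product.norm_nth_le)
      also have "\<dots> \<le> 2 * K'"
        using diagX_diagW(2)[OF half[OF in_lu(2)], of V] W_le[OF in_lu(2)] by simp
      finally show ?thesis
        by (simp add: Y_def)
    qed
    finally have "exp (p - phi \<xi> j b) \<le> 4 * K'"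
      by (simp add: exp_diff field_simps)
    then show ?thesis
      using K' by (simp add: p_def ln_ge_iff)
  qed
  have high: "\<bar>phi \<xi> j t - phi \<xi> j s\<bar> \<le> \<bar>ln (4 * K')\<bar>"
    if s: "(s, \<xi>) \<in> Zhyp N" "s \<le> t" "\<Theta> \<le> (1 + s) * norm \<xi>" for s t \<xi> j
  proof -
    \<comment> \<open>The phase drops by at most ln (4 K') from its maximum to either end, so its
      values at the two ends differ by no more than that.\<close>
    obtain a where a: "a \<in> {s..t}" "\<And>\<tau>. \<tau> \<in> {s..t} \<Longrightarrow> phi \<xi> j \<tau> \<le> phi \<xi> j a"
      using continuous_attains_sup[OF _ _ phi_continuous[OF s(1), of t j]] s(2) by auto
    have "\<Theta> \<le> (1 + a) * norm \<xi>"
      using s(3) mult_right_mono[of "1 + s" "1 + a" "norm \<xi>"] a(1) by simp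
    then have "phi \<xi> j a - phi \<xi> j t \<le> ln (4 * K')"
      using a by (intro core[of a \<xi> t] Zhyp_mono[OF s(1)]) auto
    moreover have "phi \<xi> j a - phi \<xi> j s \<le> ln (4 * K')"
      using a s by (intro core[of s \<xi> a]) auto
    ultimately show ?thesis
      using a(2)[of s] a(2)[of t] s(2) by auto
  qed
  have "\<bar>phi \<xi> j t - phi \<xi> j s\<bar> \<le> \<bar>ln (4 * K')\<bar> + cl * \<Theta>"
    if s: "(s, \<xi>) \<in> Zhyp N" "s \<le> t" for s t \<xi> j
    using s \<Theta>(1)
  proof (cases rule: split_time)
    case 1
    then show ?thesis
      using cl(2)[OF s, of \<Theta> j] by simp
  next
    case 2
    then show ?thesis
      using high[OF s, of j] cl(1) \<Theta>(2) by (simp add: add_increasing2)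
  next
    case (3 b)
    have "(b, \<xi>) \<in> Zhyp N"
      by (rule Zhyp_mono[OF s(1) 3(1)])
    then show ?thesis
      using cl(2)[OF s(1) 3(1), of \<Theta> j] high[of b \<xi> t j] 3 by simp
  qed
  then show ?thesis
    by blast
qed

text \<open>The integral is diagonal with the phase differences as entries: each entry is bounded by
  the norm, and the norm by the finite sum over the entries.\<close>

lemma A3_iff_phi_bound:
  "(\<exists>B. \<forall>s t \<xi>. (s, \<xi>) \<in> Zhyp N \<longrightarrow> (t, \<xi>) \<in> Zhyp N \<longrightarrow> norm (integral {s..t} (\<lambda>\<theta>. cmat_Im (F \<theta> \<xi>))) \<le> B) \<longleftrightarrow>
    (\<exists>B. \<forall>s t \<xi> j. (s, \<xi>) \<in> Zhyp N \<longrightarrow> s \<le> t \<longrightarrow> \<bar>phi \<xi> j t - phi \<xi> j s\<bar> \<le> B)"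
proof -
  define E :: "'m \<Rightarrow> ((complex, 'm) vec, 'm) vec" where "E j = diag_mat (\<lambda>i. if i = j then 1 else 0)" for j
  have int: "integral {s..t} (\<lambda>\<theta>. cmat_Im (F \<theta> \<xi>)) = (\<Sum>j\<in>UNIV. (phi \<xi> j t - phi \<xi> j s) *\<^sub>R E j)"
    if "(s, \<xi>) \<in> Zhyp N" "s \<le> t" for s t \<xi>
    unfolding E_def by (rule integral_unique[OF cmat_Im_has_integral[OF that]])
  show ?thesis
  proof (intro iffI; elim exE)
    fix B assume B: "\<forall>s t \<xi>. (s, \<xi>) \<in> Zhyp N \<longrightarrow> (t, \<xi>) \<in> Zhyp N \<longrightarrow> norm (integral {s..t} (\<lambda>\<theta>. cmat_Im (F \<theta> \<xi>))) \<le> B"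
    have "\<bar>phi \<xi> k t - phi \<xi> k s\<bar> \<le> B" if s: "(s, \<xi>) \<in> Zhyp N" "s \<le> t" for s t \<xi> k
    proof -
      let ?S = "\<Sum>j\<in>UNIV. (phi \<xi> j t - phi \<xi> j s) *\<^sub>R E j"
      have "?S $ k $ k = (\<Sum>j\<in>UNIV. if j = k then complex_of_real (phi \<xi> k t - phi \<xi> k s) else 0)"
        unfolding sum_component by (intro sum.cong) (auto simp: E_def diag_mat_def scaleR_conv_of_real[where 'a = complex])
      then have "cmod (?S $ k $ k) = \<bar>phi \<xi> k t - phi \<xi> k s\<bar>"
        by (simp del: of_real_diff)
      moreover have "cmod (?S $ k $ k) \<le> norm ?S"
        by (rule order_trans[OF Finite_Cartesian_Product.norm_nth_le Finite_Cartesian_Product.norm_nth_le])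
      moreover have "norm ?S \<le> B"
        using B s Zhyp_mono[OF s] int[OF s] by metis
      ultimately show ?thesis
        by simp
    qed
    then show "\<exists>B. \<forall>s t \<xi> j. (s, \<xi>) \<in> Zhyp N \<longrightarrow> s \<le> t \<longrightarrow> \<bar>phi \<xi> j t - phi \<xi> j s\<bar> \<le> B"
      by blast
  next
    fix B assume B: "\<forall>s t \<xi> j. (s, \<xi>) \<in> Zhyp N \<longrightarrow> s \<le> t \<longrightarrow> \<bar>phi \<xi> j t - phi \<xi> j s\<bar> \<le> B"
    have "norm (integral {s..t} (\<lambda>\<theta>. cmat_Im (F \<theta> \<xi>))) \<le> (\<Sum>j\<in>UNIV. \<bar>B\<bar> * norm (E j))"
      if s: "(s, \<xi>) \<in> Zhyp N" for s t \<xi>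
    proof (cases "s \<le> t")
      case True
      have "norm (\<Sum>j\<in>UNIV. (phi \<xi> j t - phi \<xi> j s) *\<^sub>R E j) \<le> (\<Sum>j\<in>UNIV. \<bar>phi \<xi> j t - phi \<xi> j s\<bar> * norm (E j))"
        by (rule order_trans[OF norm_sum]) simp
      also have "\<dots> \<le> (\<Sum>j\<in>UNIV. \<bar>B\<bar> * norm (E j))"
        using B s True by (intro sum_mono mult_right_mono) (auto intro: order_trans[OF _ abs_ge_self])
      finally show ?thesis
        unfolding int[OF s True] .
    next
      \<comment> \<open>For s > t the interval {s..t} is empty and the integral is 0; the order s
        \<le> t therefore carries all the information.\<close>
      case False
      then show ?thesis
        by (simp add: sum_nonneg)
    qed
    then show "\<exists>B. \<forall>s t \<xi>. (s, \<xi>) \<in> Zhyp N \<longrightarrow> (t, \<xi>) \<in> Zhyp N \<longrightarrow> norm (integral {s..t} (\<lambda>\<theta>. cmat_Im (F \<theta> \<xi>))) \<le> B"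
      by blast
  qed
qed

end

section \<open>Equivalence of (A3) with generalised energy conservation\<close>

theorem theorem15:
  fixes N :: real
    and A A1 :: "real \<Rightarrow> real^'n \<Rightarrow> complex^'m::{finite,linorder}^'m::{finite,linorder}"
    and lam :: "'m::{finite,linorder} \<Rightarrow> real \<Rightarrow> real^'n \<Rightarrow> real"
    and cf :: "real \<Rightarrow> real"
    and \<E> :: "real \<Rightarrow> real \<Rightarrow> real^'n \<Rightarrow> complex^'m::{finite,linorder}^'m::{finite,linorder}"
  assumes N_pos: "0 < N"
    and chi_smooth: "smooth_real cf"
    and chi_one: "\<forall>r \<le> 1/2. cf r = 1"
    and chi_zero: "\<forall>r \<ge> 1. cf r = 0"
    and A_smooth: "smooth_tx A"
    and A_S1: "Linf_S1 A"
    and A1: "A1_hyp N A"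
    and A2: "A2_hyp N cf A A1 lam"
    and E_init: "\<forall>s \<xi>. 0 \<le> s \<longrightarrow> \<E> s s \<xi> = mat 1"
    and E_ode: "\<forall>t s \<xi>. 0 \<le> t \<longrightarrow> 0 \<le> s \<longrightarrow>
       ((\<lambda>\<tau>. \<E> \<tau> s \<xi>) has_vector_derivative (\<chi> i j. \<i> * (A t \<xi> ** \<E> t s \<xi>) $ i $ j)) (at t within {0..})"
  shows "A3_hyp N A A1 lam \<longleftrightarrow>
    (\<exists>C>0. \<forall>V t s \<xi>. (t, \<xi>) \<in> Zhyp N \<longrightarrow> (s, \<xi>) \<in> Zhyp N \<longrightarrow>
        norm V / C \<le> norm (\<E> t s \<xi> *v V) \<and> norm (\<E> t s \<xi> *v V) \<le> C * norm V)"
proof -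
  \<comment> \<open>\<open>cf\<close> vanishes from 1 on, and on the zone its argument is at least
    1.\<close>
  have chi: "chi_hyp cf N t \<xi> = 1" if "(t, \<xi>) \<in> Zhyp N" for t and \<xi> :: "real^'n"
  proof -
    have "1 \<le> norm \<xi> * (1 + t) / N"
      using ZhypD[OF that N_pos] N_pos by (simp add: pos_le_divide_eq mult.commute)
    then show ?thesis
      using chi_zero by (simp add: chi_hyp_def)
  qed
  note A2' = A2[unfolded A2_hyp_def]
  note A1_hom = A2'[THEN conjunct1]
    and A1_diff = A2'[THEN conjunct2, THEN conjunct1]
    and A1_eig = A2'[THEN conjunct2, THEN conjunct2, THEN conjunct1]
    and lam_less = A2'[THEN conjunct2, THEN conjunct2, THEN conjunct2, THEN conjunct1]
    and lam_symb0 = A2'[THEN conjunct2, THEN conjunct2, THEN conjunct2, THEN conjunct2, THEN conjunct1]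
    and lam_far = A2'[THEN conjunct2, THEN conjunct2, THEN conjunct2, THEN conjunct2, THEN conjunct2]
  have A_symb0: "symb0inf Zall N 1 0 A"
    using A1 unfolding A1_hyp_def by (rule conjunct1)
  interpret hyperbolic_principal N A A1 lam
  proof
    show "0 < N"
      by fact
    show "continuous_on ({0..} \<times> UNIV) (\<lambda>(t, \<xi>). A t \<xi>)"
      using A_smooth[unfolded smooth_tx_def, THEN conjunct1, rule_format, of "[]"] by simp
    show "symb N K 1 0 A" for K
      by (rule symb0inf_symb[OF A_symb0 _ N_pos]) (auto simp: Zall_def Zhyp_def)
    show "A1 t (\<rho> *\<^sub>R \<xi>) = \<rho> *\<^sub>R A1 t \<xi>" if "0 < \<rho>" for \<rho> t \<xi>
      using A1_hom that by blast
    show "symb N K 0 1 (\<lambda>t \<xi>. A t \<xi> - A1 t \<xi>)" for K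
    proof (rule symb_cong)
      show "symb N K 0 1 (\<lambda>t \<xi>. A t \<xi> - chi_hyp cf N t \<xi> *\<^sub>R A1 t \<xi>)"
        by (rule symb0inf_symb[OF A1_diff order_refl N_pos])
    qed (simp add: chi)
    show "{\<zeta>. is_eigenvalue (A1 t \<xi>) \<zeta>} = {complex_of_real (lam i t \<xi>) | i. True}" if "(t, \<xi>) \<in> Zhyp N" for t \<xi>
      using bspec[OF A1_eig that] by simp
    show "inj (\<lambda>i. lam i t \<xi>)" if "(t, \<xi>) \<in> Zhyp N" for t \<xi>
    proof (rule linorder_injI)
      fix i j :: 'm assume "i < j"
      then have "lam i t \<xi> < lam j t \<xi>"
        using bspec[OF lam_less that] by simp
      then show "lam i t \<xi> \<noteq> lam j t \<xi>"
        by simp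
    qed
    show "symb N K 1 0 (lam i)" for K i
      by (rule symb0inf_symb[OF lam_symb0[rule_format] order_refl N_pos])
    show "\<exists>\<delta>>0. \<forall>\<^sub>F t in at_top. \<forall>\<omega>. norm \<omega> = 1 \<longrightarrow> \<delta> \<le> \<bar>lam i t \<omega> - lam j t \<omega>\<bar>" if "i \<noteq> j" for i j
      using lam_far that by simp
  qed
  \<comment> \<open>Stated for every diagonaliser, as the two implications interpret the locale with
    different ones.\<close>
  have solution_E: "diagonalised.solution N A \<xi> (\<lambda>\<tau>. \<E> \<tau> s \<xi> *v V)"
    if D: "diagonalised N A A1 lam M Minv" and Z: "(s, \<xi>) \<in> Zhyp N" for M Minv s \<xi> V
    unfolding diagonalised.solution_def[OF D]
  proof (intro allI impI)
    fix t assume "(t, \<xi>) \<in> Zhyp N"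
    then have "0 \<le> t" "0 \<le> s"
      using Z by (auto simp: Zhyp_def)
    then have "((\<lambda>\<tau>. \<E> \<tau> s \<xi>) has_vector_derivative (\<chi> i j. \<i> * (A t \<xi> ** \<E> t s \<xi>) $ i $ j)) (at t within {0..})"
      using E_ode by blast
    also have "(\<chi> i j. \<i> * (A t \<xi> ** \<E> t s \<xi>) $ i $ j) = imat ** (A t \<xi> ** \<E> t s \<xi>)"
      by (simp add: vec_eq_iff imat_nth)
    finally have "((\<lambda>\<tau>. \<E> \<tau> s \<xi> *v V) has_vector_derivative (imat ** (A t \<xi> ** \<E> t s \<xi>)) *v V) (at t within {0..})"
      by (rule bounded_linear.has_vector_derivative[OF bounded_bilinear.bounded_linear_left[OF bounded_bilinear_matrix_vector]])
    then have "((\<lambda>\<tau>. \<E> \<tau> s \<xi> *v V) has_vector_derivative imat *v (A t \<xi> *v (\<E> t s \<xi> *v V))) (at t within {0..})"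
      by (simp add: matrix_vector_mul_assoc)
    then show "((\<lambda>\<tau>. \<E> \<tau> s \<xi> *v V) has_vector_derivative imat *v (A t \<xi> *v (\<E> t s \<xi> *v V))) (at t within slice N \<xi>)"
      by (rule has_vector_derivative_within_subset) (auto simp: Zhyp_def)
  qed
  have E_id: "\<E> s s \<xi> *v V = V" if "(s, \<xi>) \<in> Zhyp N" for s \<xi> V
    using E_init that by (simp add: Zhyp_def)
  show ?thesis
  proof
    assume "A3_hyp N A A1 lam"
    then obtain M Minv B where
      M: "\<And>t \<xi>. (t, \<xi>) \<in> Zhyp N \<Longrightarrow> M t \<xi> ** Minv t \<xi> = mat 1 \<and> Minv t \<xi> ** M t \<xi> = mat 1 \<and>
        A1 t \<xi> ** M t \<xi> = M t \<xi> ** diag_mat (\<lambda>i. complex_of_real (lam i t \<xi>))"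
      and symb: "symb0inf (Zhyp N) N 0 0 M" "symb0inf (Zhyp N) N 0 0 Minv"
      and B: "\<forall>s t \<xi>. (s, \<xi>) \<in> Zhyp N \<longrightarrow> (t, \<xi>) \<in> Zhyp N \<longrightarrow>
        norm (integral {s..t} (\<lambda>\<theta>. cmat_Im (F0 N A A1 M Minv \<theta> \<xi>))) \<le> B"
      unfolding A3_hyp_def by blast
    interpret D: diagonalised N A A1 lam M Minv
      by unfold_locales (use M symb0inf_symb[OF symb(1) order_refl N_pos] symb0inf_symb[OF symb(2) order_refl N_pos] in auto)
    obtain B' where "\<And>s t \<xi> j. (s, \<xi>) \<in> Zhyp N \<Longrightarrow> s \<le> t \<Longrightarrow> \<bar>D.phi \<xi> j t - D.phi \<xi> j s\<bar> \<le> B'"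
      using D.A3_iff_phi_bound B by blast
    from D.solution_bound[OF this] obtain C where C: "0 < C"
      "\<And>s t \<xi> V. D.solution \<xi> V \<Longrightarrow> (s, \<xi>) \<in> Zhyp N \<Longrightarrow> (t, \<xi>) \<in> Zhyp N \<Longrightarrow> norm (V t) \<le> C * norm (V s)"
      by blast
    \<comment> \<open>The lower bound is the upper bound for the same solution read from t back to
      s.\<close>
    have "norm V / C \<le> norm (\<E> t s \<xi> *v V) \<and> norm (\<E> t s \<xi> *v V) \<le> C * norm V"
      if "(t, \<xi>) \<in> Zhyp N" "(s, \<xi>) \<in> Zhyp N" for V t s \<xi>
      using C(2)[OF solution_E[OF D.diagonalised_axioms that(2), of V] that(2,1)]
        C(2)[OF solution_E[OF D.diagonalised_axioms that(2), of V] that] E_id[OF that(2), of V] C(1)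
      by (simp add: pos_divide_le_eq mult.commute)
    then show "\<exists>C>0. \<forall>V t s \<xi>. (t, \<xi>) \<in> Zhyp N \<longrightarrow> (s, \<xi>) \<in> Zhyp N \<longrightarrow>
        norm V / C \<le> norm (\<E> t s \<xi> *v V) \<and> norm (\<E> t s \<xi> *v V) \<le> C * norm V"
      using C(1) by blast
  next
    assume "\<exists>C>0. \<forall>V t s \<xi>. (t, \<xi>) \<in> Zhyp N \<longrightarrow> (s, \<xi>) \<in> Zhyp N \<longrightarrow>
        norm V / C \<le> norm (\<E> t s \<xi> *v V) \<and> norm (\<E> t s \<xi> *v V) \<le> C * norm V"
    then obtain C where C: "0 < C" "\<And>V t s \<xi>. (t, \<xi>) \<in> Zhyp N \<Longrightarrow> (s, \<xi>) \<in> Zhyp N \<Longrightarrow> norm (\<E> t s \<xi> *v V) \<le> C * norm V"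
      by blast
    obtain M Minv where M: "\<And>t \<xi>. (t, \<xi>) \<in> Zhyp N \<Longrightarrow> M t \<xi> ** Minv t \<xi> = mat 1 \<and> Minv t \<xi> ** M t \<xi> = mat 1 \<and>
        A1 t \<xi> ** M t \<xi> = M t \<xi> ** diag_mat (\<lambda>i. complex_of_real (lam i t \<xi>))"
      and symb: "\<And>K. symb N K 0 0 M" "\<And>K. symb N K 0 0 Minv"
      using diagonaliser_exists by blast
    interpret D: diagonalised N A A1 lam M Minv
      by unfold_locales (use M symb in auto)
    \<comment> \<open>The energy bound also covers times before a, so the solution is controlled on
      both sides of its starting point, as needed when a is a maximum inside an interval.\<close>
    have "\<exists>V. D.solution \<xi> V \<and> V a = V0 \<and> (\<forall>t. (t, \<xi>) \<in> Zhyp N \<longrightarrow> norm (V t) \<le> C * norm V0)"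
      if "(a, \<xi>) \<in> Zhyp N" for \<xi> a V0
      using solution_E[OF D.diagonalised_axioms that, of V0] E_id[OF that] C(2)[OF _ that]
      by (intro exI[of _ "\<lambda>\<tau>. \<E> \<tau> a \<xi> *v V0"]) simp
    from D.phi_bound[OF C(1) this] have "\<exists>B. \<forall>s t \<xi>. (s, \<xi>) \<in> Zhyp N \<longrightarrow> (t, \<xi>) \<in> Zhyp N \<longrightarrow>
        norm (integral {s..t} (\<lambda>\<theta>. cmat_Im (F0 N A A1 M Minv \<theta> \<xi>))) \<le> B"
      unfolding D.A3_iff_phi_bound .
    then show "A3_hyp N A A1 lam"
      unfolding A3_hyp_def using M symb_imp_symb0inf[OF symb(1) N_pos] symb_imp_symb0inf[OF symb(2) N_pos]
      by (intro exI[of _ M] exI[of _ Minv]) auto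
  qed
qed

end
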